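(* Let $n\ge 2$ and let $E$ be a subset of the unit sphere $\partial B_1(0)\subset\mathbb{R}^n$ which is not contained in any hyperplane in $\mathbb{R}^n$. Then there exists a convex admissible maximal solution $u\in C^{0,1}(\mathbb{R}^n)$ on $\mathbb{R}^n$ of $$\det D^2u=(1-|Du|^2)^{\frac{n+2}{2}}$$ satisfying $$\overline{Du(\mathbb{R}^n)}=\Gamma(E),$$ where $\Gamma(E)$ denotes the convex hull of $E$, and $$V_u(x)=V_E(x):=\sup_{\alpha\in E}\alpha\cdot x,\qquad x\in\mathbb{R}^n .$$
   Context: $Du$ and $D^2u$ denote the ordinary gradient and Hessian of $u$, and $B_1(0)$ is the unit ball of $\mathbb{R}^n$ centered at the origin. The blowdown of $u$ at infinity is $V_u(x)=\lim_{r\to\infty}u(rx)/r$. Admissible maximal solutions. A function $w$ is weakly spacelike if $|Dw|\le 1$. For a domain $\Omega\subseteq\mathbb{R}^n$ and a nonnegative function $\psi$ defined on $\Omega\times\mathbb{R}$ (here $\psi\equiv1$), $\mathcal{A}[\psi,\Omega]$ denotes the collection of weakly spacelike, locally convex subsolutions (in the viscosity sense) in $C^0(\overline\Omega)$ of the equation $\det D^2w=\psi(x,w)(1-|Dw|^2)^{\frac{n+2}{2}}$. A function $u\in\mathcal{A}[\psi,\Omega]$ is an admissible maximal solution of this equation in $\Omega$ if $$\int_{\Omega'}\sqrt{1-|Du|^2}\,dx\ \ge\ \int_{\Omega'}\sqrt{1-|Dv|^2}\,dx$$ for any bounded subdomain $\Omega'$ of $\Omega$ and any $v\in\mathcal{A}[\psi,\Omega']$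 with $u=v$ on $\partial\Omega'$.
   Formalization: Γ(E) is taken to be the closed convex hull of E: for non-closed E (e.g. the sphere minus a point) the plain convex hull need not be closed and so cannot equal the closure of Du(R^n); where the convex hull is closed (e.g. E closed) the two agree. *)

theory Defs
  imports "HOL-Analysis.Analysis"
begin

text \<open>
  Functions on a domain \<open>\<Omega>\<close> or on its closure are represented by total functions; only their values
  on \<open>closure \<Omega>\<close> matter below.
\<close>

definition is_domain :: "'a::topological_space set \<Rightarrow> bool" where
  "is_domain \<Omega> \<longleftrightarrow> open \<Omega> \<and> connected \<Omega> \<and> \<Omega> \<noteq> {}"

text \<open>Both \<open>grad\<close> and \<open>hessian\<close> carry information only where the derivative in question exists.\<close>

definition grad :: "(real^'n \<Rightarrow> real) \<Rightarrow> real^'n \<Rightarrow> real^'n" where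
  "grad f x = (THE D. GDERIV f x :> D)"

definition hessian :: "(real^'n \<Rightarrow> real) \<Rightarrow> real^'n \<Rightarrow> real^'n^'n" where
  "hessian f x = matrix (frechet_derivative (grad f) (at x))"

definition C2_on :: "(real^'n) set \<Rightarrow> (real^'n \<Rightarrow> real) \<Rightarrow> bool" where
  "C2_on U f \<longleftrightarrow>
     (\<forall>x\<in>U. f differentiable (at x)) \<and> (\<forall>x\<in>U. grad f differentiable (at x)) \<and>
     continuous_on U (hessian f)"

text \<open>
  \<open>|Dw| \<le> 1\<close> is read for a locally Lipschitz \<open>w\<close>, whose gradient exists almost everywhere by
  Rademacher's theorem. For such \<open>w\<close> the bound holds at almost every point if and only if it holds
  at every point of differentiability.
\<close>

definition weakly_spacelike :: "(real^'n) set \<Rightarrow> (real^'n \<Rightarrow> real) \<Rightarrow> bool" where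
  "weakly_spacelike \<Omega> w \<longleftrightarrow>
     (\<forall>x\<in>\<Omega>. \<exists>r>0. \<exists>L. L-lipschitz_on (ball x r \<inter> \<Omega>) w) \<and>
     (\<forall>x\<in>\<Omega>. w differentiable (at x) \<longrightarrow> norm (grad w x) \<le> 1)"

definition locally_convex :: "(real^'n) set \<Rightarrow> (real^'n \<Rightarrow> real) \<Rightarrow> bool" where
  "locally_convex \<Omega> w \<longleftrightarrow> (\<forall>x\<in>\<Omega>. \<exists>r>0. ball x r \<subseteq> \<Omega> \<and> convex_on (ball x r) w)"

text \<open>
  Viscosity subsolutions of \<open>det D\<^sup>2w = \<psi>(x, w) (1 - |Dw|\<^sup>2)\<^bsup>(n+2)/2\<^esup>\<close>, tested by \<open>C\<^sup>2\<close> functions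
  touching from above. The definition is used only for \<open>w\<close> that are weakly spacelike and locally
  convex. For these, a test function \<open>\<phi>\<close> at \<open>x\<close> automatically satisfies \<open>|D\<phi>(x)| \<le> 1\<close> and has a
  positive semidefinite Hessian at \<open>x\<close>. Hence the base of the power is nonnegative, and
  restricting to convex test functions would make no difference.
\<close>

definition viscosity_subsolution ::
    "(real^'n \<Rightarrow> real \<Rightarrow> real) \<Rightarrow> (real^'n) set \<Rightarrow> (real^'n \<Rightarrow> real) \<Rightarrow> bool" where
  "viscosity_subsolution \<psi> \<Omega> w \<longleftrightarrow>
     (\<forall>x\<in>\<Omega>. \<forall>\<phi>. \<forall>r>0.
        ball x r \<subseteq> \<Omega> \<and> C2_on (ball x r) \<phi> \<and> (\<forall>y\<in>ball x r. w y - \<phi> y \<le> w x - \<phi> x) \<longrightarrow>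
        det (hessian \<phi> x) \<ge>
          \<psi> x (w x) * (1 - (norm (grad \<phi> x))\<^sup>2) powr ((real CARD('n) + 2) / 2))"

definition admissible ::
    "(real^'n \<Rightarrow> real \<Rightarrow> real) \<Rightarrow> (real^'n) set \<Rightarrow> (real^'n \<Rightarrow> real) set" where
  "admissible \<psi> \<Omega> =
     {w. continuous_on (closure \<Omega>) w \<and> weakly_spacelike \<Omega> w \<and> locally_convex \<Omega> w \<and>
         viscosity_subsolution \<psi> \<Omega> w}"

definition spacelike_area :: "(real^'n) set \<Rightarrow> (real^'n \<Rightarrow> real) \<Rightarrow> real" where
  "spacelike_area \<Omega> w = (LINT x:\<Omega>|lebesgue. sqrt (1 - (norm (grad w x))\<^sup>2))"

definition admissible_maximal_solution ::
    "(real^'n \<Rightarrow> real \<Rightarrow> real) \<Rightarrow> (real^'n) set \<Rightarrow> (real^'n \<Rightarrow> real) \<Rightarrow> bool" where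
  "admissible_maximal_solution \<psi> \<Omega> u \<longleftrightarrow>
     u \<in> admissible \<psi> \<Omega> \<and>
     (\<forall>\<Omega>' v. is_domain \<Omega>' \<and> bounded \<Omega>' \<and> \<Omega>' \<subseteq> \<Omega> \<and> v \<in> admissible \<psi> \<Omega>' \<and>
              (\<forall>x\<in>frontier \<Omega>'. u x = v x) \<longrightarrow>
              spacelike_area \<Omega>' u \<ge> spacelike_area \<Omega>' v)"

text \<open>\<open>Du(\<Omega>)\<close>, the set of values of the ordinary gradient at the points where it exists.\<close>

definition gradient_image :: "(real^'n \<Rightarrow> real) \<Rightarrow> (real^'n) set \<Rightarrow> (real^'n) set" where
  "gradient_image u \<Omega> = grad u ` {x\<in>\<Omega>. u differentiable (at x)}"

text \<open>The limit \<open>V\<^sub>u = V\<close> is stated as convergence, so that its existence is part of the claim.\<close>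

definition has_blowdown :: "(real^'n \<Rightarrow> real) \<Rightarrow> (real^'n \<Rightarrow> real) \<Rightarrow> bool" where
  "has_blowdown u V \<longleftrightarrow> (\<forall>x. ((\<lambda>r. u (r *\<^sub>R x) / r) \<longlongrightarrow> V x) at_top)"

text \<open>
  \<open>\<Gamma>(E)\<close> is the closed convex hull: \<open>E\<close> is not assumed closed, while \<open>\<Gamma>(E)\<close> is to be equal to a
  closed set. For closed \<open>E\<close> in the unit sphere this is the ordinary convex hull.
\<close>

definition closed_convex_hull :: "(real^'n) set \<Rightarrow> (real^'n) set" where
  "closed_convex_hull E = closure (convex hull E)"

definition support_fun :: "(real^'n) set \<Rightarrow> real^'n \<Rightarrow> real" where
  "support_fun E x = (SUP \<alpha>\<in>E. \<alpha> \<bullet> x)"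

end

theory Submission
  imports Defs
begin

text \<open>
  The solution is the largest function in the class of convex subsolutions whose increments are
  bounded by \<open>V\<^sub>E\<close> and which lie below the hyperboloid \<open>sqrt (4 + |x|\<^sup>2)\<close>, a strict supersolution.
  The class contains \<open>V\<^sub>E\<close>. If an admissible competitor \<open>v\<close> agrees with \<open>u\<close> on the boundary of a
  bounded domain, then \<open>max u v\<close>, continued by \<open>u\<close>, is again in the class, so \<open>v \<le> u\<close>. For a convex
  function \<open>u\<close> this ordering of the functions implies the ordering of the areas: cutting \<open>v\<close> from
  below by a spacelike plane does not decrease the area, because the area integrand is concave and the
  gradient of a compactly supported function has mean zero, and countably many cuts turn \<open>v\<close> into \<open>u\<close>.

  The gradients of \<open>u\<close> are dense in \<open>\<Gamma>(E)\<close>, since otherwise \<open>u\<close> would have so many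
  subgradients at points of a null set that a quadratic polynomial with a large Hessian determinant
  could be inserted below \<open>u\<close>, and lifting it slightly would give a larger subsolution.
\<close>

text \<open>The equation is never solved, and no comparison principle between viscosity sub- and
  supersolutions is used. The barrier serves because the other conditions on the class survive the
  addition of constants; its strictness reduces comparison with it to one touching point.

  Increments are bounded by \<open>V_E\<close> rather than gradients by 1. For a convex function
  this says that all subgradients lie in \<Gamma>(E), and together with \<open>V_E \<le> u\<close>
  it gives the blowdown. That the bound survives gluing is not a local fact: it follows from global
  convexity and from bounded distance to \<open>u\<close>.

  As \<open>u\<close> has no known regularity beyond convexity and the Lipschitz bound, areas are
  compared for convex functions alone, using almost everywhere differentiability. The cutting planes
  are supporting planes of \<open>u\<close> with slopes shrunk below norm 1, since the area
  integrand has no finite tangent plane at slopes of norm 1.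

  For the density of the gradients, the obstacle is to turn many subgradients over a null set into
  something quantitative: two contact points much closer together than their slopes.\<close>

section \<open>Determinants of symmetric matrices\<close>

text \<open>Maximize the Rayleigh quotient over the unit sphere of the orthogonal complement of
  \<open>B\<close>. The complement is invariant under \<open>H\<close> because \<open>H\<close> is
  symmetric and \<open>B\<close> consists of eigenvectors.\<close>

lemma symmetric_eigenvector_step:
  fixes H :: "real^'n^'n"
  assumes sym: "\<And>x y. x \<bullet> (H *v y) = (H *v x) \<bullet> y"
    and B: "\<And>b. b \<in> B \<Longrightarrow> H *v b = l b *\<^sub>R b" and nspan: "span B \<noteq> UNIV"
  obtains x c where "norm x = 1" "\<And>b. b \<in> B \<Longrightarrow> b \<bullet> x = 0" "H *v x = c *\<^sub>R x"
proof -
  define S where "S = {x. \<forall>b\<in>B. b \<bullet> x = 0}"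
  have S: "subspace S" unfolding S_def subspace_def by (auto simp: inner_add_right)
  have clS: "closed S"
    by (rule closed_subspace[OF S])
  obtain z where z: "z \<noteq> 0" "\<And>x. x \<in> span B \<Longrightarrow> orthogonal z x"
    using orthogonal_to_subspace_exists_gen[of B UNIV] nspan
    by (metis psubsetI span_UNIV subset_UNIV)
  have zS: "z \<in> S" unfolding S_def using z(2) span_base
    by (auto simp: orthogonal_def inner_commute)
  let ?K = "S \<inter> sphere 0 1"
  have "compact ?K" by (simp add: clS closed_Int_compact)
  moreover have "(1 / norm z) *\<^sub>R z \<in> ?K"
    using zS S z(1) by (auto simp: subspace_scale)
  moreover have "continuous_on ?K (\<lambda>x. x \<bullet> (H *v x))"
    by (intro continuous_intros linear_continuous_on_compose[OF continuous_on_id]) auto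
  ultimately obtain x where x: "x \<in> ?K" "\<And>y. y \<in> ?K \<Longrightarrow> y \<bullet> (H *v y) \<le> x \<bullet> (H *v x)"
    using continuous_attains_sup[of ?K "\<lambda>x. x \<bullet> (H *v x)"] by blast
  define c where "c = x \<bullet> (H *v x)"
  have nx: "norm x = 1" "x \<bullet> x = 1" using x(1) by (auto simp: norm_eq_1)
  have le: "y \<bullet> (H *v y) \<le> c * (y \<bullet> y)" if "y \<in> S" for y
  proof (cases "y = 0")
    case False
    have "(1 / norm y) *\<^sub>R y \<in> ?K" using that S False by (auto simp: subspace_scale)
    from x(2)[OF this] have "(y \<bullet> (H *v y)) / (norm y)\<^sup>2 \<le> c"
      by (simp add: c_def matrix_vector_mult_scaleR power2_eq_square)
    then show ?thesis using False
      by (simp add: divide_le_eq power2_norm_eq_inner)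
  qed auto
  define y where "y = H *v x - c *\<^sub>R x"
  have xS: "x \<in> S" using x by auto
  have "H *v x \<in> S"
    unfolding S_def using xS by (auto simp: sym B S_def)
  then have yS: "y \<in> S" unfolding y_def using xS S by (simp add: subspace_diff subspace_scale)
  \<comment> \<open>\<open>y\<close> is the residual of \<open>x\<close>. Moving from
    \<open>x\<close> along \<open>t y\<close> gains \<open>2 t |y|^2\<close> to first order, which
    for small \<open>t\<close> outweighs the second-order term and would beat the maximum unless
    \<open>y = 0\<close>.\<close>
  have key: "2 * t * (y \<bullet> y) \<le> t\<^sup>2 * (c * (y \<bullet> y) - y \<bullet> (H *v y))" for t
  proof -
    have "x + t *\<^sub>R y \<in> S" using xS yS S by (simp add: subspace_add subspace_scale)
    from le[OF this]
    have "c + 2 * t * (y \<bullet> (H *v x)) + t\<^sup>2 * (y \<bullet> (H *v y)) \<le> c * (1 + 2 * t * (y \<bullet> x) + t\<^sup>2 * (y \<bullet> y))"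
      using sym[of x y] nx(2)
      by (simp add: c_def matrix_vector_right_distrib matrix_vector_mult_scaleR inner_add_left
         inner_add_right algebra_simps power2_eq_square inner_commute)
    moreover have "y \<bullet> (H *v x) = y \<bullet> y + c * (y \<bullet> x)"
      unfolding y_def by (simp add: inner_diff_right inner_diff_left algebra_simps)
    ultimately show ?thesis by (simp add: algebra_simps)
  qed
  have "y \<bullet> y = 0"
  proof (rule ccontr)
    assume "y \<bullet> y \<noteq> 0"
    then have Y: "y \<bullet> y > 0" by simp
    define K where "K = \<bar>c * (y \<bullet> y) - y \<bullet> (H *v y)\<bar> + 1"
    have K: "K > 0" "c * (y \<bullet> y) - y \<bullet> (H *v y) \<le> K" unfolding K_def by auto
    define t where "t = (y \<bullet> y) / K"
    have t: "t > 0" "t * K = y \<bullet> y" using Y K(1) by (auto simp: t_def)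
    have "2 * t * (y \<bullet> y) \<le> t\<^sup>2 * K"
      using order_trans[OF key[of t] mult_left_mono[OF K(2), of "t\<^sup>2"]] by simp
    also have "\<dots> = t * (y \<bullet> y)" using t(2) by (simp add: power2_eq_square)
    finally show False using t(1) Y by simp
  qed
  then have "H *v x = c *\<^sub>R x" unfolding y_def by simp
  with that nx xS show thesis unfolding S_def by blast
qed

lemma symmetric_eigenbasis:
  fixes H :: "real^'n^'n"
  assumes sym: "transpose H = H"
  obtains f :: "'n \<Rightarrow> real^'n" and l where
    "\<And>i j. f i \<bullet> f j = (if i = j then 1 else 0)" "\<And>i. H *v f i = l i *\<^sub>R f i"
    "det H = prod l UNIV" "\<And>x. x = (\<Sum>i\<in>UNIV. (f i \<bullet> x) *\<^sub>R f i)"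
proof -
  have sym': "x \<bullet> (H *v y) = (H *v x) \<bullet> y" for x y
    using dot_lmul_matrix[of x H y] sym by (metis transpose_matrix_vector)
  \<comment> \<open>Grow an orthonormal family of eigenvectors one vector at a time; as long as it
    has fewer than \<open>n\<close> members its span is proper, so another eigenvector can be found
    orthogonal to it.\<close>
  have "\<exists>B l. finite B \<and> card B = k \<and> (\<forall>b\<in>B. norm b = 1 \<and> H *v b = l b *\<^sub>R b) \<and> pairwise orthogonal B"
    if "k \<le> CARD('n)" for k
    using that
  proof (induction k)
    case 0
    then show ?case by (intro exI[of _ "{}"]) auto
  next
    case (Suc k)
    then obtain B l where B: "finite B" "card B = k" "\<And>b. b\<in>B \<Longrightarrow> norm b = 1" "\<And>b. b\<in>B \<Longrightarrow> H *v b = l b *\<^sub>R b"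
      "pairwise orthogonal B" by force
    have "dim (span B) \<le> k" using B(1,2) dim_le_card'[of B] by simp
    then have "span B \<noteq> UNIV" using Suc.prems by (metis dim_UNIV DIM_cart DIM_real mult.right_neutral not_less_eq_eq)
    then obtain x c where x: "norm x = 1" "\<And>b. b \<in> B \<Longrightarrow> b \<bullet> x = 0" "H *v x = c *\<^sub>R x"
      using symmetric_eigenvector_step[OF sym' B(4)] by blast
    have xB: "x \<notin> B" using x(1) x(2)[of x] by auto
    show ?case
      apply (rule exI[of _ "insert x B"], rule exI[of _ "l(x := c)"])
      using B x xB by (auto simp: pairwise_insert orthogonal_def inner_commute pairwise_def)
  qed
  from this[OF order_refl] obtain B l where B: "finite B" "card B = CARD('n)" "\<And>b. b\<in>B \<Longrightarrow> norm b = 1" "\<And>b. b\<in>B \<Longrightarrow> H *v b = l b *\<^sub>R b"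
      "pairwise orthogonal B" by force
  obtain f where f: "bij_betw f (UNIV::'n set) B"
    using B(1,2) by (metis finite_same_card_bij finite)
  have ff: "f i \<bullet> f j = (if i = j then 1 else 0)" for i j
  proof -
    have "f i \<in> B" "f j \<in> B" using f by (auto simp: bij_betw_def)
    moreover have "i \<noteq> j \<Longrightarrow> f i \<noteq> f j" using f by (auto simp: bij_betw_def inj_eq)
    ultimately show ?thesis using B(3)[of "f i"] B(5) by (auto simp: pairwise_def orthogonal_def norm_eq_1)
  qed
  have Hf: "H *v f i = l (f i) *\<^sub>R f i" for i using B(4) f by (auto simp: bij_betw_def)
  define P :: "real^'n^'n" where "P = (\<chi> i j. f j $ i)"
  define D :: "real^'n^'n" where "D = (\<chi> i j. if i = j then l (f i) else 0)"
  have "transpose P ** P = mat 1"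
    using ff by (simp add: vec_eq_iff P_def matrix_matrix_mult_def transpose_def mat_def inner_vec_def)
  then have op: "orthogonal_matrix P" by (simp add: orthogonal_matrix)
  have "H ** P = P ** D"
  proof -
    have "(H ** P) $ i $ j = (H *v f j) $ i" for i j
      by (simp add: matrix_matrix_mult_def matrix_vector_mult_def P_def)
    moreover have "(P ** D) $ i $ j = l (f j) * f j $ i" for i j
      by (simp add: matrix_matrix_mult_def P_def D_def if_distrib cong: if_cong)
    ultimately show ?thesis by (simp add: vec_eq_iff Hf)
  qed
  then have "det H * det P = det P * det D" by (metis det_mul)
  moreover have "det P \<noteq> 0" using det_orthogonal_matrix[OF op] by auto
  moreover have "det D = (\<Prod>i\<in>UNIV. l (f i))"
    by (subst det_diagonal) (auto simp: D_def)
  ultimately have dH: "det H = (\<Prod>i\<in>UNIV. l (f i))" by simp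
  have PP: "P ** transpose P = mat 1" using op by (simp add: orthogonal_matrix_def)
  have ex: "x = (\<Sum>i\<in>UNIV. (f i \<bullet> x) *\<^sub>R f i)" for x
  proof -
    have "x = P *v (transpose P *v x)" by (simp only: matrix_vector_mul_assoc PP matrix_vector_mul_lid)
    also have "transpose P *v x = (\<chi> i. f i \<bullet> x)"
      by (simp add: vec_eq_iff P_def transpose_def matrix_vector_mult_def inner_vec_def)
    also have "P *v \<dots> = (\<Sum>i\<in>UNIV. (f i \<bullet> x) *\<^sub>R f i)"
      by (simp add: vec_eq_iff P_def matrix_vector_mult_def mult.commute)
    finally show ?thesis .
  qed
  show thesis by (rule that[OF ff Hf dH ex])
qed

lemma det_psd_nonneg:
  fixes H :: "real^'n^'n"
  assumes sym: "transpose H = H" and psd: "\<And>v. v \<bullet> (H *v v) \<ge> 0"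
  shows "det H \<ge> 0"
proof -
  obtain f :: "'n \<Rightarrow> real^'n" and l where f: "\<And>i j. f i \<bullet> f j = (if i = j then 1 else 0)" "\<And>i. H *v f i = l i *\<^sub>R f i"
    "det H = prod l UNIV" "\<And>x. x = (\<Sum>i\<in>UNIV. (f i \<bullet> x) *\<^sub>R f i)"
    by (rule symmetric_eigenbasis[OF sym]) (rule that)
  have "l i \<ge> 0" for i using psd[of "f i"] f(1)[of i i] f(2)[of i] by simp
  then show ?thesis using f(3) by (simp add: prod_nonneg)
qed

text \<open>The Rayleigh quotient at a unit vector is a convex combination of the eigenvalues, so
  some eigenvalue is at least \<open>b\<close>; the others are at least \<open>a\<close>. For
  positive \<open>a\<close>, large curvature in one direction alone thus makes the determinant
  large.\<close>

lemma det_ge_of_quadratic_bounds: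
  fixes H :: "real^'n^'n"
  assumes sym: "transpose H = H" and a: "a \<ge> 0" "\<And>v. v \<bullet> (H *v v) \<ge> a * (v \<bullet> v)"
    and e: "norm e = 1" "e \<bullet> (H *v e) \<ge> b"
  shows "det H \<ge> a ^ (CARD('n) - 1) * b"
proof -
  obtain f :: "'n \<Rightarrow> real^'n" and l where f: "\<And>i j. f i \<bullet> f j = (if i = j then 1 else 0)" "\<And>i. H *v f i = l i *\<^sub>R f i"
    "det H = prod l UNIV" "\<And>x. x = (\<Sum>i\<in>UNIV. (f i \<bullet> x) *\<^sub>R f i)"
    by (rule symmetric_eigenbasis[OF sym]) (rule that)
  have la: "l i \<ge> a" for i using a(2)[of "f i"] f(1)[of i i] f(2)[of i] by simp
  have "\<exists>i. l i \<ge> b"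
  proof (rule ccontr)
    assume "\<not> ?thesis"
    then have lb: "l i < b" for i by (simp add: not_le)
    let ?c = "\<lambda>i. f i \<bullet> e"
    have 1: "(\<Sum>i\<in>UNIV. (?c i)\<^sup>2) = 1"
    proof -
      have "1 = e \<bullet> e" using e(1) by (simp add: norm_eq_1)
      also have "\<dots> = e \<bullet> (\<Sum>i\<in>UNIV. ?c i *\<^sub>R f i)" using f(4)[of e] by simp
      also have "\<dots> = (\<Sum>i\<in>UNIV. (?c i)\<^sup>2)"
        by (simp add: inner_sum_right power2_eq_square inner_commute)
      finally show ?thesis by simp
    qed
    have "H *v e = (\<Sum>i\<in>UNIV. (?c i * l i) *\<^sub>R f i)"
      using arg_cong[OF f(4)[of e], of "\<lambda>x. H *v x"]
      by (simp add: f(2) matrix_vector_mult_scaleR matrix_vector_right_distrib vec.linear_sum)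
    then have "e \<bullet> (H *v e) = (\<Sum>i\<in>UNIV. (?c i)\<^sup>2 * l i)"
      by (simp add: inner_sum_right power2_eq_square inner_commute mult_ac)
    also have "\<dots> < (\<Sum>i\<in>UNIV. (?c i)\<^sup>2 * b)"
    proof (rule sum_strict_mono_ex1)
      show "\<forall>i\<in>UNIV. (?c i)\<^sup>2 * l i \<le> (?c i)\<^sup>2 * b" using lb by (simp add: mult_left_mono less_imp_le)
      obtain i where "?c i \<noteq> 0" using 1 by (metis (no_types, lifting) sum.neutral zero_neq_one zero_power2)
      then show "\<exists>i\<in>UNIV. (?c i)\<^sup>2 * l i < (?c i)\<^sup>2 * b" using lb by (intro bexI[of _ i]) auto
    qed auto
    also have "\<dots> = b" using 1 by (simp add: sum_distrib_right[symmetric])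
    finally show False using e(2) by simp
  qed
  then obtain i where i: "l i \<ge> b" by blast
  have "det H = l i * prod l (UNIV - {i})" unfolding f(3) by (subst prod.remove[of _ i]) auto
  moreover have "prod l (UNIV - {i}) \<ge> (\<Prod>j\<in>UNIV - {i}. a)"
    by (rule prod_mono) (use la a in auto)
  moreover have "(\<Prod>j\<in>UNIV - {i}. a) = a ^ (CARD('n) - 1)" by (simp add: card_Diff_singleton)
  moreover have "a ^ (CARD('n) - 1) \<ge> 0" using a by simp
  moreover have "l i \<ge> 0" using la[of i] a by simp
  ultimately show ?thesis using i
    by (metis mult.commute mult_left_mono mult_right_mono order_trans)
qed

text \<open>In an eigenbasis of \<open>a I + b y y^T\<close> the off-diagonal entries
  \<open>b (y . f i)(y . f j)\<close> vanish, so at most one eigenvector feels the perturbation. The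
  case of interest is the Hessian of the hyperboloid.\<close>

lemma det_rank_one_perturbation:
  fixes H :: "real^'n^'n" and y :: "real^'n"
  assumes H: "\<And>i j. H $ i $ j = (if i = j then a else 0) + b * y $ i * y $ j"
  shows "det H = a ^ (CARD('n) - 1) * (a + b * (y \<bullet> y))"
proof -
  have sym: "transpose H = H" by (simp add: vec_eq_iff transpose_def H)
  have Hv: "H *v v = a *\<^sub>R v + (b * (y \<bullet> v)) *\<^sub>R y" for v
  proof -
    have "(H *v v) $ i = a * v $ i + b * (y \<bullet> v) * y $ i" for i
    proof -
      have "(H *v v) $ i = (\<Sum>j\<in>UNIV. (if i = j then a * v $ j else 0) + b * y $ i * (y $ j * v $ j))"
        unfolding matrix_vector_mult_def by (auto simp: H algebra_simps intro!: sum.cong)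
      also have "\<dots> = a * v $ i + b * y $ i * (y \<bullet> v)"
        by (simp only: sum.distrib sum_distrib_left[symmetric] inner_vec_def inner_real_def) simp
      finally show ?thesis by simp
    qed
    then show ?thesis by (simp add: vec_eq_iff)
  qed
  obtain f :: "'n \<Rightarrow> real^'n" and l where f: "\<And>i j. f i \<bullet> f j = (if i = j then 1 else 0)" "\<And>i. H *v f i = l i *\<^sub>R f i"
    "det H = prod l UNIV" "\<And>x. x = (\<Sum>i\<in>UNIV. (f i \<bullet> x) *\<^sub>R f i)"
    by (rule symmetric_eigenbasis[OF sym]) (rule that)
  have l0: "l j = a + b * (y \<bullet> f j)\<^sup>2" for j
  proof -
    have "l j = f j \<bullet> (H *v f j)" using f(1)[of j j] f(2) by simp
    then show ?thesis using f(1)[of j j] by (simp add: Hv inner_add_right power2_eq_square inner_commute)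
  qed
  have off: "b * (y \<bullet> f j) * (y \<bullet> f i) = 0" if "i \<noteq> j" for i j
  proof -
    have "f i \<bullet> (H *v f j) = 0" using f(1)[of i j] f(2) that by simp
    then show ?thesis using f(1)[of i j] that by (simp add: Hv inner_add_right inner_commute)
  qed
  have yy: "y \<bullet> y = (\<Sum>i\<in>UNIV. (y \<bullet> f i)\<^sup>2)"
    using arg_cong[OF f(4)[of y], of "\<lambda>x. y \<bullet> x"] by (simp add: inner_sum_right power2_eq_square inner_commute)
  obtain k where k: "\<And>j. j \<noteq> k \<Longrightarrow> b * (y \<bullet> f j) = 0"
  proof (cases "\<exists>k. b * (y \<bullet> f k) \<noteq> 0")
    case True
    then obtain k where "b * (y \<bullet> f k) \<noteq> 0" by blast
    then have "b * (y \<bullet> f j) = 0" if "j \<noteq> k" for j using off[of k j] that by auto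
    then show ?thesis using that by blast
  qed (use that in blast)
  have "det H = l k * prod l (UNIV - {k})" unfolding f(3) by (subst prod.remove[of _ k]) auto
  also have "prod l (UNIV - {k}) = (\<Prod>j\<in>UNIV - {k}. a)"
    by (rule prod.cong) (use k in \<open>auto simp: l0 power2_eq_square\<close>)
  also have "\<dots> = a ^ (CARD('n) - 1)" by (simp add: card_Diff_singleton)
  also have "l k = a + b * (y \<bullet> y)"
  proof -
    have "(\<Sum>i\<in>UNIV - {k}. b * (y \<bullet> f i)\<^sup>2) = 0"
    proof (rule sum.neutral, rule ballI)
      fix j assume "j \<in> UNIV - {k}"
      then have "b * (y \<bullet> f j) = 0" using k by blast
      then show "b * (y \<bullet> f j)\<^sup>2 = 0" by auto
    qed
    then have "b * (\<Sum>i\<in>UNIV. (y \<bullet> f i)\<^sup>2) = b * (y \<bullet> f k)\<^sup>2"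
      by (simp add: distrib_left sum_distrib_left sum.remove[of UNIV k])
    then show ?thesis by (auto simp: l0 yy)
  qed
  finally show ?thesis by simp
qed

section \<open>Second derivatives\<close>

lemma grad_eqI:
  assumes "(f has_derivative (\<lambda>h. h \<bullet> D)) (at x)"
  shows "grad f x = D"
  unfolding grad_def gderiv_def
proof (rule the_equality)
  show "(f has_derivative (\<lambda>h. h \<bullet> D)) (at x)" by fact
  fix D' assume "(f has_derivative (\<lambda>h. h \<bullet> D')) (at x)"
  from has_derivative_unique[OF this assms] show "D' = D"
    by (metis (no_types) inner_commute vector_eq_ldot)
qed

lemma has_derivative_grad:
  assumes "f differentiable (at x)"
  shows "(f has_derivative (\<lambda>h. h \<bullet> grad f x)) (at x)"
proof -
  obtain f' where f': "(f has_derivative f') (at x)" using assms differentiable_def by blast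
  define D where "D = (\<chi> i. f' (axis i 1))"
  have "linear f'" using f' has_derivative_linear by blast
  then have "f' h = h \<bullet> D" for h
  proof -
    have "f' h = f' (\<Sum>i\<in>UNIV. h $ i *\<^sub>R axis i 1)"
      using basis_expansion[of h] by (simp add: scalar_mult_eq_scaleR)
    also have "\<dots> = h \<bullet> D"
      by (simp add: linear_sum[OF \<open>linear f'\<close>] linear_scale[OF \<open>linear f'\<close>] D_def inner_vec_def)
    finally show ?thesis .
  qed
  then have "f' = (\<lambda>h. h \<bullet> D)" by blast
  with f' grad_eqI show ?thesis by metis
qed

lemma C2_on_has_derivative:
  assumes "C2_on U f" "x \<in> U"
  shows "(f has_derivative (\<lambda>h. h \<bullet> grad f x)) (at x)"
    and "(grad f has_derivative (\<lambda>h. hessian f x *v h)) (at x)"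
proof -
  show "(f has_derivative (\<lambda>h. h \<bullet> grad f x)) (at x)"
    using assms by (auto simp: C2_on_def intro: has_derivative_grad)
  have d: "(grad f has_derivative frechet_derivative (grad f) (at x)) (at x)"
    using assms by (auto simp: C2_on_def frechet_derivative_works)
  then show "(grad f has_derivative (\<lambda>h. hessian f x *v h)) (at x)"
    unfolding hessian_def
    by (simp add: matrix_vector_mul(2)[OF has_derivative_linear[OF d]])
qed

lemma C2_on_subset: "C2_on U f \<Longrightarrow> V \<subseteq> U \<Longrightarrow> C2_on V f"
  by (auto simp: C2_on_def intro: continuous_on_subset)

lemma
  assumes U: "open U" and f: "\<And>x. x \<in> U \<Longrightarrow> (f has_derivative (\<lambda>h. h \<bullet> G x)) (at x)"
    and G: "\<And>x. x \<in> U \<Longrightarrow> (G has_derivative (\<lambda>h. M x *v h)) (at x)"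
    and M: "continuous_on U M"
  shows C2_onI: "C2_on U f" and grad_of_C2: "x \<in> U \<Longrightarrow> grad f x = G x"
    and hessian_of_C2: "x \<in> U \<Longrightarrow> hessian f x = M x"
proof -
  show g: "grad f x = G x" if "x \<in> U" for x
    using grad_eqI[OF f[OF that]] .
  have dG: "(grad f has_derivative (\<lambda>h. M x *v h)) (at x)" if "x \<in> U" for x
    by (rule has_derivative_transform_within_open[OF G[OF that] U that]) (simp add: g)
  show h: "hessian f x = M x" if "x \<in> U" for x
    unfolding hessian_def using frechet_derivative_at[OF dG[OF that]]
    by (metis matrix_of_matrix_vector_mul)
  show "C2_on U f"
    unfolding C2_on_def
    using f dG M h by (auto simp: differentiable_def intro: continuous_on_cong[THEN iffD1, OF refl _ M] )
qed

text \<open>The mean value theorem in direction \<open>v\<close> turns the second difference into a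
  difference of gradients, which is then expanded to first order at the single point
  \<open>x\<close>.\<close>

lemma second_difference_estimate:
  fixes f :: "real^'n \<Rightarrow> real"
  assumes r: "r > 0" and f: "\<And>y. y \<in> ball x r \<Longrightarrow> (f has_derivative (\<lambda>h. h \<bullet> G y)) (at y)"
    and G: "(G has_derivative (\<lambda>h. H *v h)) (at x)" and e: "e > 0"
  shows "\<exists>s0>0. \<forall>s. 0 < s \<and> s < s0 \<longrightarrow>
    \<bar>f (x + s *\<^sub>R u + s *\<^sub>R v) - f (x + s *\<^sub>R u) - f (x + s *\<^sub>R v) + f x - s\<^sup>2 * (v \<bullet> (H *v u))\<bar> \<le> e * s\<^sup>2"
proof -
  define K where "K = norm u + norm v + 1"
  have K: "K \<ge> 1" "norm u \<le> K" "norm v \<le> K" "norm u + norm v < K" by (auto simp: K_def)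
  \<comment> \<open>Two first-order errors of size at most \<open>e' s K\<close> each, paired with
    \<open>v\<close> at the cost of another factor \<open>K\<close>, add up to
    \<open>2 e' s K^2 = e s\<close>.\<close>
  define e' where "e' = e / (2 * K\<^sup>2)"
  have e': "e' > 0" using e K by (auto simp: e'_def)
  obtain d where d: "d > 0" "\<And>y. norm (y - x) < d \<Longrightarrow> norm (G y - G x - H *v (y - x)) \<le> e' * norm (y - x)"
    using G e' unfolding has_derivative_at_alt by blast
  define s0 where "s0 = min d r / K"
  have s0: "s0 > 0" using d r K by (auto simp: s0_def)
  show ?thesis
  proof (intro exI[of _ s0] conjI allI impI s0)
    fix s :: real assume s: "0 < s \<and> s < s0"
    have sK: "s * K < d" "s * K < r" using s K unfolding s0_def by (auto simp: field_simps)
    have small: "norm (a *\<^sub>R u + b *\<^sub>R v) \<le> s * (norm u + norm v)" if "0 \<le> a" "a \<le> s" "0 \<le> b" "b \<le> s" for a b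
    proof -
      have "norm (a *\<^sub>R u + b *\<^sub>R v) \<le> a * norm u + b * norm v"
        using norm_triangle_ineq[of "a *\<^sub>R u" "b *\<^sub>R v"] that by simp
      also have "\<dots> \<le> s * norm u + s * norm v" using that by (intro add_mono mult_right_mono) auto
      finally show ?thesis by (simp add: algebra_simps)
    qed
    have small': "s * (norm u + norm v) \<le> s * K" using K s by (intro mult_left_mono) auto
    have inb: "x + a *\<^sub>R u + b *\<^sub>R v \<in> ball x r" if "0 \<le> a" "a \<le> s" "0 \<le> b" "b \<le> s" for a b
    proof -
      have "norm (a *\<^sub>R u + b *\<^sub>R v) < r" using small[OF that] small' sK by linarith
      then show ?thesis by (simp add: dist_norm add.assoc) (metis norm_minus_cancel minus_add_distrib uminus_add_conv_diff add.commute)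
    qed
    define g where "g t = f (x + s *\<^sub>R u + t *\<^sub>R v) - f (x + t *\<^sub>R v)" for t
    have dg: "(g has_real_derivative (v \<bullet> (G (x + s *\<^sub>R u + t *\<^sub>R v) - G (x + t *\<^sub>R v)))) (at t)"
      if "0 \<le> t" "t \<le> s" for t
    proof -
      have "((\<lambda>t. f (x + s *\<^sub>R u + t *\<^sub>R v)) has_derivative (\<lambda>h. (h *\<^sub>R v) \<bullet> G (x + s *\<^sub>R u + t *\<^sub>R v))) (at t)"
        by (rule has_derivative_compose[OF _ f]) (use that s inb[of s t] in \<open>auto intro!: derivative_eq_intros\<close>)
      moreover have "((\<lambda>t. f (x + t *\<^sub>R v)) has_derivative (\<lambda>h. (h *\<^sub>R v) \<bullet> G (x + t *\<^sub>R v))) (at t)"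
        by (rule has_derivative_compose[OF _ f]) (use that s inb[of 0 t] in \<open>auto intro!: derivative_eq_intros\<close>)
      ultimately have "(g has_derivative (\<lambda>h. (h *\<^sub>R v) \<bullet> G (x + s *\<^sub>R u + t *\<^sub>R v) - (h *\<^sub>R v) \<bullet> G (x + t *\<^sub>R v))) (at t)"
        unfolding g_def by (rule has_derivative_diff)
      moreover have "(\<lambda>h. (h *\<^sub>R v) \<bullet> G (x + s *\<^sub>R u + t *\<^sub>R v) - (h *\<^sub>R v) \<bullet> G (x + t *\<^sub>R v))
          = (*) (v \<bullet> (G (x + s *\<^sub>R u + t *\<^sub>R v) - G (x + t *\<^sub>R v)))"
        by (simp add: fun_eq_iff inner_diff_right algebra_simps)
      ultimately show ?thesis by (simp add: has_field_derivative_def)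
    qed
    obtain t where t: "0 < t" "t < s" "g s - g 0 = (s - 0) * (v \<bullet> (G (x + s *\<^sub>R u + t *\<^sub>R v) - G (x + t *\<^sub>R v)))"
      using MVT2[of 0 s g "\<lambda>t. v \<bullet> (G (x + s *\<^sub>R u + t *\<^sub>R v) - G (x + t *\<^sub>R v))"] s dg by auto
    let ?E = "\<lambda>h. G (x + h) - G x - H *v h"
    have E: "norm (?E h) \<le> e' * norm h" if "norm h < d" for h
      using d(2)[of "x + h"] that by simp
    let ?h1 = "s *\<^sub>R u + t *\<^sub>R v" and ?h2 = "t *\<^sub>R v"
    have h1: "norm ?h1 \<le> s * K" using small[of s t] small' t s by linarith
    have h2: "norm ?h2 \<le> s * K" using order_trans[OF small[of 0 t] small'] t s by simp
    have "norm (?E ?h1) \<le> e' * (s * K)"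
      using order_trans[OF E[of ?h1] mult_left_mono[OF h1, of e']] h1 sK e' by auto
    moreover have "norm (?E ?h2) \<le> e' * (s * K)"
      using order_trans[OF E[of ?h2] mult_left_mono[OF h2, of e']] h2 sK e' by auto
    ultimately have "norm (?E ?h1 - ?E ?h2) \<le> 2 * (e' * (s * K))"
      using norm_triangle_ineq4[of "?E ?h1" "?E ?h2"] by linarith
    moreover have "?E ?h1 - ?E ?h2 = G (x + s *\<^sub>R u + t *\<^sub>R v) - G (x + t *\<^sub>R v) - s *\<^sub>R (H *v u)"
      by (simp add: matrix_vector_right_distrib matrix_vector_mult_scaleR algebra_simps)
    ultimately have n: "norm (G (x + s *\<^sub>R u + t *\<^sub>R v) - G (x + t *\<^sub>R v) - s *\<^sub>R (H *v u)) \<le> 2 * (e' * (s * K))" by simp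
    have "\<bar>v \<bullet> (G (x + s *\<^sub>R u + t *\<^sub>R v) - G (x + t *\<^sub>R v) - s *\<^sub>R (H *v u))\<bar> \<le> K * (2 * (e' * (s * K)))"
      by (rule order_trans[OF Cauchy_Schwarz_ineq2 mult_mono[OF K(3) n]]) (use K in auto)
    also have "\<dots> = e * s" using K by (simp add: e'_def power2_eq_square)
    finally have "\<bar>v \<bullet> (G (x + s *\<^sub>R u + t *\<^sub>R v) - G (x + t *\<^sub>R v)) - s * (v \<bullet> (H *v u))\<bar> \<le> e * s"
      by (simp add: inner_diff_right)
    then have "s * \<bar>v \<bullet> (G (x + s *\<^sub>R u + t *\<^sub>R v) - G (x + t *\<^sub>R v)) - s * (v \<bullet> (H *v u))\<bar> \<le> s * (e * s)"
      using s by (intro mult_left_mono) auto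
    moreover have "s * \<bar>v \<bullet> (G (x + s *\<^sub>R u + t *\<^sub>R v) - G (x + t *\<^sub>R v)) - s * (v \<bullet> (H *v u))\<bar>
       = \<bar>g s - g 0 - s\<^sup>2 * (v \<bullet> (H *v u))\<bar>"
    proof -
      have "s * \<bar>A - s * B\<bar> = \<bar>s * A - s\<^sup>2 * B\<bar>" for A B :: real
      proof -
        have "s * A - s\<^sup>2 * B = s * (A - s * B)" by (simp add: power2_eq_square right_diff_distrib)
        then show ?thesis using s by (simp add: abs_mult)
      qed
      then show ?thesis by (simp add: t(3))
    qed
    moreover have "g s - g 0 = f (x + s *\<^sub>R u + s *\<^sub>R v) - f (x + s *\<^sub>R u) - f (x + s *\<^sub>R v) + f x"
      by (simp add: g_def)
    ultimately show "\<bar>f (x + s *\<^sub>R u + s *\<^sub>R v) - f (x + s *\<^sub>R u) - f (x + s *\<^sub>R v) + f x - s\<^sup>2 * (v \<bullet> (H *v u))\<bar> \<le> e * s\<^sup>2"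
      by (simp add: power2_eq_square algebra_simps)
  qed
qed

text \<open>The second difference is symmetric in its two increments \<open>s u\<close> and
  \<open>s v\<close>, and dividing it by \<open>s^2\<close> gives \<open>v . H u\<close> in the
  limit.\<close>

lemma hessian_symmetric:
  fixes f :: "real^'n \<Rightarrow> real"
  assumes "open U" "C2_on U f" "x \<in> U"
  shows "transpose (hessian f x) = hessian f x"
proof -
  obtain r where r: "r > 0" "ball x r \<subseteq> U" using assms open_contains_ball by blast
  let ?H = "hessian f x"
  note D = C2_on_has_derivative[OF assms(2)]
  have est: "\<exists>s0>0. \<forall>s. 0 < s \<and> s < s0 \<longrightarrow>
    \<bar>f (x + s *\<^sub>R u + s *\<^sub>R v) - f (x + s *\<^sub>R u) - f (x + s *\<^sub>R v) + f x - s\<^sup>2 * (v \<bullet> (?H *v u))\<bar> \<le> e * s\<^sup>2"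
    if "e > 0" for u v e
    by (rule second_difference_estimate[OF r(1) _ D(2)]) (use r D(1) assms that in auto)
  have "\<bar>v \<bullet> (?H *v u) - u \<bullet> (?H *v v)\<bar> \<le> e" if e: "e > 0" for u v e
  proof -
    obtain s1 where s1: "s1 > 0" "\<And>s. 0 < s \<Longrightarrow> s < s1 \<Longrightarrow>
      \<bar>f (x + s *\<^sub>R u + s *\<^sub>R v) - f (x + s *\<^sub>R u) - f (x + s *\<^sub>R v) + f x - s\<^sup>2 * (v \<bullet> (?H *v u))\<bar> \<le> e/2 * s\<^sup>2"
      using est[of "e/2" u v] e by auto
    obtain s2 where s2: "s2 > 0" "\<And>s. 0 < s \<Longrightarrow> s < s2 \<Longrightarrow>
      \<bar>f (x + s *\<^sub>R v + s *\<^sub>R u) - f (x + s *\<^sub>R v) - f (x + s *\<^sub>R u) + f x - s\<^sup>2 * (u \<bullet> (?H *v v))\<bar> \<le> e/2 * s\<^sup>2"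
      using est[of "e/2" v u] e by auto
    define s where "s = min s1 s2 / 2"
    have s: "0 < s" "s < s1" "s < s2" using s1(1) s2(1) by (auto simp: s_def)
    have "x + s *\<^sub>R v + s *\<^sub>R u = x + s *\<^sub>R u + s *\<^sub>R v" by simp
    then have "\<bar>f (x + s *\<^sub>R u + s *\<^sub>R v) - f (x + s *\<^sub>R u) - f (x + s *\<^sub>R v) + f x - s\<^sup>2 * (u \<bullet> (?H *v v))\<bar> \<le> e/2 * s\<^sup>2"
      using s2(2)[OF s(1,3)] by (simp add: algebra_simps)
    moreover define E where "E = e/2 * s\<^sup>2"
    ultimately have "\<bar>s\<^sup>2 * (v \<bullet> (?H *v u)) - s\<^sup>2 * (u \<bullet> (?H *v v))\<bar> \<le> 2 * E"
      using s1(2)[OF s(1,2)] by linarith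
    then have "\<bar>s\<^sup>2 * (v \<bullet> (?H *v u)) - s\<^sup>2 * (u \<bullet> (?H *v v))\<bar> \<le> e * s\<^sup>2" by (simp add: E_def)
    then have "s\<^sup>2 * \<bar>v \<bullet> (?H *v u) - u \<bullet> (?H *v v)\<bar> \<le> s\<^sup>2 * e"
      by (simp only: right_diff_distrib[symmetric] abs_mult abs_power2 mult.commute)
    then show ?thesis using s by simp
  qed
  then have eq: "v \<bullet> (?H *v u) = u \<bullet> (?H *v v)" for u v
    using field_le_epsilon[of "\<bar>v \<bullet> (?H *v u) - u \<bullet> (?H *v v)\<bar>" 0] by force
  show ?thesis
    using eq[of "axis _ 1" "axis _ 1"]
    by (simp add: vec_eq_iff transpose_def inner_axis' matrix_vector_mul_component inner_axis)
qed

text \<open>On each line through \<open>x\<close> the gap \<open>k\<close> has a minimum at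
  \<open>0\<close>, which decides its first and second derivative there. Any function homogeneous of
  degree 2 can serve as \<open>q\<close>: zero for affine supports, the quadratic part of
  \<open>quad\<close> later.\<close>

lemma quadratic_touching_below:
  fixes f :: "real^'n \<Rightarrow> real"
  assumes r: "r > 0" and C2: "C2_on (ball x r) f"
    and le: "\<And>y. y \<in> ball x r \<Longrightarrow> f y \<ge> f x + p \<bullet> (y - x) + q (y - x)"
    and q: "\<And>t v. q (t *\<^sub>R v) = t\<^sup>2 * q v"
  shows "grad f x = p" and "v \<bullet> (hessian f x *v v) \<ge> 2 * q v"
proof -
  note D = C2_on_has_derivative[OF C2]
  have xin: "x \<in> ball x r" using r by simp
  define k where "k v t = f (x + t *\<^sub>R v) - f x - t * (p \<bullet> v) - t\<^sup>2 * q v" for v t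
  define d where "d v = r / (norm v + 1)" for v :: "real^'n"
  have nv: "0 < norm v + 1" for v :: "real^'n" using norm_ge_zero[of v] by linarith
  have dpos: "d v > 0" for v using r nv[of v] by (simp add: d_def)
  have inb: "x + t *\<^sub>R v \<in> ball x r" if "\<bar>t\<bar> < d v" for t v
  proof -
    have "\<bar>t\<bar> * norm v \<le> \<bar>t\<bar> * (norm v + 1)" by (simp add: mult_left_mono)
    also have "\<dots> < r" using that nv[of v] by (simp add: d_def field_simps)
    finally show ?thesis by (simp add: dist_norm)
  qed
  have k0: "k v 0 = 0" for v by (simp add: k_def)
  have kpos: "k v t \<ge> 0" if "\<bar>t\<bar> < d v" for v t
    using le[OF inb[OF that]] by (simp add: k_def q)
  have dk: "(k v has_real_derivative (v \<bullet> grad f (x + t *\<^sub>R v) - p \<bullet> v - 2 * t * q v)) (at t)" if "\<bar>t\<bar> < d v" for v t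
  proof -
    have "((\<lambda>t. f (x + t *\<^sub>R v)) has_derivative (\<lambda>h. (h *\<^sub>R v) \<bullet> grad f (x + t *\<^sub>R v))) (at t)"
      by (rule has_derivative_compose[of _ _ _ UNIV, OF _ D(1)]) (use inb[OF that] in \<open>auto intro!: derivative_eq_intros\<close>)
    then have "((\<lambda>t. f (x + t *\<^sub>R v)) has_real_derivative (v \<bullet> grad f (x + t *\<^sub>R v))) (at t)"
      by (simp add: has_field_derivative_def mult_commute_abs)
    then show ?thesis unfolding k_def by (auto intro!: derivative_eq_intros)
  qed
  have g0: "v \<bullet> grad f x = v \<bullet> p" for v
  proof -
    have "(k v has_real_derivative (v \<bullet> grad f x - p \<bullet> v)) (at 0)" using dk[of 0 v] dpos by simp
    from DERIV_local_min[OF this dpos[of v]] show ?thesis using kpos k0 by (auto simp: inner_commute)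
  qed
  then show gp: "grad f x = p" by (metis inner_commute vector_eq_ldot)
  show "v \<bullet> (hessian f x *v v) \<ge> 2 * q v"
  proof (rule ccontr)
    assume neg: "\<not> ?thesis"
    define k' where "k' t = v \<bullet> grad f (x + t *\<^sub>R v) - p \<bullet> v - 2 * t * q v" for t
    have "((\<lambda>t. grad f (x + t *\<^sub>R v)) has_derivative (\<lambda>h. hessian f x *v (h *\<^sub>R v))) (at 0)"
      by (rule has_derivative_compose[of "\<lambda>t. x + t *\<^sub>R v" _ 0 UNIV "grad f"])
        (use D(2)[OF xin] in \<open>auto intro!: derivative_eq_intros\<close>)
    from has_derivative_inner_right[OF this, of v]
    have "((\<lambda>t. v \<bullet> grad f (x + t *\<^sub>R v)) has_real_derivative (v \<bullet> (hessian f x *v v))) (at 0)"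
      by (simp add: has_field_derivative_def matrix_vector_mult_scaleR mult_commute_abs)
    then have "(k' has_real_derivative (v \<bullet> (hessian f x *v v) - 2 * q v)) (at 0)"
      unfolding k'_def by (auto intro!: derivative_eq_intros)
    \<comment> \<open>Only the derivative of \<open>k'\<close> at \<open>0\<close> is available. If
      it is negative, \<open>k'\<close> is negative just to the right of \<open>0\<close>, and the
      mean value theorem makes the gap negative there.\<close>
    then obtain e where e: "e > 0" "\<And>h. h > 0 \<Longrightarrow> h < e \<Longrightarrow> k' (0 + h) < k' 0"
      using DERIV_neg_dec_right[of k' "v \<bullet> (hessian f x *v v) - 2 * q v" 0] neg by auto
    have k'0: "k' 0 = 0" using gp by (simp add: k'_def inner_commute)
    define h where "h = min e (d v) / 2"
    have h: "h > 0" "h < e" "h < d v" using e(1) dpos[of v] by (auto simp: h_def)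
    obtain t where t: "0 < t" "t < h" "k v h - k v 0 = (h - 0) * k' t"
      using MVT2[of 0 h "k v" k'] h dk[of _ v] unfolding k'_def by auto
    have "k' t < 0" using e(2)[of t] t h k'0 by simp
    then have "k v h < 0" using t(3) h k0 by (simp add: mult_pos_neg)
    then show False using kpos[of h v] h by simp
  qed
qed

section \<open>Convex functions\<close>

text \<open>Separate the graph point over \<open>x\<close> from the strict epigraph over the
  ball.\<close>

lemma convex_on_ball_subgradient:
  fixes f :: "'a::euclidean_space \<Rightarrow> real"
  assumes r: "r > 0" and f: "convex_on (ball x r) f"
  obtains p where "\<And>y. y \<in> ball x r \<Longrightarrow> f y \<ge> f x + p \<bullet> (y - x)"
proof -
  define A where "A = {(y, t). y \<in> ball x r \<and> f y < t}"
  have xin: "x \<in> ball x r" using r by simp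
  have "convex A"
    unfolding convex_alt
  proof (intro ballI allI impI)
    fix a b and u :: real assume ab: "a \<in> A" "b \<in> A" and u: "0 \<le> u \<and> u \<le> 1"
    obtain y s z t where eq: "a = (y, s)" "b = (z, t)" by fastforce
    have yz: "y \<in> ball x r" "z \<in> ball x r" "f y < s" "f z < t" using ab by (auto simp: A_def eq)
    have "(1 - u) *\<^sub>R y + u *\<^sub>R z \<in> ball x r"
      using convexD_alt[OF convex_ball yz(1,2)] u by auto
    moreover have "f ((1 - u) *\<^sub>R y + u *\<^sub>R z) \<le> (1 - u) * f y + u * f z"
      using convex_onD[OF f, of u y z] u yz by auto
    moreover have "(1 - u) * f y + u * f z < (1 - u) * s + u * t"
    proof (cases "u = 0")
      case False
      then show ?thesis using u yz by (intro add_le_less_mono mult_left_mono mult_strict_left_mono) auto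
    qed (use yz in simp)
    ultimately show "(1 - u) *\<^sub>R a + u *\<^sub>R b \<in> A" by (simp add: eq A_def)
  qed
  moreover have "(x, f x + 1) \<in> A" using xin by (simp add: A_def)
  then have "A \<noteq> {}" by blast
  moreover have "A \<inter> {(x, f x)} = {}" by (auto simp: A_def)
  ultimately obtain a b where a: "a \<noteq> 0" "\<forall>z\<in>{(x, f x)}. inner a z \<le> b" "\<forall>z\<in>A. inner a z \<ge> b"
    using separating_hyperplane_sets[of "{(x, f x)}" A] by auto
  obtain q c where qc: "a = (q, c)" by fastforce
  have sep: "q \<bullet> (y - x) + c * (t - f x) \<ge> 0" if "y \<in> ball x r" "f y < t" for y t
  proof -
    have "(y, t) \<in> A" using that by (simp add: A_def)
    then have "inner a (y, t) \<ge> inner a (x, f x)" using a by force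
    then show ?thesis by (simp add: qc inner_diff_right algebra_simps)
  qed
  have c0: "c \<ge> 0" using sep[OF xin, of "f x + 1"] by simp
  \<comment> \<open>A vertical hyperplane would put the whole ball on one side of a hyperplane
    through \<open>x\<close>; a small step from \<open>x\<close> against \<open>q\<close> refutes
    this because \<open>x\<close> is interior.\<close>
  have "c \<noteq> 0"
  proof
    assume "c = 0"
    then have q: "q \<noteq> 0" using a(1) qc by (auto simp: zero_prod_def)
    define y where "y = x - (r / (2 * norm q)) *\<^sub>R q"
    have "y \<in> ball x r" using q r by (simp add: y_def dist_norm)
    from sep[OF this, of "f y + 1"] have "q \<bullet> (y - x) \<ge> 0" using \<open>c = 0\<close> by simp
    moreover have "q \<bullet> (y - x) = - (r / (2 * norm q)) * (q \<bullet> q)" by (simp add: y_def)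
    moreover have "(r / (2 * norm q)) * (q \<bullet> q) > 0" using q r by simp
    ultimately show False by linarith
  qed
  with c0 have c: "c > 0" by simp
  have "f y \<ge> f x + (- (1/c) *\<^sub>R q) \<bullet> (y - x)" if y: "y \<in> ball x r" for y
  proof (rule field_le_epsilon)
    fix e :: real assume "e > 0"
    then have "q \<bullet> (y - x) + c * (f y + e - f x) \<ge> 0" using sep[OF y, of "f y + e"] by simp
    then show "f x + (- (1/c) *\<^sub>R q) \<bullet> (y - x) \<le> f y + e" using c by (simp add: field_simps)
  qed
  with that show thesis by blast
qed

text \<open>A local support is global: pull \<open>y\<close> back towards \<open>x\<close> into the
  unit ball and use convexity along the segment.\<close>

lemma convex_on_UNIV_subgradient:
  fixes f :: "'a::euclidean_space \<Rightarrow> real"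
  assumes f: "convex_on UNIV f"
  obtains p where "\<And>y. f y \<ge> f x + p \<bullet> (y - x)"
proof -
  have "convex_on (ball x 1) f" using f convex_on_subset by blast
  then obtain p where p: "\<And>y. y \<in> ball x 1 \<Longrightarrow> f y \<ge> f x + p \<bullet> (y - x)"
    using convex_on_ball_subgradient[of 1 x f] by auto
  have "f y \<ge> f x + p \<bullet> (y - x)" for y
  proof -
    define t where "t = 1 / (2 * (norm (y - x) + 1))"
    have n: "norm (y - x) + 1 > 0" using norm_ge_zero[of "y - x"] by linarith
    have t: "0 < t" "t \<le> 1" using n by (auto simp: t_def divide_simps)
    have "t * norm (y - x) < 1" using n by (simp add: t_def divide_simps)
    then have "x + t *\<^sub>R (y - x) \<in> ball x 1" using t by (simp add: dist_norm)
    then have "f x + t * (p \<bullet> (y - x)) \<le> f (x + t *\<^sub>R (y - x))" using p[of "x + t *\<^sub>R (y - x)"] by simp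
    also have "x + t *\<^sub>R (y - x) = (1 - t) *\<^sub>R x + t *\<^sub>R y" by (simp add: algebra_simps)
    also have "f \<dots> \<le> (1 - t) * f x + t * f y" using convex_onD[OF f, of t x y] t by simp
    finally have "t * (f x + p \<bullet> (y - x)) \<le> t * f y" by (simp add: algebra_simps)
    then show ?thesis using t by simp
  qed
  with that show thesis by blast
qed

text \<open>If the excess over a chord had a positive maximum, the set where the maximum is attained would
  be closed by continuity and open because of the local supports.\<close>

lemma convex_on_of_local_support:
  fixes w :: "'a::euclidean_space \<Rightarrow> real"
  assumes cont: "continuous_on UNIV w"
    and supp: "\<And>x. \<exists>r>0. \<exists>p. \<forall>y\<in>ball x r. w y \<ge> w x + p \<bullet> (y - x)"
  shows "convex_on UNIV w"
proof (rule convex_onI)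
  fix t :: real and a b :: 'a assume t: "t > 0" "t < 1"
  define c where "c s = (1 - s) *\<^sub>R a + s *\<^sub>R b" for s :: real
  define g where "g s = w (c s) - ((1 - s) * w a + s * w b)" for s
  have cc: "continuous_on A c" for A unfolding c_def by (intro continuous_intros)
  have cg: "continuous_on {0..1} g"
    unfolding g_def by (intro continuous_intros continuous_on_compose2[OF cont] cc) auto
  show "w ((1 - t) *\<^sub>R a + t *\<^sub>R b) \<le> (1 - t) * w a + t * w b"
  proof (rule ccontr)
    assume "\<not> ?thesis"
    then have gt: "g t > 0" by (simp add: g_def c_def)
    obtain m where m: "m \<in> {0..1}" "\<And>s. s \<in> {0..1} \<Longrightarrow> g s \<le> g m"
      using continuous_attains_sup[OF _ _ cg] by auto
    have gm: "g m > 0" using m(2)[of t] gt t by auto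
    define T where "T = {s \<in> {0..1}. g s = g m}"
    have "closed T" unfolding T_def
      by (rule continuous_closed_preimage_constant[OF cg]) simp
    moreover have "T = {0..1} \<inter> T" by (auto simp: T_def)
    ultimately have cT: "compact T" by (metis compact_Int_closed compact_Icc)
    have "T \<noteq> {}" using m by (auto simp: T_def)
    \<comment> \<open>At the leftmost maximizer \<open>s\<close> the local support bounds
      \<open>g\<close> below by an affine function of slope \<open>k\<close>. Maximality forbids
      growth towards \<open>s + h\<close>, so \<open>k \<le> 0\<close>; then \<open>s - h\<close> is
      a maximizer too, contradicting the choice of \<open>s\<close>.\<close>
    then obtain s where s: "s \<in> T" "\<And>s'. s' \<in> T \<Longrightarrow> s \<le> s'"
      using compact_attains_inf[OF cT] by blast
    have g01: "g 0 = 0" "g 1 = 0" by (auto simp: g_def c_def)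
    have s01: "0 < s" "s < 1" and gs: "g s = g m" using s(1) gm g01
      by (auto simp: T_def less_le)
    obtain r p where r: "r > 0" and p: "\<And>y. y \<in> ball (c s) r \<Longrightarrow> w y \<ge> w (c s) + p \<bullet> (y - c s)"
      using supp[of "c s"] by blast
    define k where "k = p \<bullet> (b - a) + w a - w b"
    have lin: "g s' \<ge> g s + k * (s' - s)" if "\<bar>s' - s\<bar> * norm (b - a) < r" for s'
    proof -
      have d: "c s' - c s = (s' - s) *\<^sub>R (b - a)" by (simp add: c_def algebra_simps)
      then have "c s' \<in> ball (c s) r" using that by (simp add: dist_norm norm_minus_commute[of "c s"])
      from p[OF this] d show ?thesis by (simp add: g_def k_def algebra_simps)
    qed
    define h where "h = min (min s (1 - s)) (r / (norm (b - a) + 1)) / 2"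
    have nb: "norm (b - a) + 1 > 0" using norm_ge_zero[of "b - a"] by linarith
    define q where "q = r / (norm (b - a) + 1)"
    have q: "q > 0" "q * (norm (b - a) + 1) = r" using nb r by (auto simp: q_def)
    have h: "h > 0" "h < s" "h < 1 - s" "h < q"
      using s01 q by (auto simp: h_def q_def[symmetric])
    have "h * norm (b - a) \<le> h * (norm (b - a) + 1)" using h by (simp add: mult_left_mono)
    also have "\<dots> < r" using h(4) nb q(2) mult_strict_right_mono by fastforce
    finally have hr: "h * norm (b - a) < r" .
    have "k * h \<le> 0" using lin[of "s + h"] m(2)[of "s + h"] h hr s01 gs by simp
    moreover have "g (s - h) \<ge> g s - k * h" using lin[of "s - h"] h hr by simp
    moreover have "g (s - h) \<le> g m" using m(2)[of "s - h"] h s01 by simp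
    ultimately have "s - h \<in> T" using h s01 gs by (auto simp: T_def)
    with s(2)[of "s - h"] h show False by simp
  qed
qed auto

text \<open>\<open>f\<close> is squeezed between an affine function and a function differentiable at
  \<open>x\<close>. With \<open>g = f\<close> this identifies any subgradient at a point of
  differentiability with the gradient.\<close>

lemma touching_grad:
  assumes r: "r > 0" and lo: "\<And>y. y \<in> ball x r \<Longrightarrow> f y \<ge> f x + p \<bullet> (y - x)"
    and up: "\<And>y. y \<in> ball x r \<Longrightarrow> f y - f x \<le> g y - g x"
    and g: "(g has_derivative (\<lambda>h. h \<bullet> D)) (at x)"
  shows "p = D" and "(f has_derivative (\<lambda>h. h \<bullet> D)) (at x)"
proof -
  have "((\<lambda>y. g y - p \<bullet> (y - x)) has_derivative (\<lambda>h. h \<bullet> D - p \<bullet> h)) (at x)"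
    by (auto intro!: derivative_eq_intros g)
  moreover have "\<forall>y\<in>ball x r. g x - p \<bullet> (x - x) \<le> g y - p \<bullet> (y - x)"
    using lo up by fastforce
  ultimately have "(\<lambda>h. h \<bullet> D - p \<bullet> h) = (\<lambda>v. 0)"
    using differential_zero_maxmin[of x "ball x r" "\<lambda>y. g y - p \<bullet> (y - x)"] r by auto
  then have "h \<bullet> D = p \<bullet> h" for h by (metis eq_iff_diff_eq_0)
  then show pD: "p = D" by (metis inner_commute vector_eq_ldot)
  show "(f has_derivative (\<lambda>h. h \<bullet> D)) (at x)"
    unfolding has_derivative_at_alt
  proof (intro conjI allI impI bounded_linear_inner_left)
    fix e :: real assume "e > 0"
    then obtain d where d: "d > 0" "\<And>y. norm (y - x) < d \<Longrightarrow> norm (g y - g x - (y - x) \<bullet> D) \<le> e * norm (y - x)"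
      using g unfolding has_derivative_at_alt by blast
    show "\<exists>d>0. \<forall>y. norm (y - x) < d \<longrightarrow> norm (f y - f x - (y - x) \<bullet> D) \<le> e * norm (y - x)"
    proof (intro exI[of _ "min d r"] conjI allI impI)
      fix y assume y: "norm (y - x) < min d r"
      then have "y \<in> ball x r" by (simp add: dist_norm norm_minus_commute)
      from lo[OF this] up[OF this] d(2)[of y] y pD
      show "norm (f y - f x - (y - x) \<bullet> D) \<le> e * norm (y - x)" by (auto simp: inner_commute)
    qed (use d r in auto)
  qed
qed

section \<open>Gradients of convex functions and of their limits\<close>

lemma convex_grad_support:
  assumes "r > 0" "convex_on (ball x r) f" "f differentiable (at x)" "y \<in> ball x r"
  shows "f y \<ge> f x + grad f x \<bullet> (y - x)"
proof -
  obtain p where p: "\<And>y. y \<in> ball x r \<Longrightarrow> f y \<ge> f x + p \<bullet> (y - x)"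
    using convex_on_ball_subgradient assms by blast
  have "p = grad f x"
    by (rule touching_grad(1)[OF assms(1) p _ has_derivative_grad[OF assms(3)]]) auto
  with p assms show ?thesis by simp
qed

text \<open>Serves the points where the right-hand side of the equation vanishes: there convexity
  alone yields the viscosity inequality.\<close>

lemma convex_touched_above:
  assumes r: "r > 0" and w: "convex_on (ball x r) w" and C2: "C2_on (ball x r) \<phi>"
    and le: "\<And>y. y \<in> ball x r \<Longrightarrow> w y - \<phi> y \<le> w x - \<phi> x"
  shows "w differentiable (at x)" "grad w x = grad \<phi> x" "det (hessian \<phi> x) \<ge> 0"
proof -
  have xin: "x \<in> ball x r" using r by simp
  obtain p where p: "\<And>y. y \<in> ball x r \<Longrightarrow> w y \<ge> w x + p \<bullet> (y - x)"
    using convex_on_ball_subgradient r w by blast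
  have le': "\<And>y. y \<in> ball x r \<Longrightarrow> w y - w x \<le> \<phi> y - \<phi> x" using le by fastforce
  note T = touching_grad[OF r p le' C2_on_has_derivative(1)[OF C2 xin]]
  show "w differentiable (at x)" "grad w x = grad \<phi> x" using T(2) grad_eqI by (auto simp: differentiable_def)
  have "v \<bullet> (hessian \<phi> x *v v) \<ge> 2 * 0" for v
    by (rule quadratic_touching_below(2)[OF r C2, of p "\<lambda>_. 0"]) (use p le' in \<open>fastforce+\<close>)
  then show "det (hessian \<phi> x) \<ge> 0"
    by (intro det_psd_nonneg hessian_symmetric[OF open_ball C2 xin]) simp
qed

lemma norm_grad_le_of_lipschitz:
  assumes r: "r > 0" and L: "L-lipschitz_on (ball x r) w" and d: "w differentiable (at x)"
  shows "norm (grad w x) \<le> L"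
proof (rule ccontr)
  assume neg: "\<not> ?thesis"
  let ?g = "grad w x"
  have L0: "L \<ge> 0" using L lipschitz_on_nonneg by blast
  then have g: "norm ?g > 0" using neg by linarith
  define e where "e = (norm ?g - L) / 2"
  have e: "e > 0" using neg by (simp add: e_def)
  obtain d where d: "d > 0" "\<And>y. norm (y - x) < d \<Longrightarrow> norm (w y - w x - (y - x) \<bullet> ?g) \<le> e * norm (y - x)"
    using has_derivative_grad[OF d] e unfolding has_derivative_at_alt by blast
  define t where "t = min d r / (2 * norm ?g)"
  have t: "t > 0" "t * norm ?g < d" "t * norm ?g < r" using d r g by (auto simp: t_def)
  let ?y = "x + t *\<^sub>R ?g"
  have "\<bar>w ?y - w x - t * (?g \<bullet> ?g)\<bar> \<le> e * (t * norm ?g)" using d(2)[of ?y] t by simp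
  moreover have "\<bar>w ?y - w x\<bar> \<le> L * (t * norm ?g)"
    using lipschitz_onD[OF L, of ?y x] t r by (simp add: dist_norm)
  ultimately have "t * (?g \<bullet> ?g) \<le> (e + L) * (t * norm ?g)" by (simp add: algebra_simps)
  then have "norm ?g * (t * norm ?g) \<le> (e + L) * (t * norm ?g)"
    by (simp add: power2_norm_eq_inner[symmetric] power2_eq_square mult_ac)
  then have "norm ?g \<le> e + L" using t g by simp
  then show False using neg by (simp add: e_def field_simps)
qed

text \<open>The second difference is divided by \<open>t\<close>, not by its square. For convex
  \<open>f\<close> its limit from the right at \<open>0\<close> is the jump of the derivative along
  \<open>e\<close>, so a zero limit expresses differentiability in that direction.\<close>

abbreviation second_quotient :: "('a::real_vector \<Rightarrow> real) \<Rightarrow> 'a \<Rightarrow> 'a \<Rightarrow> real \<Rightarrow> real" where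
  "second_quotient f x e t \<equiv> (f (x + t *\<^sub>R e) + f (x - t *\<^sub>R e) - 2 * f x) / t"

text \<open>A subgradient bounds \<open>f\<close> below. Small second differences turn this into an
  upper bound along each coordinate axis, and convexity extends the upper bound from the axes to a
  neighborhood.\<close>

lemma convex_differentiable_of_second_differences:
  fixes f :: "real^'n \<Rightarrow> real"
  assumes r: "r > 0" and f: "convex_on (ball x r) f"
    and lim: "\<And>i. ((\<lambda>t. second_quotient f x (axis i 1) t) \<longlongrightarrow> 0) (at_right 0)"
  shows "f differentiable (at x)"
proof -
  let ?n = "real CARD('n)"
  have n: "?n \<ge> 1" by (simp add: Suc_leI)
  obtain p where p: "\<And>y. y \<in> ball x r \<Longrightarrow> f y \<ge> f x + p \<bullet> (y - x)"
    using convex_on_ball_subgradient r f by blast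
  have "(f has_derivative (\<lambda>h. h \<bullet> p)) (at x)"
    unfolding has_derivative_at_alt
  proof (intro conjI allI impI bounded_linear_inner_left)
    fix e :: real assume e: "e > 0"
    define e' where "e' = e / ?n"
    have e': "e' > 0" using e n by (simp add: e'_def)
    have "\<exists>b>0. \<forall>t. 0 < t \<and> t < b \<longrightarrow>
       f (x + t *\<^sub>R axis i 1) + f (x - t *\<^sub>R axis i 1) - 2 * f x \<le> e' * t" for i
    proof -
      have "\<forall>\<^sub>F t in at_right 0. second_quotient f x (axis i 1) t < e'"
        using order_tendstoD(2)[OF lim e'] .
      then obtain b where "b > 0" "\<And>t. 0 < t \<Longrightarrow> t < b \<Longrightarrow>
          second_quotient f x (axis i 1) t < e'"
        unfolding eventually_at_right_field by blast
      then show ?thesis by (intro exI[of _ b]) (auto simp: pos_divide_less_eq less_imp_le)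
    qed
    then obtain b where b: "\<And>i. b i > 0" "\<And>i t. 0 < t \<Longrightarrow> t < b i \<Longrightarrow>
       f (x + t *\<^sub>R axis i 1) + f (x - t *\<^sub>R axis i 1) - 2 * f x \<le> e' * t" by metis
    define B where "B = min r (Min (range b))"
    have B: "B > 0" "B \<le> r" "\<And>i. B \<le> b i" using r b(1) by (auto simp: B_def min_le_iff_disj)
    have one: "f (x + t *\<^sub>R axis i 1) \<le> f x + t * p $ i + e' * \<bar>t\<bar>" if t: "\<bar>t\<bar> < B" for t i
    proof (cases "t = 0")
      case False
      have ball: "x + s *\<^sub>R axis i 1 \<in> ball x r" if "\<bar>s\<bar> < B" for s :: real
        using that B(2) by (simp add: dist_norm norm_axis_1)
      have "f (x + \<bar>t\<bar> *\<^sub>R axis i 1) + f (x - \<bar>t\<bar> *\<^sub>R axis i 1) - 2 * f x \<le> e' * \<bar>t\<bar>"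
        using b(2)[of "\<bar>t\<bar>" i] t B(3)[of i] False by simp
      then have "f (x + t *\<^sub>R axis i 1) + f (x + (-t) *\<^sub>R axis i 1) - 2 * f x \<le> e' * \<bar>t\<bar>"
        by (cases "t \<ge> 0") (auto simp: abs_of_nonneg abs_of_neg)
      moreover have "f (x + (-t) *\<^sub>R axis i 1) \<ge> f x - t * p $ i"
        using p[OF ball[of "-t"]] t by (simp add: inner_axis)
      ultimately show ?thesis by linarith
    qed simp
    show "\<exists>d>0. \<forall>y. norm (y - x) < d \<longrightarrow> norm (f y - f x - (y - x) \<bullet> p) \<le> e * norm (y - x)"
    proof (intro exI[of _ "B / ?n"] conjI allI impI)
      fix y assume y: "norm (y - x) < B / ?n"
      define h where "h = y - x"
      have hB: "?n * norm h < B" using y n by (simp add: h_def field_simps)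
      have "norm h \<le> ?n * norm h" using n by (simp add: mult_le_cancel_right1)
      with hB have yb: "y \<in> ball x r" using B(2) by (simp add: h_def dist_norm norm_minus_commute)
      have hi: "\<bar>?n * h $ i\<bar> < B" for i
      proof -
        have "\<bar>?n * h $ i\<bar> \<le> ?n * norm h" using component_le_norm_cart[of h i] n by (simp add: abs_mult)
        then show ?thesis using hB by simp
      qed
      \<comment> \<open>\<open>y\<close> is the average of \<open>n\<close> points, the
        \<open>i\<close>-th displaced from \<open>x\<close> by \<open>n\<close> times the
        \<open>i\<close>-th coordinate of \<open>h\<close>; Jensen's inequality then refers to
        points on the axes only.\<close>
      have "y = (\<Sum>i\<in>UNIV. (1/?n) *\<^sub>R (x + (?n * h $ i) *\<^sub>R axis i 1))"
      proof -
        have "(\<Sum>i\<in>UNIV. (1/?n) *\<^sub>R (x + (?n * h $ i) *\<^sub>R axis i 1)) = x + (\<Sum>i\<in>UNIV. (h $ i) *\<^sub>R axis i 1)"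
          using n by (simp add: scaleR_add_right sum.distrib sum_constant_scaleR del: sum_constant)
        also have "(\<Sum>i\<in>UNIV. (h $ i) *\<^sub>R axis i 1) = h"
          using basis_expansion[of h] by (simp add: scalar_mult_eq_scaleR)
        finally show ?thesis by (simp add: h_def)
      qed
      then have "f y = f (\<Sum>i\<in>UNIV. (1/?n) *\<^sub>R (x + (?n * h $ i) *\<^sub>R axis i 1))" by simp
      also have "\<dots> \<le> (\<Sum>i\<in>UNIV. (1/?n) * f (x + (?n * h $ i) *\<^sub>R axis i 1))"
        by (rule convex_on_sum[OF _ _ f]) (use hi B(2) n in \<open>auto simp: dist_norm norm_axis_1 intro: less_le_trans\<close>)
      also have "\<dots> \<le> (\<Sum>i\<in>UNIV. (1/?n) * (f x + (?n * h $ i) * p $ i + e' * \<bar>?n * h $ i\<bar>))"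
        by (intro sum_mono mult_left_mono one hi) auto
      also have "\<dots> = (\<Sum>i\<in>UNIV. f x / ?n + h $ i * p $ i + e' * \<bar>h $ i\<bar>)"
        using n by (intro sum.cong) (auto simp: abs_mult field_simps)
      also have "\<dots> = f x + h \<bullet> p + e' * (\<Sum>i\<in>UNIV. \<bar>h $ i\<bar>)"
        using n by (simp add: sum.distrib inner_vec_def sum_distrib_left)
      also have "\<dots> \<le> f x + h \<bullet> p + e' * (?n * norm h)"
      proof -
        have "(\<Sum>i\<in>UNIV. \<bar>h $ i\<bar>) \<le> (\<Sum>i\<in>(UNIV::'n set). norm h)"
          by (intro sum_mono component_le_norm_cart)
        then show ?thesis using e' by simp
      qed
      also have "e' * (?n * norm h) = e * norm h" using n by (simp add: e'_def)
      finally have "f y - f x - (y - x) \<bullet> p \<le> e * norm (y - x)" by (simp add: h_def)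
      moreover have "f y - f x - (y - x) \<bullet> p \<ge> 0" using p[OF yb] by (simp add: inner_commute)
      ultimately show "norm (f y - f x - (y - x) \<bullet> p) \<le> e * norm (y - x)" by simp
    qed (use B n in auto)
  qed
  then show ?thesis by (auto simp: differentiable_def)
qed

text \<open>For a convex function the difference quotient in direction \<open>v\<close> bounds the
  directional derivative from above. For a fixed small \<open>t\<close> the quotients converge, and
  using both \<open>v\<close> and \<open>-v\<close> pins the gradients down.\<close>

lemma convex_grad_tendsto:
  fixes f :: "real^'n \<Rightarrow> real"
  assumes r: "r > 0" and F: "\<And>k. convex_on (ball x r) (F k)" "\<And>k. F k differentiable (at x)"
    and f: "f differentiable (at x)"
    and lim: "\<And>y. y \<in> ball x r \<Longrightarrow> (\<lambda>k. F k y) \<longlonglongrightarrow> f y"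
  shows "(\<lambda>k. grad (F k) x) \<longlonglongrightarrow> grad f x"
proof -
  have xin: "x \<in> ball x r" using r by simp
  have up: "\<forall>\<^sub>F k in sequentially. v \<bullet> grad (F k) x < v \<bullet> grad f x + e" if e: "e > 0" for v e
  proof -
    define K where "K = norm v + 1"
    have K: "K > 0" using norm_ge_zero[of v] unfolding K_def by linarith
    have "e / (2 * K) > 0" using e K by simp
    then obtain d where d: "d > 0" "\<And>y. norm (y - x) < d \<Longrightarrow> norm (f y - f x - (y - x) \<bullet> grad f x) \<le> (e / (2 * K)) * norm (y - x)"
      using has_derivative_grad[OF f] unfolding has_derivative_at_alt by blast
    \<comment> \<open>Over this step the linearization of \<open>f\<close> errs by at most
      \<open>t e / 2\<close>, which leaves a strict inequality that holds for all late
      \<open>F k\<close>.\<close>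
    define t where "t = min d r / (2 * K)"
    have t: "t > 0" "t * K < d" "t * K < r" using d r K by (auto simp: t_def)
    have tn: "t * norm v < t * K" using t by (simp add: K_def)
    let ?y = "x + t *\<^sub>R v"
    have tv: "t * norm v < r" "t * norm v < d" using t tn by linarith+
    then have y: "?y \<in> ball x r" using t by (simp add: dist_norm)
    have "\<bar>f ?y - f x - t * (v \<bullet> grad f x)\<bar> \<le> e / (2 * K) * (t * norm v)"
      using d(2)[of ?y] t tv by simp
    also have "\<dots> \<le> e / (2 * K) * (t * K)" by (intro mult_left_mono less_imp_le[OF tn]) (use e K in auto)
    also have "\<dots> = t * (e / 2)" using K by simp
    finally have "f ?y - f x \<le> t * (v \<bullet> grad f x) + t * (e/2)" by linarith
    moreover have "t * (e/2) < t * e" using t e by simp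
    ultimately have lt: "f ?y - f x < t * (v \<bullet> grad f x + e)" unfolding distrib_left by linarith
    have "(\<lambda>k. F k ?y - F k x) \<longlonglongrightarrow> f ?y - f x" by (intro tendsto_diff lim y xin)
    from order_tendstoD(2)[OF this lt]
    show ?thesis
    proof eventually_elim
      case (elim k)
      have "F k ?y \<ge> F k x + grad (F k) x \<bullet> (?y - x)"
        by (rule convex_grad_support[OF r F y])
      then have "t * (v \<bullet> grad (F k) x) < t * (v \<bullet> grad f x + e)" using elim by (simp add: inner_commute)
      then show ?case using t by simp
    qed
  qed
  have inner: "(\<lambda>k. v \<bullet> grad (F k) x) \<longlonglongrightarrow> v \<bullet> grad f x" for v
  proof (rule order_tendstoI)
    fix a assume "a < v \<bullet> grad f x"
    then show "\<forall>\<^sub>F k in sequentially. a < v \<bullet> grad (F k) x"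
      using up[of "v \<bullet> grad f x - a" "- v"] by simp
  next
    fix a assume "v \<bullet> grad f x < a"
    then show "\<forall>\<^sub>F k in sequentially. v \<bullet> grad (F k) x < a"
      using up[of "a - v \<bullet> grad f x" v] by simp
  qed
  show ?thesis
    by (rule vec_tendstoI) (use inner[of "axis _ 1"] in \<open>simp add: inner_axis'\<close>)
qed

section \<open>Almost everywhere differentiability\<close>

lemma integral_lborel_shift:
  fixes f :: "'a::euclidean_space \<Rightarrow> real"
  assumes "f \<in> borel_measurable borel"
  shows "(\<integral>x. f (x + c) \<partial>lborel) = (\<integral>x. f x \<partial>lborel)"
proof -
  have "(\<integral>x. f x \<partial>distr lborel borel ((+) c)) = (\<integral>x. f (c + x) \<partial>lborel)"
    by (rule integral_distr) (use assms in auto)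
  then show ?thesis by (simp add: lborel_distr_plus add.commute)
qed

lemma integrable_bounded_cball:
  fixes f :: "'a::euclidean_space \<Rightarrow> real"
  assumes "f \<in> borel_measurable borel" "\<And>x. \<bar>f x\<bar> \<le> B" "\<And>x. x \<notin> cball a R \<Longrightarrow> f x = 0"
  shows "integrable lborel f"
proof (rule integrableI_bounded_set)
  show "emeasure lborel (cball a R) < \<infinity>" by (rule emeasure_bounded_finite) simp
  show "AE x in lborel. x \<in> cball a R \<longrightarrow> norm (f x) \<le> B" using assms(2) by simp
  show "AE x in lborel. x \<notin> cball a R \<longrightarrow> f x = 0" using assms(3) by simp
qed (use assms(1) in auto)

lemma second_difference_quotient_tendsto_0:
  fixes f :: "'a::real_normed_vector \<Rightarrow> real"
  assumes "f differentiable (at x)"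
  shows "((\<lambda>t. second_quotient f x e t) \<longlongrightarrow> 0) (at_right 0)"
proof -
  obtain f' where f': "(f has_derivative f') (at x)" using assms differentiable_def by blast
  have lin: "linear f'" using f' has_derivative_linear by blast
  have "((\<lambda>t. x + t *\<^sub>R e) has_derivative (\<lambda>h. h *\<^sub>R e)) (at 0)"
    by (auto intro!: derivative_eq_intros)
  from has_derivative_compose[OF this, of f f'] f'
  have "((\<lambda>t. f (x + t *\<^sub>R e)) has_derivative (\<lambda>h. f' (h *\<^sub>R e))) (at 0)" by simp
  moreover have "((\<lambda>t. x - t *\<^sub>R e) has_derivative (\<lambda>h. - (h *\<^sub>R e))) (at 0)"
    by (auto intro!: derivative_eq_intros)
  from has_derivative_compose[OF this, of f f'] f'
  have "((\<lambda>t. f (x - t *\<^sub>R e)) has_derivative (\<lambda>h. f' (- (h *\<^sub>R e)))) (at 0)" by simp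
  ultimately have "((\<lambda>t. f (x + t *\<^sub>R e) + f (x - t *\<^sub>R e)) has_derivative (\<lambda>h. f' (h *\<^sub>R e) + f' (- (h *\<^sub>R e)))) (at 0)"
    by (rule has_derivative_add)
  moreover have "(\<lambda>h. f' (h *\<^sub>R e) + f' (- (h *\<^sub>R e))) = (*) (0::real)"
    by (simp add: fun_eq_iff linear_neg[OF lin])
  ultimately have "((\<lambda>t. f (x + t *\<^sub>R e) + f (x - t *\<^sub>R e)) has_real_derivative 0) (at 0)"
    by (simp add: has_field_derivative_def)
  then have "((\<lambda>t. second_quotient f x e t) \<longlongrightarrow> 0) (at 0)"
    by (simp add: DERIV_def)
  then show ?thesis by (rule tendsto_within_subset) auto
qed

text \<open>Monotonicity in the step lets smallness at one step control all smaller steps, so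
  convergence along one sequence implies the full limit from the right.\<close>

lemma convex_second_difference_mono:
  fixes f :: "'a::real_normed_vector \<Rightarrow> real"
  assumes f: "convex_on (ball a r) f" and b: "x + t *\<^sub>R e \<in> ball a r" "x - t *\<^sub>R e \<in> ball a r" "x \<in> ball a r"
    and s: "0 < s" "s \<le> t"
  shows "second_quotient f x e s \<le> second_quotient f x e t"
    and "0 \<le> second_quotient f x e t"
proof -
  define u where "u = s / t"
  have u: "0 \<le> u" "u \<le> 1" "s = u * t" "u > 0" using s by (auto simp: u_def)
  have 1: "f (x + s *\<^sub>R e) \<le> (1 - u) * f x + u * f (x + t *\<^sub>R e)"
    using convex_onD[OF f u(1,2) b(3,1)] by (simp add: u(3) algebra_simps)
  have 2: "f (x - s *\<^sub>R e) \<le> (1 - u) * f x + u * f (x - t *\<^sub>R e)"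
    using convex_onD[OF f u(1,2) b(3,2)] by (simp add: u(3) algebra_simps)
  have "f (x + s *\<^sub>R e) + f (x - s *\<^sub>R e) - 2 * f x \<le> u * (f (x + t *\<^sub>R e) + f (x - t *\<^sub>R e) - 2 * f x)"
    using 1 2 by (simp add: algebra_simps)
  then have "second_quotient f x e s \<le> u * (f (x + t *\<^sub>R e) + f (x - t *\<^sub>R e) - 2 * f x) / s"
    by (rule divide_right_mono) (use s in simp)
  moreover have "u * X / s = X / t" for X using s by (simp add: u_def)
  ultimately show "second_quotient f x e s \<le> second_quotient f x e t"
    by metis
  have "f ((1 - 1/2) *\<^sub>R (x + t *\<^sub>R e) + (1/2) *\<^sub>R (x - t *\<^sub>R e)) \<le> (1 - 1/2) * f (x + t *\<^sub>R e) + 1/2 * f (x - t *\<^sub>R e)"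
    by (rule convex_onD[OF f _ _ b(1,2)]) auto
  moreover have "(1 - 1/2) *\<^sub>R (x + t *\<^sub>R e) + (1/2) *\<^sub>R (x - t *\<^sub>R e) = (1/2) *\<^sub>R (x + x)"
    by (simp flip: scaleR_add_right)
  moreover have "(1/2) *\<^sub>R (x + x) = x" by (rule scaleR_half_double)
  ultimately have "f x \<le> (1 - 1/2) * f (x + t *\<^sub>R e) + 1/2 * f (x - t *\<^sub>R e)" by metis
  then have "0 \<le> f (x + t *\<^sub>R e) + f (x - t *\<^sub>R e) - 2 * f x" by (simp add: field_simps)
  then show "0 \<le> second_quotient f x e t"
    using s by (intro divide_nonneg_nonneg) auto
qed

text \<open>A cutoff whose points of nondifferentiability lie in the explicit null set formed by its
  centre and a sphere, so that almost everywhere differentiability is not presupposed.\<close>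

definition hat :: "'a::euclidean_space \<Rightarrow> real \<Rightarrow> 'a \<Rightarrow> real" where
  "hat a \<rho> x = max 0 (\<rho> - norm (x - a))"

lemma hat_differentiable:
  assumes "x \<noteq> a" "norm (x - a) \<noteq> \<rho>"
  shows "hat a \<rho> differentiable (at x)"
proof (cases "norm (x - a) < \<rho>")
  case True
  have "(\<lambda>y. \<rho> - norm (y - a)) differentiable (at x)"
    using assms(1) by (intro derivative_intros differentiable_compose[of norm] differentiable_norm_at) auto
  then obtain D where D: "((\<lambda>y. \<rho> - norm (y - a)) has_derivative D) (at x)" by (auto simp: differentiable_def)
  have "open {y. norm (y - a) < \<rho>}" by (intro open_Collect_less continuous_intros)
  then have "(hat a \<rho> has_derivative D) (at x)"
    by (rule has_derivative_transform_within_open[OF D]) (use True in \<open>auto simp: hat_def\<close>)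
  then show ?thesis by (auto simp: differentiable_def)
next
  case False
  have "open {y. norm (y - a) > \<rho>}" by (intro open_Collect_less continuous_intros)
  then have "(hat a \<rho> has_derivative (\<lambda>_. 0)) (at x)"
    by (rule has_derivative_transform_within_open[OF has_derivative_const[of 0]])
      (use False assms in \<open>auto simp: hat_def\<close>)
  then show ?thesis by (auto simp: differentiable_def)
qed

text \<open>Integrated against the cutoff \<open>hat\<close>, the second difference quotients of \<open>f\<close> turn into those of
  the cutoff by translation invariance, and these tend to zero almost everywhere.\<close>

lemma convex_AE_second_differences:
  fixes f :: "real^'n \<Rightarrow> real"
  assumes r: "r > 0" and f: "convex_on (ball a r) f" and e: "norm e = 1"
  shows "AE x in lborel. x \<in> ball a (r/2) \<longrightarrow>
    ((\<lambda>t. second_quotient f x e t) \<longlongrightarrow> 0) (at_right 0)"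
proof -
  define \<rho> where "\<rho> = r / 2"
  define \<eta> where "\<eta> = hat a \<rho>"
  \<comment> \<open>This ball contains all translates by at most \<open>r / 4\<close> of the support
    of the cutoff, and \<open>f\<close> is bounded on it.\<close>
  define C where "C = cball a (3 * r / 4)"
  define F where "F x = indicator C x * f x" for x
  define \<tau> where "\<tau> k = r / 8 * inverse (real (Suc k))" for k
  have \<tau>: "0 < \<tau> k" "\<tau> k < r / 4" for k proof -
    have "inverse (real (Suc k)) \<le> 1" by (simp add: inverse_le_1_iff)
    then have "\<tau> k \<le> r / 8 * 1" unfolding \<tau>_def using r by (intro mult_left_mono) auto
    then show "\<tau> k < r / 4" using r by simp
    show "0 < \<tau> k" using r by (simp add: \<tau>_def)
  qed
  have \<tau>0: "\<tau> \<longlonglongrightarrow> 0" unfolding \<tau>_def by (intro tendsto_mult_right_zero LIMSEQ_inverse_real_of_nat)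
  have Cr: "C \<subseteq> ball a r" using r by (auto simp: C_def)
  have contf: "continuous_on C f"
    using continuous_on_subset[OF convex_on_continuous[OF open_ball f] Cr] .
  then have "compact (f ` C)" unfolding C_def using compact_continuous_image compact_cball by blast
  then obtain B where B: "\<And>x. x \<in> C \<Longrightarrow> \<bar>f x\<bar> \<le> B" "B > 0"
    using compact_imp_bounded bounded_pos by (metis (no_types, lifting) imageI real_norm_def)
  have FB: "\<bar>F x\<bar> \<le> B" for x using B by (auto simp: F_def indicator_def)
  have Fm [measurable]: "F \<in> borel_measurable borel"
  proof -
    have "(\<lambda>x. indicator C x *\<^sub>R f x) \<in> borel_measurable borel"
      by (rule borel_measurable_continuous_on_indicator[OF _ contf]) (simp add: C_def)
    then show ?thesis by (simp add: F_def[abs_def])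
  qed
  have \<eta>c: "continuous_on UNIV \<eta>" unfolding \<eta>_def hat_def by (intro continuous_intros)
  then have \<eta>m [measurable]: "\<eta> \<in> borel_measurable borel" by (rule borel_measurable_continuous_onI)
  have \<eta>lip: "\<bar>\<eta> x - \<eta> y\<bar> \<le> norm (x - y)" for x y
    using norm_triangle_ineq3[of "x - a" "y - a"] unfolding \<eta>_def hat_def by (simp add: max_def) linarith
  have \<eta>0: "\<eta> x = 0" if "x \<notin> ball a \<rho>" for x
    using that by (simp add: \<eta>_def hat_def dist_norm norm_minus_commute)
  have \<eta>ge: "\<eta> x \<ge> 0" "\<eta> x \<le> \<rho>" for x using r by (auto simp: \<eta>_def hat_def \<rho>_def max_def)
  have inC: "x + t *\<^sub>R e \<in> C" if "x \<in> ball a \<rho>" "\<bar>t\<bar> \<le> r/4" for x t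
  proof -
    have eq: "x + t *\<^sub>R e - a = (x - a) + t *\<^sub>R e" by simp
    have "norm (x + t *\<^sub>R e - a) \<le> norm (x - a) + norm (t *\<^sub>R e)"
      unfolding eq by (rule norm_triangle_ineq)
    then have "norm (x + t *\<^sub>R e - a) \<le> norm (x - a) + \<bar>t\<bar>" using e by simp
    moreover have "norm (x - a) < r / 2" using that by (simp add: \<rho>_def dist_norm norm_minus_commute)
    ultimately have "norm (x + t *\<^sub>R e - a) \<le> 3 * r / 4" using that(2) by linarith
    then show ?thesis unfolding C_def mem_cball dist_norm norm_minus_commute[of a] .
  qed
  \<comment> \<open>\<open>g\<close> and \<open>h\<close> are the two sides of a discrete
    integration by parts. Convexity makes \<open>g\<close> nonnegative, so convergence of its
    integrals to zero is convergence in the mean.\<close>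
  define g where "g k x = \<eta> x * (second_quotient F x e (\<tau> k))" for k x
  define h where "h k x = F x * (second_quotient \<eta> x e (\<tau> k))" for k x
  have gf: "g k x = \<eta> x * (second_quotient f x e (\<tau> k))" for k x
  proof (cases "x \<in> ball a \<rho>")
    case True
    show ?thesis using inC[OF True, of "\<tau> k"] inC[OF True, of "- \<tau> k"] inC[OF True, of 0] \<tau>[of k]
      by (simp add: g_def F_def)
  qed (simp add: g_def \<eta>0)
  have g_nonneg: "g k x \<ge> 0" for k x
  proof (cases "x \<in> ball a \<rho>")
    case True
    have "0 \<le> second_quotient f x e (\<tau> k)"
      by (rule convex_second_difference_mono(2)[OF f, of _ _ _ "\<tau> k"])
        (use inC[OF True, of "\<tau> k"] inC[OF True, of "- \<tau> k"] inC[OF True, of 0] \<tau>[of k] Cr in auto)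
    then show ?thesis unfolding gf by (rule mult_nonneg_nonneg[OF \<eta>ge(1)])
  qed (simp add: g_def \<eta>0)
  have int: "integrable lborel (\<lambda>x. \<eta> (x + c) * F (x + d))" for c d
  proof (rule integrable_bounded_cball)
    show "\<bar>\<eta> (x + c) * F (x + d)\<bar> \<le> \<rho> * B" for x
      unfolding abs_mult by (rule mult_mono) (use \<eta>ge[of "x + c"] FB[of "x + d"] in auto)
    show "\<eta> (x + c) * F (x + d) = 0" if "x \<notin> cball (a - d) r" for x
    proof -
      have "dist a (x + d) = dist (a - d) x" by (simp add: dist_norm algebra_simps)
      then have "x + d \<notin> C" using that r by (simp add: C_def)
      then show ?thesis by (simp add: F_def)
    qed
  qed measurable
  have shift: "(\<integral>x. \<eta> x * F (x + c) \<partial>lborel) = (\<integral>x. \<eta> (x - c) * F x \<partial>lborel)" for c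
    using integral_lborel_shift[of "\<lambda>x. \<eta> (x - c) * F x" c] by simp
  have int_gh: "integrable lborel (g k)" "(\<integral>x. g k x \<partial>lborel) = (\<integral>x. h k x \<partial>lborel)" for k
  proof -
    have g_eq: "g k = (\<lambda>x. (\<eta> x * F (x + \<tau> k *\<^sub>R e) + \<eta> x * F (x - \<tau> k *\<^sub>R e) - 2 * (\<eta> x * F x)) / \<tau> k)"
      by (simp add: g_def fun_eq_iff algebra_simps)
    have h_eq: "h k = (\<lambda>x. (\<eta> (x - \<tau> k *\<^sub>R e) * F x + \<eta> (x + \<tau> k *\<^sub>R e) * F x - 2 * (\<eta> x * F x)) / \<tau> k)"
      by (simp add: h_def fun_eq_iff algebra_simps)
    note I = int[of 0 "\<tau> k *\<^sub>R e", simplified] int[of 0 "- (\<tau> k *\<^sub>R e)", simplified] int[of 0 0, simplified]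
      int[of "\<tau> k *\<^sub>R e" 0, simplified] int[of "- (\<tau> k *\<^sub>R e)" 0, simplified]
    show "integrable lborel (g k)" unfolding g_eq
      by (intro integrable_divide Bochner_Integration.integrable_diff Bochner_Integration.integrable_add
        integrable_mult_right I)
    show "(\<integral>x. g k x \<partial>lborel) = (\<integral>x. h k x \<partial>lborel)"
      unfolding g_eq h_eq
      using I shift[of "\<tau> k *\<^sub>R e"] shift[of "- (\<tau> k *\<^sub>R e)"] by simp
  qed
  \<comment> \<open>The cutoff is 1-Lipschitz, so its second difference quotients are at most 2 in
    absolute value; this is the source of the dominating function.\<close>
  have "(\<lambda>k. \<integral>x. h k x \<partial>lborel) \<longlonglongrightarrow> (\<integral>x. 0 \<partial>(lborel :: (real^'n) measure))"
  proof (rule integral_dominated_convergence[where w = "\<lambda>x. 2 * B * indicator C x"])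
    show "integrable lborel (\<lambda>x. 2 * B * indicator C x :: real)"
      by (rule integrable_bounded_cball[where B = "2 * B" and a = a and R = "3 * r / 4"])
        (use B(2) in \<open>auto simp: C_def indicator_def\<close>)
    show "h k \<in> borel_measurable lborel" for k unfolding h_def by measurable
    show "AE x in lborel. norm (h k x) \<le> 2 * B * indicator C x" for k
    proof (rule AE_I2)
      fix x
      have "\<bar>\<eta> (x + \<tau> k *\<^sub>R e) - \<eta> x\<bar> \<le> \<tau> k" "\<bar>\<eta> (x - \<tau> k *\<^sub>R e) - \<eta> x\<bar> \<le> \<tau> k"
        using \<eta>lip[of "x + \<tau> k *\<^sub>R e" x] \<eta>lip[of "x - \<tau> k *\<^sub>R e" x] e \<tau>[of k] by auto
      then have "\<bar>\<eta> (x + \<tau> k *\<^sub>R e) + \<eta> (x - \<tau> k *\<^sub>R e) - 2 * \<eta> x\<bar> / \<tau> k \<le> 2"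
        using \<tau>[of k] by (simp add: divide_le_eq)
      then have "\<bar>F x\<bar> * (\<bar>\<eta> (x + \<tau> k *\<^sub>R e) + \<eta> (x - \<tau> k *\<^sub>R e) - 2 * \<eta> x\<bar> / \<tau> k) \<le> (B * indicator C x) * 2"
        using \<tau>[of k] B by (intro mult_mono) (auto simp: F_def indicator_def)
      then show "norm (h k x) \<le> 2 * B * indicator C x"
        using \<tau>[of k] by (simp add: h_def abs_mult)
    qed
    have "negligible ({a} \<union> sphere a \<rho>)" by (simp add: negligible_sphere)
    moreover have "{a} \<union> sphere a \<rho> \<in> sets lborel" by simp
    ultimately have "{a} \<union> sphere a \<rho> \<in> null_sets lborel"
      by (simp only: negligible_iff_null_sets null_sets_completion_iff)
    then have "AE x in lborel. x \<notin> {a} \<union> sphere a \<rho>" by (rule AE_not_in)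
    then show "AE x in lborel. (\<lambda>k. h k x) \<longlonglongrightarrow> 0"
    proof eventually_elim
      case (elim x)
      then have "\<eta> differentiable (at x)"
        unfolding \<eta>_def by (intro hat_differentiable) (auto simp: dist_norm norm_minus_commute)
      moreover have "filterlim \<tau> (at_right 0) sequentially"
        using \<tau>0 \<tau>(1) less_imp_neq[OF \<tau>(1)] by (auto simp: filterlim_at)
      ultimately have "(\<lambda>k. second_quotient \<eta> x e (\<tau> k)) \<longlonglongrightarrow> 0"
        using filterlim_compose[OF second_difference_quotient_tendsto_0] by blast
      then show ?case unfolding h_def by (rule tendsto_mult_right_zero)
    qed
  qed auto
  then have "(\<lambda>k. \<integral>x. norm (g k x) \<partial>lborel) \<longlonglongrightarrow> 0"
    using g_nonneg int_gh(2) by simp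
  \<comment> \<open>Convergence in the mean gives pointwise convergence along a subsequence only;
    monotonicity in the step removes this restriction below.\<close>
  then obtain \<sigma> where \<sigma>: "strict_mono \<sigma>" "AE x in lborel. (\<lambda>n. g (\<sigma> n) x) \<longlonglongrightarrow> 0"
    using tendsto_L1_AE_subseq[of lborel g, OF int_gh(1)] by blast
  show ?thesis using \<sigma>(2)
  proof eventually_elim
    case (elim x)
    show ?case
    proof
      assume x: "x \<in> ball a (r/2)"
      let ?D = "\<lambda>t. second_quotient f x e t"
      have \<eta>x: "\<eta> x > 0" using x by (simp add: \<eta>_def hat_def \<rho>_def dist_norm norm_minus_commute)
      have inr: "x + t *\<^sub>R e \<in> ball a r" if "\<bar>t\<bar> \<le> r/4" for t
        using inC[OF _ that, of x] x Cr by (auto simp: \<rho>_def)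
      show "(?D \<longlongrightarrow> 0) (at_right 0)"
      proof (rule tendstoI)
        fix \<epsilon> :: real assume "\<epsilon> > 0"
        then have "\<forall>\<^sub>F n in sequentially. g (\<sigma> n) x < \<eta> x * \<epsilon>"
          using order_tendstoD(2)[OF elim] \<eta>x by simp
        then obtain n where "g (\<sigma> n) x < \<eta> x * \<epsilon>" using eventually_happens by fastforce
        then have n: "?D (\<tau> (\<sigma> n)) < \<epsilon>" unfolding gf mult_less_cancel_left_pos[OF \<eta>x] .
        let ?t = "\<tau> (\<sigma> n)"
        have "dist (?D s) 0 < \<epsilon>" if s: "0 < s" "s < ?t" for s
        proof -
          have t4: "?t < r/4" "0 < ?t" using \<tau>[of "\<sigma> n"] by auto
          have "?D s \<le> ?D ?t"
            by (rule convex_second_difference_mono(1)[OF f])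
              (use s t4 inr[of ?t] inr[of "- ?t"] inr[of 0] r in auto)
          moreover have "0 \<le> ?D s"
            by (rule convex_second_difference_mono(2)[OF f, of _ _ _ s])
              (use s t4 inr[of s] inr[of "- s"] inr[of 0] r in auto)
          ultimately show ?thesis using n by simp
        qed
        then show "\<forall>\<^sub>F s in at_right 0. dist (?D s) 0 < \<epsilon>"
          unfolding eventually_at_right_field using \<tau>(1) by blast
      qed
    qed
  qed
qed

lemma convex_on_negligible_nondifferentiable:
  fixes f :: "real^'n \<Rightarrow> real"
  assumes r: "r > 0" and f: "convex_on (ball a r) f"
  shows "negligible {x \<in> ball a (r/2). \<not> f differentiable (at x)}"
proof -
  have "AE x in lborel. \<forall>i\<in>(UNIV::'n set). x \<in> ball a (r/2) \<longrightarrow>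
    ((\<lambda>t. second_quotient f x (axis i 1) t) \<longlongrightarrow> 0) (at_right 0)"
    by (rule AE_finite_allI) (rule finite, rule convex_AE_second_differences[OF r f norm_axis_1])
  then have "AE x in lborel. x \<in> ball a (r/2) \<longrightarrow> f differentiable (at x)"
  proof eventually_elim
    case (elim x)
    show ?case
    proof
      assume x: "x \<in> ball a (r/2)"
      have sub: "ball x (r/2) \<subseteq> ball a r" using x by (auto simp: dist_commute) (smt (verit) dist_triangle dist_commute)
      show "f differentiable (at x)"
        by (rule convex_differentiable_of_second_differences[of "r/2"])
          (use r elim x in \<open>auto intro: convex_on_subset[OF f sub]\<close>)
    qed
  qed
  then obtain N where N: "N \<in> null_sets lborel" "{x. \<not> (x \<in> ball a (r/2) \<longrightarrow> f differentiable (at x))} \<subseteq> N"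
    by (auto simp: eventually_ae_filter)
  have "negligible N" using N(1) by (simp add: negligible_iff_null_sets null_sets_completionI)
  then show ?thesis by (rule negligible_subset) (use N(2) in auto)
qed

lemma locally_convex_negligible_nondifferentiable:
  fixes f :: "real^'n \<Rightarrow> real"
  assumes "locally_convex \<Omega> f"
  shows "negligible {x \<in> \<Omega>. \<not> f differentiable (at x)}"
proof (rule locally_negligible_alt[THEN iffD2], intro ballI)
  let ?S = "{x \<in> \<Omega>. \<not> f differentiable (at x)}"
  fix x assume x: "x \<in> ?S"
  then obtain r where r: "r > 0" "ball x r \<subseteq> \<Omega>" "convex_on (ball x r) f"
    using assms by (auto simp: locally_convex_def)
  show "\<exists>U. openin (top_of_set ?S) U \<and> x \<in> U \<and> negligible U"
  proof (intro exI[of _ "?S \<inter> ball x (r/2)"] conjI)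
    show "openin (top_of_set ?S) (?S \<inter> ball x (r/2))" by (rule openin_open_Int) simp
    show "x \<in> ?S \<inter> ball x (r/2)" using x r by simp
    show "negligible (?S \<inter> ball x (r/2))"
      by (rule negligible_subset[OF convex_on_negligible_nondifferentiable[OF r(1,3)]]) auto
  qed
qed

section \<open>Integrals of gradients\<close>

text \<open>\<open>grad\<close> has unspecified values where no derivative exists, so measurability
  of functions built from it rests on the completeness of Lebesgue measure.\<close>

lemma borel_measurable_lebesgue_AE_cong:
  fixes f g :: "'a::euclidean_space \<Rightarrow> real"
  assumes f: "f \<in> borel_measurable lebesgue" and ae: "AE x in lebesgue. f x = g x"
  shows "g \<in> borel_measurable lebesgue"
proof (rule measurableI)
  fix A :: "real set" assume A: "A \<in> sets borel"
  have 1: "f -` A \<inter> space lebesgue \<in> sets lebesgue" using f A by (rule measurable_sets)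
  have 2: "AE x in lebesgue. x \<in> f -` A \<inter> space lebesgue \<longleftrightarrow> x \<in> g -` A \<inter> space lebesgue"
    using ae by eventually_elim auto
  show "g -` A \<inter> space lebesgue \<in> sets lebesgue"
    by (rule completion.in_sets_AE[OF 2 1]) auto
qed auto

lemma borel_measurable_lebesgue_AE_limit:
  fixes f :: "'a::euclidean_space \<Rightarrow> real"
  assumes q: "\<And>k. q k \<in> borel_measurable lebesgue"
    and lim: "AE x in lebesgue. (\<lambda>k. q k x) \<longlonglongrightarrow> f x"
  shows "f \<in> borel_measurable lebesgue"
proof (rule borel_measurable_lebesgue_AE_cong)
  show "(\<lambda>x. lim (\<lambda>k. q k x)) \<in> borel_measurable lebesgue" using q by (rule borel_measurable_lim_metric)
  show "AE x in lebesgue. lim (\<lambda>k. q k x) = f x" using lim by eventually_elim (rule limI)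
qed

lemma AE_not_in_negligible: "negligible N \<Longrightarrow> AE x in lebesgue. x \<notin> N"
  by (simp add: negligible_iff_null_sets AE_not_in)

lemma integrable_lebesgue_indicator:
  fixes A :: "'a::euclidean_space set"
  assumes "bounded A" "A \<in> sets borel"
  shows "integrable lebesgue (indicator A :: 'a \<Rightarrow> real)"
proof -
  have "emeasure lborel A < \<infinity>" using assms(1) by (rule emeasure_bounded_finite)
  then have "integrable lborel (indicator A :: 'a \<Rightarrow> real)" using assms(2) by (intro integrable_real_indicator) auto
  then show ?thesis using assms(2) by (subst integrable_completion) auto
qed

lemma difference_quotient_tendsto_grad:
  fixes f :: "real^'n \<Rightarrow> real"
  assumes "f differentiable (at x)"
  shows "(\<lambda>k. real (Suc k) * (f (x + (1 / real (Suc k)) *\<^sub>R axis i 1) - f x)) \<longlonglongrightarrow> grad f x $ i"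
proof -
  have "((\<lambda>t. x + t *\<^sub>R axis i 1) has_derivative (\<lambda>h. h *\<^sub>R axis i 1)) (at 0)"
    by (auto intro!: derivative_eq_intros)
  from has_derivative_compose[OF this, of f "\<lambda>h. h \<bullet> grad f x"] has_derivative_grad[OF assms]
  have "((\<lambda>t. f (x + t *\<^sub>R axis i 1)) has_derivative (\<lambda>h. h * grad f x $ i)) (at 0)"
    by (simp add: inner_axis')
  then have "((\<lambda>t. f (x + t *\<^sub>R axis i 1)) has_real_derivative grad f x $ i) (at 0)"
    by (simp add: has_field_derivative_def mult_commute_abs)
  then have "((\<lambda>t. (f (x + t *\<^sub>R axis i 1) - f x) / t) \<longlongrightarrow> grad f x $ i) (at 0)"
    by (simp add: DERIV_def)
  moreover have "filterlim (\<lambda>k. 1 / real (Suc k)) (at 0) sequentially"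
    using LIMSEQ_inverse_real_of_nat by (simp add: filterlim_at inverse_eq_divide)
  ultimately have "(\<lambda>k. (f (x + (1 / real (Suc k)) *\<^sub>R axis i 1) - f x) / (1 / real (Suc k))) \<longlonglongrightarrow> grad f x $ i"
    by (rule filterlim_compose)
  then show ?thesis by (simp add: mult.commute)
qed

text \<open>The component is an almost everywhere limit of difference quotients of the extension of
  \<open>f\<close> by zero; as \<Omega> is open, the shifted points eventually lie in it and the
  extension does no harm.\<close>

lemma grad_component_measurable:
  fixes f :: "real^'n \<Rightarrow> real"
  assumes \<Omega>: "open \<Omega>" and f: "continuous_on \<Omega> f" and d: "negligible {x \<in> \<Omega>. \<not> f differentiable (at x)}"
  shows "(\<lambda>x. indicator \<Omega> x * (grad f x $ i)) \<in> borel_measurable lebesgue"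
proof (rule borel_measurable_lebesgue_AE_limit)
  define F where "F x = indicator \<Omega> x *\<^sub>R f x" for x
  have [measurable]: "F \<in> borel_measurable borel"
    unfolding F_def using borel_measurable_continuous_on_indicator[OF _ f] \<Omega> by simp
  have [measurable]: "\<Omega> \<in> sets borel" using \<Omega> by simp
  let ?q = "\<lambda>k x. indicator \<Omega> x * (real (Suc k) * (F (x + (1 / real (Suc k)) *\<^sub>R axis i 1) - F x))"
  show "?q k \<in> borel_measurable lebesgue" for k
    by (rule measurable_completion) measurable
  show "AE x in lebesgue. (\<lambda>k. ?q k x) \<longlonglongrightarrow> indicator \<Omega> x * (grad f x $ i)"
    using AE_not_in_negligible[OF d]
  proof eventually_elim
    case (elim x)
    show ?case
    proof (cases "x \<in> \<Omega>")
      case True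
      have "(\<lambda>k. x + (1 / real (Suc k)) *\<^sub>R axis i 1) \<longlonglongrightarrow> x + 0 *\<^sub>R axis i 1"
        using LIMSEQ_inverse_real_of_nat by (intro tendsto_intros) (simp add: inverse_eq_divide)
      then have "\<forall>\<^sub>F k in sequentially. x + (1 / real (Suc k)) *\<^sub>R axis i 1 \<in> \<Omega>"
        using topological_tendstoD \<Omega> True by fastforce
      then have "\<forall>\<^sub>F k in sequentially. real (Suc k) * (f (x + (1 / real (Suc k)) *\<^sub>R axis i 1) - f x) = ?q k x"
        by eventually_elim (use True in \<open>simp add: F_def\<close>)
      moreover have "f differentiable (at x)" using elim True by simp
      ultimately show ?thesis
        using Lim_transform_eventually[OF difference_quotient_tendsto_grad] True by fastforce
    qed simp
  qed
qed

text \<open>Difference quotients have integral zero by translation invariance, and the Lipschitz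
  bound dominates them. The radius \<open>R + 1\<close> leaves room for steps of length at most
  1.\<close>

lemma integral_grad_compact_support:
  fixes h :: "real^'n \<Rightarrow> real"
  assumes h: "continuous_on UNIV h" "L-lipschitz_on (cball 0 (R + 1)) h" "\<And>x. x \<notin> cball 0 R \<Longrightarrow> h x = 0"
    and d: "negligible {x. \<not> h differentiable (at x)}"
  shows "(\<integral>x. grad h x $ i \<partial>lebesgue) = 0"
proof -
  define q where "q k x = real (Suc k) * (h (x + (1 / real (Suc k)) *\<^sub>R axis i 1) - h x)" for k x
  have [measurable]: "h \<in> borel_measurable borel" using h(1) by (rule borel_measurable_continuous_onI)
  have qm: "q k \<in> borel_measurable borel" for k unfolding q_def by measurable
  have "bounded (h ` cball 0 R)"
    by (intro compact_imp_bounded compact_continuous_image continuous_on_subset[OF h(1)]) auto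
  then obtain B where B: "\<And>x. x \<in> cball 0 R \<Longrightarrow> \<bar>h x\<bar> \<le> B" unfolding bounded_iff by (metis imageI real_norm_def)
  have hB: "\<bar>h x\<bar> \<le> max B 0" for x using B[of x] h(3)[of x] by (cases "x \<in> cball 0 R") auto
  have ih: "integrable lborel h" by (rule integrable_bounded_cball[OF _ hB h(3)]) measurable
  have ihs: "integrable lborel (\<lambda>x. h (x + c))" for c
  proof (rule integrable_bounded_cball[where a = "-c" and R = R])
    show "h (x + c) = 0" if "x \<notin> cball (- c) R" for x
    proof (rule h(3))
      have "- c - x = - (x + c)" by simp
      then have "dist (- c) x = norm (x + c)" unfolding dist_norm by (simp only: norm_minus_cancel)
      then show "x + c \<notin> cball 0 R" using that by simp
    qed
  qed (use hB in auto)
  have q0: "(\<integral>x. q k x \<partial>lebesgue) = 0" for k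
  proof -
    have "(\<integral>x. q k x \<partial>lebesgue) = (\<integral>x. q k x \<partial>lborel)" by (rule integral_completion) (use qm in simp)
    also have "\<dots> = 0"
      unfolding q_def using integral_lborel_shift[of h "(1 / real (Suc k)) *\<^sub>R axis i 1"]
      by (simp add: Bochner_Integration.integral_diff[OF ihs ih] del: of_nat_Suc)
    finally show ?thesis .
  qed
  have "(\<lambda>k. \<integral>x. q k x \<partial>lebesgue) \<longlonglongrightarrow> (\<integral>x. grad h x $ i \<partial>lebesgue)"
  proof (rule integral_dominated_convergence[where w = "\<lambda>x. L * indicator (cball 0 (R + 1)) x"])
    show "(\<lambda>x. grad h x $ i) \<in> borel_measurable lebesgue"
      using grad_component_measurable[of UNIV h i] h(1) d by simp
    show "q k \<in> borel_measurable lebesgue" for k using qm by (intro measurable_completion) simp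
    show "integrable lebesgue (\<lambda>x. L * indicator (cball 0 (R + 1)) x)"
      by (intro integrable_mult_right integrable_lebesgue_indicator bounded_cball) simp
    show "AE x in lebesgue. (\<lambda>k. q k x) \<longlonglongrightarrow> grad h x $ i"
      using AE_not_in_negligible[OF d]
      by eventually_elim (simp add: q_def difference_quotient_tendsto_grad del: of_nat_Suc)
    show "AE x in lebesgue. norm (q k x) \<le> L * indicator (cball 0 (R + 1)) x" for k
    proof (rule AE_I2)
      fix x :: "real^'n"
      define y where "y = x + (1 / real (Suc k)) *\<^sub>R axis i 1"
      have dy: "dist y x = 1 / real (Suc k)" by (simp add: y_def dist_norm norm_axis_1)
      then have dy1: "dist y x \<le> 1" by simp
      have L0: "L \<ge> 0" using h(2) lipschitz_on_nonneg by blast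
      show "norm (q k x) \<le> L * indicator (cball 0 (R + 1)) x"
      proof (cases "x \<in> cball 0 R \<or> y \<in> cball 0 R")
        case True
        have "norm y \<le> norm x + 1" "norm x \<le> norm y + 1"
          using dy1 norm_triangle_ineq2[of y x] norm_triangle_ineq2[of x y] by (auto simp: dist_norm norm_minus_commute)
        then have "x \<in> cball 0 (R + 1)" "y \<in> cball 0 (R + 1)" using True by auto
        moreover from lipschitz_onD[OF h(2) this(2,1)] have "\<bar>h y - h x\<bar> \<le> L * (1 / real (Suc k))"
          using dy by (simp add: dist_real_def)
        then have "real (Suc k) * \<bar>h y - h x\<bar> \<le> L" by (simp add: field_simps del: of_nat_Suc)
        ultimately show ?thesis by (simp add: q_def y_def[symmetric] abs_mult del: of_nat_Suc)
      next
        case False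
        then have "h x = 0" "h y = 0" using h(3) by auto
        then show ?thesis using L0 by (simp add: q_def y_def[symmetric] del: of_nat_Suc)
      qed
    qed
  qed
  then show ?thesis using q0 by (simp add: LIMSEQ_const_iff)
qed

text \<open>A continuously differentiable replacement for the positive part, so that the chain rule
  also holds on the zero level. Its derivative \<open>ramp'\<close> lies between 0 and 1 and
  approximates an indicator.\<close>

definition ramp :: "real \<Rightarrow> real \<Rightarrow> real" where
  "ramp \<delta> s = (if s \<le> 0 then 0 else s\<^sup>2 / (s + \<delta>))"

definition ramp' :: "real \<Rightarrow> real \<Rightarrow> real" where
  "ramp' \<delta> s = (if s \<le> 0 then 0 else (s\<^sup>2 + 2 * s * \<delta>) / (s + \<delta>)\<^sup>2)"

lemma ramp'_bounds:
  assumes "\<delta> > 0" shows "0 \<le> ramp' \<delta> s" "ramp' \<delta> s \<le> 1"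
proof -
  show "0 \<le> ramp' \<delta> s" using assms by (simp add: ramp'_def)
  have "s\<^sup>2 + 2 * s * \<delta> \<le> (s + \<delta>)\<^sup>2" by (simp add: power2_sum)
  then show "ramp' \<delta> s \<le> 1" using assms by (simp add: ramp'_def divide_le_eq_1)
qed

lemma ramp'_measurable [measurable]: "ramp' \<delta> \<in> borel_measurable borel"
  unfolding ramp'_def by measurable

lemma DERIV_ramp:
  assumes \<delta>: "\<delta> > 0"
  shows "(ramp \<delta> has_real_derivative ramp' \<delta> s) (at s)"
proof -
  consider "s < 0" | "s = 0" | "s > 0" by linarith
  then show ?thesis
  proof cases
    case 1
    have "((\<lambda>_. 0) has_real_derivative ramp' \<delta> s) (at s)" using 1 by (simp add: ramp'_def)
    then show ?thesis
      by (rule has_field_derivative_transform_within_open[where S = "{..<0}"]) (use 1 in \<open>auto simp: ramp_def\<close>)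
  next
    case 2
    have "((\<lambda>h. ramp \<delta> h / h) \<longlongrightarrow> 0) (at 0)"
    proof (rule Lim_null_comparison)
      show "\<forall>\<^sub>F h in at 0. norm (ramp \<delta> h / h) \<le> \<bar>h\<bar> / \<delta>"
      proof (rule always_eventually, rule allI)
        fix h :: real
        show "norm (ramp \<delta> h / h) \<le> \<bar>h\<bar> / \<delta>"
        proof (cases "h \<le> 0")
          case False
          then have "ramp \<delta> h / h = h / (h + \<delta>)" by (simp add: ramp_def power2_eq_square)
          moreover have "h / (h + \<delta>) \<le> h / \<delta>" using False \<delta> by (intro divide_left_mono) auto
          ultimately show ?thesis using False \<delta> by simp
        qed (use \<delta> in \<open>simp add: ramp_def divide_nonpos_pos\<close>)
      qed
      have "((\<lambda>h. \<bar>h\<bar> / \<delta>) \<longlongrightarrow> \<bar>0\<bar> / \<delta>) (at 0)" by (intro tendsto_intros) (use \<delta> in auto)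
      then show "((\<lambda>h. \<bar>h\<bar> / \<delta>) \<longlongrightarrow> 0) (at 0)" by simp
    qed
    then show ?thesis using 2 by (simp add: DERIV_def ramp_def ramp'_def)
  next
    case 3
    have "((\<lambda>s. s\<^sup>2 / (s + \<delta>)) has_real_derivative ramp' \<delta> s) (at s)"
      using 3 \<delta> by (auto intro!: derivative_eq_intros simp: ramp'_def power2_eq_square algebra_simps)
    then show ?thesis
      by (rule has_field_derivative_transform_within_open[where S = "{0<..}"]) (use 3 in \<open>auto simp: ramp_def\<close>)
  qed
qed

lemma ramp_lipschitz:
  assumes "\<delta> > 0" shows "\<bar>ramp \<delta> s - ramp \<delta> t\<bar> \<le> \<bar>s - t\<bar>"
proof -
  have "norm (ramp \<delta> s - ramp \<delta> t) \<le> 1 * norm (s - t)"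
    by (rule field_differentiable_bound[of UNIV _ "ramp' \<delta>"])
      (use DERIV_ramp[OF assms] ramp'_bounds[OF assms] in auto)
  then show ?thesis by simp
qed

text \<open>For nonpositive \<open>g\<close> the shift makes the argument negative, so the value is
  0 for every \<open>k\<close>; for positive \<open>g\<close> numerator and denominator both tend to
  \<open>g^2\<close>. The same shift keeps supports compact in the flux identity.\<close>

lemma ramp'_tendsto_indicator:
  "(\<lambda>k. ramp' (1 / real (Suc k)) (g - 1 / real (Suc k))) \<longlonglongrightarrow> (if g > 0 then 1 else 0)"
proof (cases "g > 0")
  case True
  define e where "e k = 1 / real (Suc k)" for k
  have e0: "e \<longlonglongrightarrow> 0" using LIMSEQ_inverse_real_of_nat by (simp add: e_def[abs_def] inverse_eq_divide)
  have "(\<lambda>k. ((g - e k)\<^sup>2 + 2 * (g - e k) * e k) / (g - e k + e k)\<^sup>2) \<longlonglongrightarrow> ((g - 0)\<^sup>2 + 2 * (g - 0) * 0) / (g - 0 + 0)\<^sup>2"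
    by (intro tendsto_intros e0) (use True in auto)
  moreover have "\<forall>\<^sub>F k in sequentially. ((g - e k)\<^sup>2 + 2 * (g - e k) * e k) / (g - e k + e k)\<^sup>2 = ramp' (e k) (g - e k)"
    using order_tendstoD(2)[OF e0 True] by eventually_elim (simp add: ramp'_def)
  ultimately have "(\<lambda>k. ramp' (e k) (g - e k)) \<longlonglongrightarrow> ((g - 0)\<^sup>2 + 2 * (g - 0) * 0) / (g - 0 + 0)\<^sup>2"
    by (rule Lim_transform_eventually)
  then show ?thesis using True by (simp add: e_def)
next
  case False
  then have "ramp' (1 / real (Suc k)) (g - 1 / real (Suc k)) = 0" for k
    by (simp add: ramp'_def) (smt (verit) of_nat_0_le_iff divide_pos_pos)
  then show ?thesis using False by simp
qed

text \<open>The tangent plane inequality for the concave function \<open>sqrt (1 - |q|^2)\<close>.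
  Multiplied by the root \<open>S\<close> at \<open>a\<close> it reads
  \<open>S T + a . q \<le> 1\<close>, which is Cauchy-Schwarz for the unit vectors
  \<open>(a, S)\<close> and \<open>(q, T)\<close>.\<close>

lemma lorentz_concavity:
  fixes a q :: "'a::real_inner"
  assumes a: "norm a < 1" and q: "norm q \<le> 1"
  shows "sqrt (1 - (norm q)\<^sup>2) \<le> sqrt (1 - (norm a)\<^sup>2) + a \<bullet> (a - q) / sqrt (1 - (norm a)\<^sup>2)"
proof -
  let ?S = "sqrt (1 - (norm a)\<^sup>2)" and ?T = "sqrt (1 - (norm q)\<^sup>2)"
  have a2: "(norm a)\<^sup>2 < 1" using a by (simp add: abs_square_less_1)
  have q2: "(norm q)\<^sup>2 \<le> 1" using q by (simp add: abs_square_le_1)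
  have S: "?S > 0" "?S\<^sup>2 = 1 - (norm a)\<^sup>2" "?T\<^sup>2 = 1 - (norm q)\<^sup>2" using a2 q2 by auto
  have "2 * (?S * ?T) \<le> ?S\<^sup>2 + ?T\<^sup>2" using sum_squares_bound[of ?S ?T] by simp
  moreover have "0 \<le> (norm a)\<^sup>2 + (norm q)\<^sup>2 - 2 * (a \<bullet> q)"
    using zero_le_power2[of "norm (a - q)"]
    by (simp add: power2_norm_eq_inner inner_diff_left inner_diff_right inner_commute)
  ultimately have "?S * ?T \<le> ?S\<^sup>2 + a \<bullet> (a - q)"
    using S by (simp add: inner_diff_right power2_norm_eq_inner)
  then show ?thesis using S(1) by (simp add: field_simps power2_eq_square)
qed

text \<open>Admissibility without the subsolution property, which cutting by a spacelike plane
  destroys in general.\<close>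

definition spacelike_convex :: "(real^'n) set \<Rightarrow> (real^'n \<Rightarrow> real) \<Rightarrow> bool" where
  "spacelike_convex \<Omega> v \<longleftrightarrow> continuous_on (closure \<Omega>) v \<and> weakly_spacelike \<Omega> v \<and> locally_convex \<Omega> v"

abbreviation area_density :: "(real^'n \<Rightarrow> real) \<Rightarrow> real^'n \<Rightarrow> real" where
  "area_density w x \<equiv> sqrt (1 - (norm (grad w x))\<^sup>2)"

lemma spacelike_convex_integrable:
  assumes \<Omega>: "open \<Omega>" "bounded \<Omega>" and v: "spacelike_convex \<Omega> v"
  shows "integrable lebesgue (\<lambda>x. indicator \<Omega> x * area_density v x)"
proof (rule Bochner_Integration.integrable_bound[OF integrable_lebesgue_indicator])
  have nd: "negligible {x \<in> \<Omega>. \<not> v differentiable (at x)}"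
    using v locally_convex_negligible_nondifferentiable by (auto simp: spacelike_convex_def)
  have c: "continuous_on \<Omega> v" using v by (auto simp: spacelike_convex_def intro: continuous_on_subset[OF _ closure_subset])
  note [measurable] = grad_component_measurable[OF \<Omega>(1) c nd]
  have [measurable]: "\<Omega> \<in> sets lebesgue" using \<Omega> by simp
  have "(\<lambda>x. indicator \<Omega> x * sqrt (1 - (\<Sum>i\<in>UNIV. (indicator \<Omega> x * (grad v x $ i))\<^sup>2))) \<in> borel_measurable lebesgue"
    by measurable
  moreover have "(\<lambda>x. indicator \<Omega> x * sqrt (1 - (\<Sum>i\<in>UNIV. (indicator \<Omega> x * (grad v x $ i))\<^sup>2)))
      = (\<lambda>x. indicator \<Omega> x * area_density v x)"
  proof
    fix x
    have "(norm (grad v x))\<^sup>2 = (\<Sum>i\<in>UNIV. (grad v x $ i)\<^sup>2)"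
      unfolding power2_norm_eq_inner inner_vec_def by (simp add: power2_eq_square)
    then show "indicator \<Omega> x * sqrt (1 - (\<Sum>i\<in>UNIV. (indicator \<Omega> x * (grad v x $ i))\<^sup>2))
      = indicator \<Omega> x * area_density v x"
      by (cases "x \<in> \<Omega>") auto
  qed
  ultimately show "(\<lambda>x. indicator \<Omega> x * area_density v x) \<in> borel_measurable lebesgue" by simp
  show "AE x in lebesgue. norm (indicator \<Omega> x * area_density v x) \<le> norm (indicator \<Omega> x :: real)"
    using AE_not_in_negligible[OF nd]
  proof eventually_elim
    case (elim x)
    then have "x \<in> \<Omega> \<Longrightarrow> norm (grad v x) \<le> 1"
      using v by (auto simp: spacelike_convex_def weakly_spacelike_def)
    then show ?case by (auto simp: indicator_def abs_square_le_1)
  qed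
qed (use \<Omega> in auto)

section \<open>Comparison of spacelike areas\<close>

text \<open>The integrand is a gradient component of \<open>ramp \<epsilon>\<close> applied to the
  excess over \<open>v\<close> of the plane lowered by \<epsilon>. Lowering confines the support to
  a compact subset of \<Omega>, away from the frontier, near which \<open>v\<close> need not be
  uniformly Lipschitz.\<close>

lemma spacelike_convex_flux:
  fixes v :: "real^'n \<Rightarrow> real"
  assumes \<Omega>: "open \<Omega>" "bounded \<Omega>" and v: "spacelike_convex \<Omega> v"
    and fr: "\<And>x. x \<in> frontier \<Omega> \<Longrightarrow> v x \<ge> a \<bullet> x + b" and \<epsilon>: "\<epsilon> > 0"
  shows "(\<integral>x. indicator \<Omega> x * ramp' \<epsilon> (a \<bullet> x + b - v x - \<epsilon>) * (a - grad v x) $ i \<partial>lebesgue) = 0"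
    (is "integral\<^sup>L lebesgue ?I = 0")
proof -
  define g where "g x = a \<bullet> x + b - v x - \<epsilon>" for x
  define h where "h x = (if x \<in> \<Omega> then ramp \<epsilon> (g x) else 0)" for x
  define K where "K = {x \<in> closure \<Omega>. 0 \<le> g x}"
  have cv: "continuous_on (closure \<Omega>) v" and ws: "weakly_spacelike \<Omega> v" and lc: "locally_convex \<Omega> v"
    using v by (auto simp: spacelike_convex_def)
  have cg: "continuous_on (closure \<Omega>) g" unfolding g_def by (intro continuous_intros cv)
  have "closed K"
  proof -
    have "K = closure \<Omega> \<inter> g -` {0..}" by (auto simp: K_def)
    then show ?thesis using continuous_closed_preimage[OF cg closed_closure closed_atLeast] by simp
  qed
  have K\<Omega>: "K \<subseteq> \<Omega>"
  proof
    fix x assume x: "x \<in> K"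
    show "x \<in> \<Omega>"
    proof (rule ccontr)
      assume "x \<notin> \<Omega>"
      then have "x \<in> frontier \<Omega>" using x \<Omega>(1) by (auto simp: K_def frontier_def interior_open)
      from fr[OF this] show False using x \<epsilon> by (simp add: K_def g_def)
    qed
  qed
  have h0: "h x = 0" if "x \<notin> K" for x
    using that closure_subset[of \<Omega>] by (auto simp: h_def K_def ramp_def)
  have oK: "open (- K)" using \<open>closed K\<close> by auto
  have lip: "\<exists>r>0. \<exists>L. L-lipschitz_on (cball x r) h" for x
  proof (cases "x \<in> K")
    case True
    then have x: "x \<in> \<Omega>" using K\<Omega> by blast
    obtain r L where r: "r > 0" and L: "L-lipschitz_on (ball x r \<inter> \<Omega>) v"
      using ws x by (auto simp: weakly_spacelike_def)
    have "open (ball x r \<inter> \<Omega>)" "x \<in> ball x r \<inter> \<Omega>" using \<Omega>(1) x r by auto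
    then obtain s where s: "s > 0" "cball x s \<subseteq> ball x r \<inter> \<Omega>" using open_contains_cball by blast
    have "(norm a + L)-lipschitz_on (cball x s) h"
    proof (rule lipschitz_onI)
      fix y z assume yz: "y \<in> cball x s" "z \<in> cball x s"
      then have "\<bar>v y - v z\<bar> \<le> L * norm (y - z)" using lipschitz_onD[OF L, of y z] subsetD[OF s(2)] by (metis dist_norm real_norm_def)
      moreover have "\<bar>a \<bullet> (y - z)\<bar> \<le> norm a * norm (y - z)" by (rule Cauchy_Schwarz_ineq2)
      moreover have "\<bar>h y - h z\<bar> \<le> \<bar>g y - g z\<bar>" using yz s ramp_lipschitz[OF \<epsilon>] by (auto simp: h_def)
      moreover have "g y - g z = a \<bullet> (y - z) - (v y - v z)" by (simp add: g_def inner_diff_right)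
      ultimately show "dist (h y) (h z) \<le> (norm a + L) * dist y z"
        unfolding dist_norm real_norm_def distrib_right by linarith
    qed (use lipschitz_on_nonneg[OF L] in simp)
    then show ?thesis using s by blast
  next
    case False
    then obtain s where s: "s > 0" "cball x s \<subseteq> - K" using oK open_contains_cball by (metis ComplI)
    have "h y = 0" if "y \<in> cball x s" for y using h0 s(2) that by blast
    then have "0-lipschitz_on (cball x s) h" by (intro lipschitz_onI) auto
    then show ?thesis using s by blast
  qed
  have ch: "continuous_on UNIV h"
    unfolding continuous_on_eq_continuous_at[OF open_UNIV]
  proof
    fix x
    obtain r L where "r > 0" "L-lipschitz_on (cball x r) h" using lip by blast
    then show "isCont h x"
      using lipschitz_on_continuous_on continuous_on_interior by (metis centre_in_ball interior_cball)
  qed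
  obtain R where "\<forall>x\<in>closure \<Omega>. norm x \<le> R"
    using bounded_closure[OF \<Omega>(2)] unfolding bounded_iff by blast
  then have R: "closure \<Omega> \<subseteq> cball 0 R" by auto
  \<comment> \<open>Local Lipschitz bounds become uniform on a compact ball through the
    time-dependent notion, taken with a single instant as the set of times.\<close>
  have "local_lipschitz {0::real} (cball 0 (R + 1)) (\<lambda>_. h)"
    unfolding local_lipschitz_def
  proof (intro ballI)
    fix x :: "real^'n" and t :: real
    obtain r L where "r > 0" "L-lipschitz_on (cball x r) h" using lip by blast
    then show "\<exists>u>0. \<exists>L. \<forall>t\<in>cball t u \<inter> {0}. L-lipschitz_on (cball x u \<inter> cball 0 (R + 1)) h"
      using lipschitz_on_subset by blast
  qed
  then obtain L where L: "L-lipschitz_on (cball 0 (R + 1)) h"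
    using local_lipschitz_compact_implies_lipschitz[where X = "cball 0 (R + 1)" and T = "{0::real}" and f = "\<lambda>_. h"] by auto
  have nd: "negligible {x \<in> \<Omega>. \<not> v differentiable (at x)}"
    using locally_convex_negligible_nondifferentiable[OF lc] .
  have D: "(h has_derivative (\<lambda>k. k \<bullet> ((indicator \<Omega> x * ramp' \<epsilon> (g x)) *\<^sub>R (a - grad v x)))) (at x)"
    if dx: "x \<in> \<Omega> \<Longrightarrow> v differentiable (at x)" for x
  proof (cases "x \<in> \<Omega>")
    case True
    have "(g has_derivative (\<lambda>k. k \<bullet> (a - grad v x))) (at x)"
      unfolding g_def
      by (auto intro!: derivative_eq_intros has_derivative_grad dx[OF True] simp: inner_diff_right inner_commute)
    from has_derivative_compose[OF this, of "ramp \<epsilon>" "\<lambda>k. ramp' \<epsilon> (g x) * k"] DERIV_ramp[OF \<epsilon>]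
    have "((\<lambda>x. ramp \<epsilon> (g x)) has_derivative (\<lambda>k. ramp' \<epsilon> (g x) * (k \<bullet> (a - grad v x)))) (at x)"
      by (simp add: has_field_derivative_def)
    then have "(h has_derivative (\<lambda>k. ramp' \<epsilon> (g x) * (k \<bullet> (a - grad v x)))) (at x)"
      by (rule has_derivative_transform_within_open[OF _ \<Omega>(1) True]) (simp add: h_def)
    then show ?thesis using True by simp
  next
    case False
    then have "x \<in> - K" using K\<Omega> by blast
    have "(h has_derivative (\<lambda>k. 0)) (at x)"
      by (rule has_derivative_transform_within_open[OF has_derivative_const[of 0] oK \<open>x \<in> - K\<close>]) (simp add: h0)
    then show ?thesis using False by simp
  qed
  have "negligible {x. \<not> h differentiable (at x)}"
    by (rule negligible_subset[OF nd]) (use D in \<open>auto simp: differentiable_def\<close>)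
  moreover have "h x = 0" if "x \<notin> cball 0 R" for x
    using h0[of x] that R closure_subset[of \<Omega>] K\<Omega> by blast
  ultimately have "(\<integral>x. grad h x $ i \<partial>lebesgue) = 0" and
      m: "(\<lambda>x. grad h x $ i) \<in> borel_measurable lebesgue"
    using integral_grad_compact_support[OF ch L] grad_component_measurable[of UNIV h i] ch by auto
  moreover have ae: "AE x in lebesgue. grad h x $ i = ?I x"
    using AE_not_in_negligible[OF nd]
    by eventually_elim (use grad_eqI[OF D] in \<open>auto simp: g_def\<close>)
  moreover have "?I \<in> borel_measurable lebesgue"
    by (rule borel_measurable_lebesgue_AE_cong[OF m ae])
  ultimately show ?thesis using integral_cong_AE[OF m _ ae] by simp
qed

lemma spacelike_convex_grad_measurable:
  assumes "open \<Omega>" and v: "spacelike_convex \<Omega> v"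
  shows "(\<lambda>x. indicator \<Omega> x * (grad v x $ i)) \<in> borel_measurable lebesgue"
    and "(\<lambda>x. indicator \<Omega> x * v x) \<in> borel_measurable lebesgue"
proof -
  have c: "continuous_on \<Omega> v"
    using v by (auto simp: spacelike_convex_def intro: continuous_on_subset[OF _ closure_subset])
  show "(\<lambda>x. indicator \<Omega> x * (grad v x $ i)) \<in> borel_measurable lebesgue"
    using grad_component_measurable[OF assms(1) c] v locally_convex_negligible_nondifferentiable
    by (auto simp: spacelike_convex_def)
  have "(\<lambda>x. indicator \<Omega> x *\<^sub>R v x) \<in> borel_measurable borel"
    using borel_measurable_continuous_on_indicator[OF _ c] assms(1) by simp
  then show "(\<lambda>x. indicator \<Omega> x * v x) \<in> borel_measurable lebesgue"
    by (intro measurable_completion) simp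
qed

lemma spacelike_convex_AE:
  assumes v: "spacelike_convex \<Omega> v"
  shows "AE x in lebesgue. x \<in> \<Omega> \<longrightarrow> v differentiable (at x) \<and> norm (grad v x) \<le> 1"
proof -
  have "negligible {x \<in> \<Omega>. \<not> v differentiable (at x)}"
    using v locally_convex_negligible_nondifferentiable by (auto simp: spacelike_convex_def)
  from AE_not_in_negligible[OF this] show ?thesis
    by eventually_elim (use v in \<open>auto simp: spacelike_convex_def weakly_spacelike_def\<close>)
qed

section \<open>Cutting by affine functions\<close>

lemma open_less_on:
  fixes f g :: "'a::topological_space \<Rightarrow> real"
  assumes "open \<Omega>" "continuous_on \<Omega> f" "continuous_on \<Omega> g"
  shows "open {x \<in> \<Omega>. f x < g x}"
proof -
  have "{x \<in> \<Omega>. f x < g x} = \<Omega> \<inter> (\<lambda>x. g x - f x) -` {0<..}" by auto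
  then show ?thesis
    using continuous_open_preimage[OF continuous_on_diff[OF assms(3,2)] assms(1) open_greaterThan] by simp
qed

lemma convex_on_max:
  assumes "convex_on S f" "convex_on S g"
  shows "convex_on S (\<lambda>x. max (f x) (g x))"
proof (rule convex_onI)
  fix t x y assume t: "t > (0::real)" "t < 1" "x \<in> S" "y \<in> S"
  have "(1 - t) * f x + t * f y \<le> (1 - t) * max (f x) (g x) + t * max (f y) (g y)"
    "(1 - t) * g x + t * g y \<le> (1 - t) * max (f x) (g x) + t * max (f y) (g y)"
    using t by (auto intro!: add_mono mult_left_mono)
  with convex_onD[OF assms(1), of t x y] convex_onD[OF assms(2), of t x y] t
  show "max (f ((1 - t) *\<^sub>R x + t *\<^sub>R y)) (g ((1 - t) *\<^sub>R x + t *\<^sub>R y)) \<le> (1 - t) * max (f x) (g x) + t * max (f y) (g y)"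
    by simp
qed (use assms convex_on_imp_convex in blast)

lemma convex_on_affine:
  fixes a :: "'a::real_inner"
  shows "convex S \<Longrightarrow> convex_on S (\<lambda>x. a \<bullet> x + b)"
  by (rule convex_onI) (auto simp: inner_add_right algebra_simps)

text \<open>Where the plane is at least \<open>v\<close> it touches the maximum from below, which
  settles the contact set as well; where \<open>v\<close> is larger the maximum equals
  \<open>v\<close> nearby.\<close>

lemma grad_max_affine:
  fixes v :: "real^'n \<Rightarrow> real"
  assumes \<Omega>: "open \<Omega>" "x \<in> \<Omega>" and cv: "continuous_on \<Omega> v"
    and d: "(\<lambda>x. max (v x) (a \<bullet> x + b)) differentiable (at x)"
  shows "v x \<le> a \<bullet> x + b \<Longrightarrow> grad (\<lambda>x. max (v x) (a \<bullet> x + b)) x = a"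
    and "v x > a \<bullet> x + b \<Longrightarrow> v differentiable (at x) \<and> grad (\<lambda>x. max (v x) (a \<bullet> x + b)) x = grad v x"
proof -
  let ?m = "\<lambda>x. max (v x) (a \<bullet> x + b)"
  show "grad ?m x = a" if "v x \<le> a \<bullet> x + b"
  proof -
    have "a = grad ?m x"
      by (rule touching_grad(1)[of 1 x ?m a ?m, OF _ _ _ has_derivative_grad[OF d]])
        (use that in \<open>auto simp: inner_diff_right\<close>)
    then show ?thesis by simp
  qed
  show "v differentiable (at x) \<and> grad ?m x = grad v x" if "v x > a \<bullet> x + b"
  proof -
    have "open {y \<in> \<Omega>. a \<bullet> y + b < v y}"
      by (intro open_less_on \<Omega>(1) cv continuous_intros)
    then have "(v has_derivative (\<lambda>h. h \<bullet> grad ?m x)) (at x)"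
      by (rule has_derivative_transform_within_open[OF has_derivative_grad[OF d]])
        (use that \<Omega> in auto)
    then show ?thesis using grad_eqI[of v] by (auto simp: differentiable_def)
  qed
qed

lemma spacelike_convex_max_affine:
  fixes v :: "real^'n \<Rightarrow> real"
  assumes \<Omega>: "open \<Omega>" and v: "spacelike_convex \<Omega> v" and a: "norm a \<le> 1"
  shows "spacelike_convex \<Omega> (\<lambda>x. max (v x) (a \<bullet> x + b))"
  unfolding spacelike_convex_def
proof (intro conjI)
  let ?m = "\<lambda>x. max (v x) (a \<bullet> x + b)"
  have cv: "continuous_on (closure \<Omega>) v" and ws: "weakly_spacelike \<Omega> v" and lc: "locally_convex \<Omega> v"
    using v by (auto simp: spacelike_convex_def)
  have c: "continuous_on \<Omega> v" using cv closure_subset by (rule continuous_on_subset)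
  show "continuous_on (closure \<Omega>) ?m" by (intro continuous_intros cv)
  show "locally_convex \<Omega> ?m"
    using lc convex_on_affine[OF convex_ball] convex_on_max by (fastforce simp: locally_convex_def)
  show "weakly_spacelike \<Omega> ?m"
    unfolding weakly_spacelike_def
  proof (intro conjI ballI impI)
    fix x assume x: "x \<in> \<Omega>"
    then obtain r L where r: "r > 0" and L: "L-lipschitz_on (ball x r \<inter> \<Omega>) v"
      using ws by (auto simp: weakly_spacelike_def)
    have "(L + norm a)-lipschitz_on (ball x r \<inter> \<Omega>) ?m"
    proof (rule lipschitz_onI)
      fix y z assume "y \<in> ball x r \<inter> \<Omega>" "z \<in> ball x r \<inter> \<Omega>"
      then have "\<bar>v y - v z\<bar> \<le> L * norm (y - z)" using lipschitz_onD[OF L, of y z] by (auto simp: dist_norm)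
      moreover have "\<bar>a \<bullet> (y - z)\<bar> \<le> norm a * norm (y - z)" by (rule Cauchy_Schwarz_ineq2)
      moreover have "0 \<le> L * norm (y - z)" "0 \<le> norm a * norm (y - z)" using lipschitz_on_nonneg[OF L] by auto
      ultimately show "dist (?m y) (?m z) \<le> (L + norm a) * dist y z"
        unfolding dist_norm real_norm_def distrib_right inner_diff_right by (auto simp: max_def abs_le_iff)
    qed (use lipschitz_on_nonneg[OF L] in simp)
    then show "\<exists>r>0. \<exists>L. L-lipschitz_on (ball x r \<inter> \<Omega>) ?m" using r by blast
    assume d: "?m differentiable (at x)"
    show "norm (grad ?m x) \<le> 1"
      using grad_max_affine[OF \<Omega> x c d] a ws x by (cases "v x \<le> a \<bullet> x + b") (auto simp: weakly_spacelike_def)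
  qed
qed

text \<open>The flux identity is available only for smoothed weights. The concavity inequality is
  therefore integrated against \<open>W k\<close>, and the limit in \<open>k\<close> gives the gain
  over the set where \<open>v\<close> lies strictly below the plane.\<close>

lemma area_max_affine:
  fixes v :: "real^'n \<Rightarrow> real"
  assumes \<Omega>: "open \<Omega>" "bounded \<Omega>" and v: "spacelike_convex \<Omega> v" and a: "norm a < 1"
    and fr: "\<And>x. x \<in> frontier \<Omega> \<Longrightarrow> v x \<ge> a \<bullet> x + b"
  shows "spacelike_area \<Omega> v \<le> spacelike_area \<Omega> (\<lambda>x. max (v x) (a \<bullet> x + b))"
proof -
  let ?m = "\<lambda>x. max (v x) (a \<bullet> x + b)"
  define \<sigma> :: "real^'n \<Rightarrow> real" where "\<sigma> q = sqrt (1 - (norm q)\<^sup>2)" for q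
  define e where "e k = 1 / real (Suc k)" for k
  have e: "e k > 0" for k by (simp add: e_def)
  define W where "W k x = indicator \<Omega> x * ramp' (e k) (a \<bullet> x + b - v x - e k)" for k x
  let ?D = "\<lambda>x. \<sigma> a - \<sigma> (grad v x)"
  have \<sigma>01: "0 \<le> \<sigma> q" "\<sigma> q \<le> 1" if "norm q \<le> 1" for q
    using that by (auto simp: \<sigma>_def abs_square_le_1)
  have \<sigma>a: "\<sigma> a > 0" using a by (simp add: \<sigma>_def abs_square_less_1)
  have W01: "0 \<le> W k x" "W k x \<le> indicator \<Omega> x" for k x
    using ramp'_bounds[OF e] by (auto simp: W_def indicator_def)
  note gm [measurable] = spacelike_convex_grad_measurable[OF \<Omega>(1) v]
  note ind = integrable_lebesgue_indicator[of \<Omega>, OF \<Omega>(2)]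
  have [measurable]: "\<Omega> \<in> sets lebesgue" "\<Omega> \<in> sets borel" using \<Omega> by auto
  have am [measurable]: "(\<lambda>x. a \<bullet> x) \<in> borel_measurable lebesgue"
    by (rule measurable_completion) simp
  have \<sigma>m: "(\<lambda>x. indicator \<Omega> x * \<sigma> (grad v x)) \<in> borel_measurable lebesgue"
    using borel_measurable_integrable[OF spacelike_convex_integrable[OF \<Omega> v]] by (simp add: \<sigma>_def)
  have Wm: "W k \<in> borel_measurable lebesgue" for k
  proof -
    have "(\<lambda>x. indicator \<Omega> x * ramp' (e k) (a \<bullet> x + b - indicator \<Omega> x * v x - e k)) \<in> borel_measurable lebesgue"
      by measurable
    moreover have "(\<lambda>x. indicator \<Omega> x * ramp' (e k) (a \<bullet> x + b - indicator \<Omega> x * v x - e k)) = W k"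
      by (auto simp: W_def indicator_def)
    ultimately show ?thesis by simp
  qed
  have bnd: "integrable lebesgue f"
    if "f \<in> borel_measurable lebesgue" "AE x in lebesgue. \<bar>f x\<bar> \<le> 2 * indicator \<Omega> x" for f :: "real^'n \<Rightarrow> real"
    by (rule Bochner_Integration.integrable_bound[of _ "\<lambda>x. 2 * indicator \<Omega> x :: real"])
      (use that ind in auto)
  have WDm: "(\<lambda>x. W k x * ?D x) \<in> borel_measurable lebesgue" for k
  proof -
    have "(\<lambda>x. W k x * (\<sigma> a - indicator \<Omega> x * \<sigma> (grad v x))) \<in> borel_measurable lebesgue"
      using Wm \<sigma>m by measurable
    moreover have "(\<lambda>x. W k x * (\<sigma> a - indicator \<Omega> x * \<sigma> (grad v x))) = (\<lambda>x. W k x * ?D x)"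
      by (auto simp: W_def indicator_def)
    ultimately show ?thesis by simp
  qed
  have D1: "\<bar>?D x\<bar> \<le> 1" if "norm (grad v x) \<le> 1" for x
    using \<sigma>01[OF that] \<sigma>01[of a] a by (simp add: abs_le_iff)
  have WDb: "AE x in lebesgue. \<bar>W k x * ?D x\<bar> \<le> 2 * indicator \<Omega> x" for k
    using spacelike_convex_AE[OF v]
  proof eventually_elim
    case (elim x)
    show ?case
    proof (cases "x \<in> \<Omega>")
      case True
      have "\<bar>W k x * ?D x\<bar> \<le> 1 * 1"
        unfolding abs_mult by (rule mult_mono) (use True elim D1[of x] W01[of k x] in auto)
      then show ?thesis using True by simp
    qed (simp add: W_def)
  qed
  have pos: "0 \<le> (\<integral>x. W k x * ?D x \<partial>lebesgue)" for k
  proof -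
    define F where "F i x = W k x * (a - grad v x) $ i" for i x
    have F0: "(\<integral>x. F i x \<partial>lebesgue) = 0" for i
      using spacelike_convex_flux[OF \<Omega> v fr e, of k i] by (simp add: F_def W_def)
    have Fi: "integrable lebesgue (F i)" for i
    proof (rule bnd)
      have "(\<lambda>x. W k x * (a $ i - indicator \<Omega> x * grad v x $ i)) \<in> borel_measurable lebesgue"
        using Wm by measurable
      moreover have "(\<lambda>x. W k x * (a $ i - indicator \<Omega> x * grad v x $ i)) = F i"
        by (auto simp: W_def F_def indicator_def)
      ultimately show "F i \<in> borel_measurable lebesgue" by simp
      show "AE x in lebesgue. \<bar>F i x\<bar> \<le> 2 * indicator \<Omega> x"
        using spacelike_convex_AE[OF v]
      proof eventually_elim
        case (elim x)
        show ?case
        proof (cases "x \<in> \<Omega>")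
          case True
          have "\<bar>(a - grad v x) $ i\<bar> \<le> norm (a - grad v x)" by (rule component_le_norm_cart)
          also have "\<dots> \<le> 2" using norm_triangle_ineq4[of a "grad v x"] elim True a by simp
          finally have "\<bar>F i x\<bar> \<le> 1 * 2"
            unfolding F_def abs_mult by (intro mult_mono) (use True W01[of k x] in auto)
          then show ?thesis using True by simp
        qed (simp add: F_def W_def)
      qed
    qed
    \<comment> \<open>The zero is the flux paired with the constant vector \<open>a\<close> and
      divided by \<open>\<sigma> a\<close>; concavity makes its integrand a lower bound for the
      weighted difference of the area densities.\<close>
    have "0 = (\<integral>x. - (\<Sum>i\<in>UNIV. a $ i * F i x) / \<sigma> a \<partial>lebesgue)"
      using Fi F0 by simp
    also have "\<dots> \<le> (\<integral>x. W k x * ?D x \<partial>lebesgue)"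
    proof (rule integral_mono_AE)
      show "integrable lebesgue (\<lambda>x. - (\<Sum>i\<in>UNIV. a $ i * F i x) / \<sigma> a)"
        by (intro integrable_divide integrable_minus Bochner_Integration.integrable_sum integrable_mult_right Fi)
      show "integrable lebesgue (\<lambda>x. W k x * ?D x)" by (rule bnd[OF WDm WDb])
      show "AE x in lebesgue. - (\<Sum>i\<in>UNIV. a $ i * F i x) / \<sigma> a \<le> W k x * ?D x"
        using spacelike_convex_AE[OF v]
      proof eventually_elim
        case (elim x)
        have s: "(\<Sum>i\<in>UNIV. a $ i * F i x) = W k x * (a \<bullet> (a - grad v x))"
          by (simp add: F_def inner_vec_def sum_distrib_left mult_ac)
        show ?case
        proof (cases "x \<in> \<Omega>")
          case True
          have "- (a \<bullet> (a - grad v x)) / \<sigma> a \<le> ?D x"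
            using lorentz_concavity[OF a, of "grad v x"] elim True by (simp add: \<sigma>_def)
          from mult_left_mono[OF this W01(1)[of k x]] show ?thesis unfolding s by simp
        qed (simp add: s W_def)
      qed
    qed
    finally show ?thesis .
  qed
  define J where "J x = indicator \<Omega> x * (if a \<bullet> x + b - v x > 0 then 1 else 0) * ?D x" for x
  have Wlim: "(\<lambda>k. W k x * ?D x) \<longlonglongrightarrow> J x" for x
    unfolding W_def J_def e_def by (intro tendsto_intros ramp'_tendsto_indicator)
  have Jm: "J \<in> borel_measurable lebesgue"
    by (rule borel_measurable_lebesgue_AE_limit[OF WDm AE_I2[OF Wlim]])
  have "(\<lambda>k. \<integral>x. W k x * ?D x \<partial>lebesgue) \<longlonglongrightarrow> (\<integral>x. J x \<partial>lebesgue)"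
    by (rule integral_dominated_convergence[where w = "\<lambda>x. 2 * indicator \<Omega> x"])
      (use Jm WDm WDb Wlim ind in auto)
  then have J0: "0 \<le> (\<integral>x. J x \<partial>lebesgue)" by (rule LIMSEQ_le_const) (use pos in auto)
  have Ji: "integrable lebesgue J"
  proof (rule bnd[OF Jm])
    show "AE x in lebesgue. \<bar>J x\<bar> \<le> 2 * indicator \<Omega> x"
      using spacelike_convex_AE[OF v] by eventually_elim (use D1 in \<open>fastforce simp: J_def indicator_def\<close>)
  qed
  have vi: "integrable lebesgue (\<lambda>x. indicator \<Omega> x * \<sigma> (grad v x))"
    using spacelike_convex_integrable[OF \<Omega> v] by (simp add: \<sigma>_def)
  have m: "spacelike_convex \<Omega> ?m" using spacelike_convex_max_affine[OF \<Omega>(1) v] a by simp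
  have mi: "integrable lebesgue (\<lambda>x. indicator \<Omega> x * \<sigma> (grad ?m x))"
    using spacelike_convex_integrable[OF \<Omega> m] by (simp add: \<sigma>_def)
  have cv: "continuous_on \<Omega> v"
    using v by (auto simp: spacelike_convex_def intro: continuous_on_subset[OF _ closure_subset])
  \<comment> \<open>On the contact set a supporting plane of \<open>v\<close> also supports the
    maximum, so the gradients agree there and the area density does not change.\<close>
  have eqv: "grad v x = grad ?m x"
    if x: "x \<in> \<Omega>" and d: "v differentiable (at x)" "?m differentiable (at x)" and ge: "v x \<ge> a \<bullet> x + b" for x
  proof -
    obtain r where r: "r > 0" "convex_on (ball x r) v"
      using v x by (auto simp: spacelike_convex_def locally_convex_def)
    show ?thesis
    proof (rule touching_grad(1)[OF r(1) _ _ has_derivative_grad[OF d(2)]])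
      show "?m y \<ge> ?m x + grad v x \<bullet> (y - x)" if "y \<in> ball x r" for y
        using convex_grad_support[OF r d(1) that] ge by simp
    qed simp
  qed
  have "AE x in lebesgue. indicator \<Omega> x * \<sigma> (grad v x) + J x = indicator \<Omega> x * \<sigma> (grad ?m x)"
    using spacelike_convex_AE[OF m] spacelike_convex_AE[OF v]
  proof eventually_elim
    case (elim x)
    show ?case
    proof (cases "x \<in> \<Omega>")
      case True
      then have d: "?m differentiable (at x)" using elim by simp
      show ?thesis
        using grad_max_affine(1)[OF \<Omega>(1) True cv d] eqv[OF True _ d] elim True
        by (cases "v x < a \<bullet> x + b") (auto simp: J_def \<sigma>_def)
    qed (simp add: J_def)
  qed
  then have "(\<integral>x. indicator \<Omega> x * \<sigma> (grad v x) + J x \<partial>lebesgue) = (\<integral>x. indicator \<Omega> x * \<sigma> (grad ?m x) \<partial>lebesgue)"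
    using vi Ji mi by (intro integral_cong_AE) auto
  then show ?thesis
    using J0 vi Ji by (simp add: spacelike_area_def set_lebesgue_integral_def \<sigma>_def)
qed

lemma lipschitz_on_UNIV_1I:
  fixes f :: "'a::real_normed_vector \<Rightarrow> real"
  assumes "\<And>x y. f x - f y \<le> norm (x - y)" shows "1-lipschitz_on UNIV f"
proof (rule lipschitz_onI)
  show "dist (f x) (f y) \<le> 1 * dist x y" for x y
    using assms[of x y] assms[of y x] by (simp add: dist_norm abs_le_iff norm_minus_commute)
qed simp

text \<open>All stages of the cutting are convex on a common ball around a given point, so pointwise
  convergence forces convergence of the gradients, and the areas converge by dominated
  convergence.\<close>

lemma area_comparison:
  fixes u v :: "real^'n \<Rightarrow> real"
  assumes \<Omega>: "open \<Omega>" "bounded \<Omega>" and u: "convex_on UNIV u" "\<And>x y. u x - u y \<le> norm (x - y)"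
    and v: "spacelike_convex \<Omega> v" and le: "\<And>x. x \<in> \<Omega> \<Longrightarrow> v x \<le> u x"
    and fr: "\<And>x. x \<in> frontier \<Omega> \<Longrightarrow> v x = u x"
  shows "spacelike_area \<Omega> v \<le> spacelike_area \<Omega> u"
proof -
  have ulip: "1-lipschitz_on UNIV u"
    by (rule lipschitz_on_UNIV_1I[OF u(2)])
  have cu: "continuous_on A u" for A
    using lipschitz_on_continuous_on[OF ulip] continuous_on_subset by blast
  have us: "spacelike_convex \<Omega> u"
    unfolding spacelike_convex_def weakly_spacelike_def locally_convex_def
  proof (intro conjI ballI impI cu)
    fix x assume x: "x \<in> \<Omega>"
    show "\<exists>r>0. \<exists>L. L-lipschitz_on (ball x r \<inter> \<Omega>) u"
      using lipschitz_on_subset[OF ulip] by (intro exI[of _ 1] exI[of _ 1] conjI) auto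
    show "u differentiable at x \<Longrightarrow> norm (grad u x) \<le> 1"
      using norm_grad_le_of_lipschitz[of 1 1 x u] lipschitz_on_subset[OF ulip] by simp
    obtain r where "r > 0" "ball x r \<subseteq> \<Omega>" using \<Omega> x open_contains_ball by blast
    then show "\<exists>r>0. ball x r \<subseteq> \<Omega> \<and> convex_on (ball x r) u" using u(1) convex_on_subset by blast
  qed
  have "compact (closure \<Omega>)" using \<Omega> by (simp add: compact_closure)
  then have "bounded (u ` closure \<Omega>)" using cu by (intro compact_imp_bounded compact_continuous_image)
  then obtain M where "\<And>x. x \<in> closure \<Omega> \<Longrightarrow> \<bar>u x\<bar> \<le> M" unfolding bounded_iff by (metis imageI real_norm_def)
  then have M: "- M \<le> u x" if "x \<in> closure \<Omega>" for x using that by (simp add: abs_le_iff minus_le_iff)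
  obtain D :: "(real^'n) set" where D: "countable D" "\<And>X. open X \<Longrightarrow> X \<noteq> {} \<Longrightarrow> \<exists>d\<in>D. d \<in> X"
    using countable_dense_setE by blast
  have "D \<noteq> {}" using D(2)[of UNIV] by auto
  define d where "d = from_nat_into D"
  have rd: "range d = D" using D(1) \<open>D \<noteq> {}\<close> by (simp add: d_def range_from_nat_into)
  have "\<exists>p. \<forall>y. u y \<ge> u x + p \<bullet> (y - x)" for x using convex_on_UNIV_subgradient[OF u(1)] by metis
  then obtain p where p: "\<And>x y. u y \<ge> u x + p x \<bullet> (y - x)" by metis
  have np: "norm (p x) \<le> 1" for x
  proof -
    have "norm (p x) * norm (p x) \<le> 1 * norm (p x)"
      using p[of x "x + p x"] u(2)[of "x + p x" x] by (simp add: power2_norm_eq_inner[symmetric] power2_eq_square)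
    then show ?thesis by (cases "p x = 0") auto
  qed
  \<comment> \<open>Mixing a supporting plane with the constant \<open>-M\<close> brings its slope
    strictly inside the unit ball, as \<open>area_max_affine\<close> requires; since
    \<open>-M\<close> is a lower bound of \<open>u\<close>, the mixture stays below \<open>u\<close>
    on the closure.\<close>
  define \<theta> where "\<theta> k = 1 / (real k + 1)" for k
  have \<theta>: "0 < \<theta> k" "\<theta> k \<le> 1" for k by (auto simp: \<theta>_def)
  \<comment> \<open>One index codes a base point together with a mixing parameter, so that a single
    sequence of cuts runs through all pairs.\<close>
  define A where "A n = (case prod_decode n of (j, k) \<Rightarrow> (1 - \<theta> k) *\<^sub>R p (d j))" for n
  define B where "B n = (case prod_decode n of (j, k) \<Rightarrow> (1 - \<theta> k) * (u (d j) - p (d j) \<bullet> d j) + \<theta> k * (- M))" for n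
  have AB: "A n \<bullet> x + B n = (1 - \<theta> k) * (u (d j) + p (d j) \<bullet> (x - d j)) + \<theta> k * (- M)"
    if "prod_decode n = (j, k)" for n j k x
    by (simp add: A_def B_def that inner_diff_right algebra_simps)
  have nA: "norm (A n) < 1" for n
  proof -
    obtain j k where jk: "prod_decode n = (j, k)" by fastforce
    have "norm (A n) = (1 - \<theta> k) * norm (p (d j))" using \<theta>[of k] by (simp add: A_def jk)
    also have "\<dots> \<le> (1 - \<theta> k) * 1" using \<theta>[of k] np by (intro mult_left_mono) auto
    finally show ?thesis using \<theta>[of k] by simp
  qed
  have ABu: "A n \<bullet> x + B n \<le> u x" if "x \<in> closure \<Omega>" for n x
  proof -
    obtain j k where jk: "prod_decode n = (j, k)" by fastforce
    have "A n \<bullet> x + B n \<le> (1 - \<theta> k) * u x + \<theta> k * u x"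
      unfolding AB[OF jk] using \<theta>[of k] p M[OF that] by (intro add_mono mult_left_mono) auto
    then show ?thesis by (simp add: algebra_simps)
  qed
  define V where "V n = rec_nat v (\<lambda>n w x. max (w x) (A n \<bullet> x + B n)) n" for n
  have V: "V 0 = v" "V (Suc n) = (\<lambda>x. max (V n x) (A n \<bullet> x + B n))" for n by (auto simp: V_def)
  have Vs: "spacelike_convex \<Omega> (V n)" for n
  proof (induction n)
    case (Suc n)
    then show ?case unfolding V(2) using nA[of n] by (intro spacelike_convex_max_affine \<Omega>(1)) auto
  qed (simp add: V v)
  have Vge: "v x \<le> V n x" for n x by (induction n) (auto simp: V max.coboundedI1)
  have Vle: "V n x \<le> u x" if "x \<in> \<Omega>" for n x
    by (induction n) (use that le ABu closure_subset[of \<Omega>] in \<open>auto simp: V\<close>)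
  \<comment> \<open>Cut \<open>n\<close> is made in passing from stage \<open>n\<close> to stage
    \<open>n + 1\<close>, hence the strict inequality.\<close>
  have VAB: "A n \<bullet> x + B n \<le> V m x" if "n < m" for n m x
    using that by (induction m) (auto simp: V less_Suc_eq max.coboundedI1)
  have area: "spacelike_area \<Omega> v \<le> spacelike_area \<Omega> (V n)" for n
  proof (induction n)
    case (Suc n)
    have "spacelike_area \<Omega> (V n) \<le> spacelike_area \<Omega> (V (Suc n))"
      unfolding V(2)
    proof (rule area_max_affine[OF \<Omega> Vs nA])
      fix x assume x: "x \<in> frontier \<Omega>"
      then have "A n \<bullet> x + B n \<le> u x" using ABu by (simp add: frontier_def)
      then show "A n \<bullet> x + B n \<le> V n x" using fr[OF x] Vge[of x n] by linarith
    qed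
    with Suc show ?case by simp
  qed (simp add: V)
  have lim: "(\<lambda>n. V n x) \<longlonglongrightarrow> u x" if x: "x \<in> \<Omega>" for x
  proof (rule LIMSEQ_I)
    fix \<eta> :: real assume \<eta>: "\<eta> > 0"
    obtain dd where dd: "dd \<in> D" "dist x dd < \<eta> / 4"
      using D(2)[of "ball x (\<eta> / 4)"] \<eta> by auto
    then obtain j where j: "d j = dd" using rd by (metis rangeE)
    have "\<theta> \<longlonglongrightarrow> 0" unfolding \<theta>_def using LIMSEQ_inverse_real_of_nat by (simp add: inverse_eq_divide add.commute)
    then have "(\<lambda>k. \<theta> k * (u x + M)) \<longlonglongrightarrow> 0" by (rule tendsto_mult_left_zero)
    then have "\<forall>\<^sub>F k in sequentially. \<theta> k * (u x + M) < \<eta> / 2" using \<eta> by (intro order_tendstoD) auto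
    then obtain k where k: "\<theta> k * (u x + M) < \<eta> / 2" using eventually_happens by fastforce
    define N where "N = prod_encode (j, k)"
    have jk: "prod_decode N = (j, k)" by (simp add: N_def)
    \<comment> \<open>Both \<open>u\<close> and its supporting plane at \<open>d j\<close> are
      1-Lipschitz, so the plane loses at most twice the distance to \<open>d j\<close>.\<close>
    have "u (d j) + p (d j) \<bullet> (x - d j) \<ge> u x - 2 * norm (x - d j)"
    proof -
      have "\<bar>p (d j) \<bullet> (x - d j)\<bar> \<le> norm (p (d j)) * norm (x - d j)" by (rule Cauchy_Schwarz_ineq2)
      also have "\<dots> \<le> 1 * norm (x - d j)" using np by (intro mult_right_mono) auto
      finally show ?thesis using u(2)[of x "d j"] by (simp add: abs_le_iff)
    qed
    then have "(1 - \<theta> k) * (u x - 2 * norm (x - d j)) + \<theta> k * (- M) \<le> A N \<bullet> x + B N"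
      unfolding AB[OF jk] using \<theta>[of k] by (intro add_mono mult_left_mono) auto
    moreover have "(1 - \<theta> k) * (2 * norm (x - d j)) \<le> 1 * (2 * norm (x - d j))"
      using \<theta>[of k] by (intro mult_right_mono) auto
    moreover have "norm (x - d j) < \<eta> / 4" using dd j by (simp add: dist_norm)
    ultimately have "A N \<bullet> x + B N > u x - \<eta>" using k by (simp add: algebra_simps)
    then show "\<exists>no. \<forall>n\<ge>no. norm (V n x - u x) < \<eta>"
      using VAB[of N] Vle[OF x] by (intro exI[of _ "Suc N"] allI impI) (smt (verit) Suc_le_lessD real_norm_def)
  qed
  have grad_lim: "(\<lambda>n. grad (V n) x) \<longlonglongrightarrow> grad u x"
    if x: "x \<in> \<Omega>" and du: "u differentiable (at x)" and dV: "\<And>n. V n differentiable (at x)" for x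
  proof -
    obtain r where r: "r > 0" "ball x r \<subseteq> \<Omega>" "convex_on (ball x r) v"
      using v x by (auto simp: spacelike_convex_def locally_convex_def)
    have "convex_on (ball x r) (V n)" for n
      by (induction n) (use r in \<open>auto simp: V intro!: convex_on_max convex_on_affine\<close>)
    then show ?thesis
      by (rule convex_grad_tendsto[OF r(1) _ dV du]) (use lim r in auto)
  qed
  let ?S = "\<lambda>w x. indicator \<Omega> x * area_density w x"
  have "(\<lambda>n. \<integral>x. ?S (V n) x \<partial>lebesgue) \<longlonglongrightarrow> (\<integral>x. ?S u x \<partial>lebesgue)"
  proof (rule integral_dominated_convergence[where w = "indicator \<Omega>"])
    show "?S u \<in> borel_measurable lebesgue" "\<And>n. ?S (V n) \<in> borel_measurable lebesgue"
      using spacelike_convex_integrable[OF \<Omega> us] spacelike_convex_integrable[OF \<Omega> Vs] by auto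
    show "integrable lebesgue (indicator \<Omega> :: real^'n \<Rightarrow> real)"
      by (rule integrable_lebesgue_indicator) (use \<Omega> in auto)
    have aeV: "AE x in lebesgue. \<forall>n. x \<in> \<Omega> \<longrightarrow> V n differentiable (at x) \<and> norm (grad (V n) x) \<le> 1"
      unfolding AE_all_countable using spacelike_convex_AE[OF Vs] by blast
    show "AE x in lebesgue. (\<lambda>n. ?S (V n) x) \<longlonglongrightarrow> ?S u x"
      using aeV spacelike_convex_AE[OF us]
    proof eventually_elim
      case (elim x)
      show ?case
      proof (cases "x \<in> \<Omega>")
        case True
        then show ?thesis using elim by (intro tendsto_intros grad_lim) auto
      qed simp
    qed
    show "AE x in lebesgue. norm (?S (V n) x) \<le> indicator \<Omega> x" for n
      using spacelike_convex_AE[OF Vs[of n]]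
      by eventually_elim (auto simp: indicator_def abs_square_le_1)
  qed
  then have "(\<lambda>n. spacelike_area \<Omega> (V n)) \<longlonglongrightarrow> spacelike_area \<Omega> u"
    by (simp add: spacelike_area_def set_lebesgue_integral_def)
  then show ?thesis by (rule LIMSEQ_le_const) (use area in auto)
qed

section \<open>Viscosity subsolutions\<close>

abbreviation curvature_bound :: "(real^'n \<Rightarrow> real) \<Rightarrow> real^'n \<Rightarrow> real" where
  "curvature_bound \<phi> x \<equiv> (1 - (norm (grad \<phi> x))\<^sup>2) powr ((real CARD('n) + 2) / 2)"

text \<open>Touching may be tested on arbitrarily small balls, so the condition at a point carries
  no domain. This allows functions given on different sets to be glued.\<close>

definition subsolution_at :: "(real^'n \<Rightarrow> real) \<Rightarrow> real^'n \<Rightarrow> bool" where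
  "subsolution_at w x \<longleftrightarrow> (\<forall>\<phi> r. r > 0 \<and> C2_on (ball x r) \<phi> \<and> (\<forall>y\<in>ball x r. w y - \<phi> y \<le> w x - \<phi> x) \<longrightarrow>
     curvature_bound \<phi> x \<le> det (hessian \<phi> x))"

lemma subsolution_atD:
  fixes w :: "real^'n \<Rightarrow> real"
  assumes "subsolution_at w x" "r > 0" "C2_on (ball x r) \<phi>" "\<And>y. y \<in> ball x r \<Longrightarrow> w y - \<phi> y \<le> w x - \<phi> x"
  shows "curvature_bound \<phi> x \<le> det (hessian \<phi> x)"
proof -
  have "r > 0 \<and> C2_on (ball x r) \<phi> \<and> (\<forall>y\<in>ball x r. w y - \<phi> y \<le> w x - \<phi> x)" using assms(2-4) by simp
  with assms(1)[unfolded subsolution_at_def, THEN spec[of _ \<phi>], THEN spec[of _ r]] show ?thesis by (rule mp)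
qed

lemma viscosity_subsolution_iff:
  fixes w :: "real^'n \<Rightarrow> real"
  assumes "open \<Omega>"
  shows "viscosity_subsolution (\<lambda>x t. 1) \<Omega> w \<longleftrightarrow> (\<forall>x\<in>\<Omega>. subsolution_at w x)"
proof
  assume L: "viscosity_subsolution (\<lambda>x t. 1) \<Omega> w"
  show "\<forall>x\<in>\<Omega>. subsolution_at w x"
    unfolding subsolution_at_def
  proof (intro ballI allI impI)
    fix x \<phi> r assume x: "x \<in> \<Omega>" and a: "r > 0 \<and> C2_on (ball x r) \<phi> \<and> (\<forall>y\<in>ball x r. w y - \<phi> y \<le> w x - \<phi> x)"
    obtain s where s: "s > 0" "ball x s \<subseteq> \<Omega>" using assms x open_contains_ball by blast
    have sub: "ball x (min r s) \<subseteq> ball x r" "ball x (min r s) \<subseteq> \<Omega>" using s by auto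
    have "min r s > 0 \<and> ball x (min r s) \<subseteq> \<Omega> \<and> C2_on (ball x (min r s)) \<phi> \<and> (\<forall>y\<in>ball x (min r s). w y - \<phi> y \<le> w x - \<phi> x)"
      using a s sub C2_on_subset[OF _ sub(1)] by auto
    with L[unfolded viscosity_subsolution_def, THEN bspec, OF x, THEN spec[of _ \<phi>], THEN spec[of _ "min r s"]]
    show "curvature_bound \<phi> x \<le> det (hessian \<phi> x)"
      using s a by simp
  qed
next
  assume "\<forall>x\<in>\<Omega>. subsolution_at w x"
  then show "viscosity_subsolution (\<lambda>x t. 1) \<Omega> w"
    unfolding viscosity_subsolution_def
  proof (intro ballI allI impI)
    fix x \<phi> and r :: real
    assume "\<forall>x\<in>\<Omega>. subsolution_at w x" "x \<in> \<Omega>" and r: "r > 0"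
      and a: "ball x r \<subseteq> \<Omega> \<and> C2_on (ball x r) \<phi> \<and> (\<forall>y\<in>ball x r. w y - \<phi> y \<le> w x - \<phi> x)"
    then have "subsolution_at w x" by blast
    from subsolution_atD[OF this r, of \<phi>] a
    show "1 * curvature_bound \<phi> x \<le> det (hessian \<phi> x)" by simp
  qed
qed

text \<open>A test function touching \<open>w\<close> from above at \<open>x\<close> also touches
  the smaller \<open>u\<close> there. This is how maxima inherit the property.\<close>

lemma subsolution_at_le:
  fixes u w :: "real^'n \<Rightarrow> real"
  assumes u: "subsolution_at u x" and r: "r > 0" and le: "\<And>y. y \<in> ball x r \<Longrightarrow> u y \<le> w y" and eq: "u x = w x"
  shows "subsolution_at w x"
  unfolding subsolution_at_def
proof (intro allI impI)
  fix \<phi> s assume a: "s > 0 \<and> C2_on (ball x s) \<phi> \<and> (\<forall>y\<in>ball x s. w y - \<phi> y \<le> w x - \<phi> x)"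
  show "curvature_bound \<phi> x \<le> det (hessian \<phi> x)"
  proof (rule subsolution_atD[OF u])
    show "min r s > 0" using r a by simp
    show "C2_on (ball x (min r s)) \<phi>" by (rule C2_on_subset[of "ball x s"]) (use a in auto)
    show "u y - \<phi> y \<le> u x - \<phi> x" if "y \<in> ball x (min r s)" for y
    proof -
      have "u y \<le> w y" "w y - \<phi> y \<le> w x - \<phi> x" using le[of y] a that by auto
      then show ?thesis using eq by linarith
    qed
  qed
qed

section \<open>Quadratic perturbations and stability under suprema\<close>

lemma matrix_add_scaled_mat_mult:
  fixes A :: "real^'n^'n"
  shows "(A + c *\<^sub>R mat 1) *v h = A *v h + c *\<^sub>R h"
proof -
  have "(c *\<^sub>R mat 1) *v h = c *\<^sub>R (mat 1 *v h)" for h :: "real^'n"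
    by (rule scaleR_matrix_vector_assoc[symmetric])
  then show ?thesis by (simp add: matrix_vector_mult_add_rdistrib)
qed

lemma
  fixes \<phi> :: "real^'n \<Rightarrow> real"
  assumes U: "open U" and C2: "C2_on U \<phi>"
  shows C2_on_add_square: "C2_on U (\<lambda>y. \<phi> y + c * (norm (y - z))\<^sup>2)"
    and grad_add_square: "x \<in> U \<Longrightarrow> grad (\<lambda>y. \<phi> y + c * (norm (y - z))\<^sup>2) x = grad \<phi> x + (2 * c) *\<^sub>R (x - z)"
    and hessian_add_square: "x \<in> U \<Longrightarrow> hessian (\<lambda>y. \<phi> y + c * (norm (y - z))\<^sup>2) x = hessian \<phi> x + (2 * c) *\<^sub>R mat 1"
proof -
  have 1: "((\<lambda>y. \<phi> y + c * (norm (y - z))\<^sup>2) has_derivative (\<lambda>h. h \<bullet> (grad \<phi> x + (2 * c) *\<^sub>R (x - z)))) (at x)"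
    if "x \<in> U" for x
    unfolding power2_norm_eq_inner
    by (auto intro!: derivative_eq_intros C2_on_has_derivative(1)[OF C2 that]
        simp: inner_add_right inner_diff_right inner_diff_left inner_commute algebra_simps)
  have 2: "((\<lambda>y. grad \<phi> y + (2 * c) *\<^sub>R (y - z)) has_derivative (\<lambda>h. (hessian \<phi> x + (2 * c) *\<^sub>R mat 1) *v h)) (at x)"
    if "x \<in> U" for x
    unfolding matrix_add_scaled_mat_mult
    by (auto intro!: derivative_eq_intros C2_on_has_derivative(2)[OF C2 that])
  have 3: "continuous_on U (\<lambda>x. hessian \<phi> x + (2 * c) *\<^sub>R mat 1)"
    using C2 by (intro continuous_intros) (auto simp: C2_on_def)
  show "C2_on U (\<lambda>y. \<phi> y + c * (norm (y - z))\<^sup>2)"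
    "x \<in> U \<Longrightarrow> grad (\<lambda>y. \<phi> y + c * (norm (y - z))\<^sup>2) x = grad \<phi> x + (2 * c) *\<^sub>R (x - z)"
    "x \<in> U \<Longrightarrow> hessian (\<lambda>y. \<phi> y + c * (norm (y - z))\<^sup>2) x = hessian \<phi> x + (2 * c) *\<^sub>R mat 1"
    using C2_onI[OF U 1 2 3] grad_of_C2[OF U 1 2 3] hessian_of_C2[OF U 1 2 3] by blast+
qed

lemma tendsto_det:
  fixes A :: "'b \<Rightarrow> real^'n^'n"
  assumes "(A \<longlongrightarrow> L) F" shows "((\<lambda>k. det (A k)) \<longlongrightarrow> det L) F"
proof -
  have "((\<lambda>k. A k $ i $ j) \<longlongrightarrow> L $ i $ j) F" for i j
    using tendsto_vec_nth[OF tendsto_vec_nth[OF assms]] .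
  then show ?thesis unfolding det_def
    by (intro tendsto_sum tendsto_mult_left tendsto_prod) auto
qed

text \<open>A quadratic penalty makes the maximum at \<open>x\<close> strict. A member of
  \<open>S\<close> that nearly attains the supremum at \<open>x\<close> is then touched at a nearby
  interior point, and the inequality there passes to the limit.\<close>

lemma Sup_subsolution_at:
  fixes u :: "real^'n \<Rightarrow> real"
  assumes ne: "S \<noteq> {}" and S: "\<And>w x. w \<in> S \<Longrightarrow> subsolution_at w x" "\<And>w. w \<in> S \<Longrightarrow> continuous_on UNIV w"
    and le: "\<And>w x. w \<in> S \<Longrightarrow> w x \<le> u x" and approx: "\<And>x e. e > 0 \<Longrightarrow> \<exists>w\<in>S. w x > u x - e"
    and u: "convex_on UNIV u"
  shows "subsolution_at u x"
  unfolding subsolution_at_def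
proof (intro allI impI, elim conjE)
  fix \<phi> :: "real^'n \<Rightarrow> real" and r assume r: "r > 0" and C2: "C2_on (ball x r) \<phi>" and "\<forall>y\<in>ball x r. u y - \<phi> y \<le> u x - \<phi> x"
  then have max: "\<And>y. y \<in> ball x r \<Longrightarrow> u y - \<phi> y \<le> u x - \<phi> x" by blast
  have xin: "x \<in> ball x r" using r by simp
  define q where "q = (real CARD('n) + 2) / 2"
  have cb: "convex_on (ball x r) u" using u convex_on_subset by blast
  note T = convex_touched_above[OF r cb C2 max]
  define e where "e k = 1 / real (Suc k)" for k
  define \<rho> where "\<rho> k = r / 2 * e k" for k
  have e: "e k > 0" "e k \<le> 1" for k by (auto simp: e_def)
  have e0: "e \<longlonglongrightarrow> 0" using LIMSEQ_inverse_real_of_nat by (simp add: e_def[abs_def] inverse_eq_divide)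
  have \<rho>: "\<rho> k > 0" "\<rho> k < r" for k
  proof -
    show "\<rho> k > 0" using r e by (simp add: \<rho>_def)
    have "\<rho> k \<le> r / 2 * 1" unfolding \<rho>_def using r e by (intro mult_left_mono) auto
    then show "\<rho> k < r" using r by simp
  qed
  have "\<exists>y. dist x y < \<rho> k \<and> (1 - (norm (grad \<phi> y + (2 * e k) *\<^sub>R (y - x)))\<^sup>2) powr q \<le> det (hessian \<phi> y + (2 * e k) *\<^sub>R mat 1)" for k
  proof -
    define \<phi>' where "\<phi>' y = \<phi> y + e k * (norm (y - x))\<^sup>2" for y
    \<comment> \<open>On the sphere of radius \<open>\<rho> k\<close> the penalty costs
      \<open>e k\<close> times the square of the radius, while \<open>w\<close> falls short of the
      supremum at \<open>x\<close> by less; so the maximum is not on the sphere.\<close>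
    obtain w where w: "w \<in> S" "w x > u x - e k * (\<rho> k)\<^sup>2" using approx[of "e k * (\<rho> k)\<^sup>2" x] e \<rho>(1)[of k] by auto
    have sub: "cball x (\<rho> k) \<subseteq> ball x r" using \<rho>(2)[of k] by auto
    have C2': "C2_on (ball x r) \<phi>'" unfolding \<phi>'_def by (rule C2_on_add_square[OF open_ball C2])
    have "continuous_on (cball x (\<rho> k)) (\<lambda>y. w y - \<phi>' y)"
    proof (intro continuous_on_diff continuous_on_subset[OF S(2)[OF w(1)]] subset_UNIV)
      show "continuous_on (cball x (\<rho> k)) \<phi>'"
        using C2_on_has_derivative(1)[OF C2'] sub has_derivative_continuous
        by (intro continuous_at_imp_continuous_on) blast
    qed
    then obtain y where y: "y \<in> cball x (\<rho> k)" "\<And>z. z \<in> cball x (\<rho> k) \<Longrightarrow> w z - \<phi>' z \<le> w y - \<phi>' y"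
      using continuous_attains_sup[of "cball x (\<rho> k)" "\<lambda>y. w y - \<phi>' y"] \<rho>(1)[of k] by auto
    have "dist x y \<noteq> \<rho> k"
    proof
      assume d: "dist x y = \<rho> k"
      then have "norm (y - x) = \<rho> k" by (simp add: dist_norm norm_minus_commute)
      then have "w y - \<phi>' y \<le> u x - \<phi> x - e k * (\<rho> k)\<^sup>2"
        using le[OF w(1), of y] max[OF subsetD[OF sub y(1)]] by (simp add: \<phi>'_def)
      also have "\<dots> < w x - \<phi>' x" using w(2) by (simp add: \<phi>'_def)
      also have "\<dots> \<le> w y - \<phi>' y" using y(2)[of x] \<rho>(1)[of k] by simp
      finally show False by simp
    qed
    then have d: "dist x y < \<rho> k" using y(1) by simp
    have sb: "ball y (\<rho> k - dist x y) \<subseteq> cball x (\<rho> k)"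
    proof
      fix z assume "z \<in> ball y (\<rho> k - dist x y)"
      then show "z \<in> cball x (\<rho> k)" using dist_triangle[of x z y] by simp
    qed
    have "(1 - (norm (grad \<phi>' y))\<^sup>2) powr q \<le> det (hessian \<phi>' y)"
      unfolding q_def
    proof (rule subsolution_atD[OF S(1)[OF w(1)]])
      show "C2_on (ball y (\<rho> k - dist x y)) \<phi>'" using C2_on_subset[OF C2'] sb sub by blast
    qed (use d sb y in auto)
    moreover have yb: "y \<in> ball x r" using y(1) sub by blast
    ultimately show ?thesis using d unfolding \<phi>'_def
      by (auto simp: grad_add_square[OF open_ball C2 yb] hessian_add_square[OF open_ball C2 yb])
  qed
  then obtain y where y: "\<And>k. dist x (y k) < \<rho> k"
    "\<And>k. (1 - (norm (grad \<phi> (y k) + (2 * e k) *\<^sub>R (y k - x)))\<^sup>2) powr q \<le> det (hessian \<phi> (y k) + (2 * e k) *\<^sub>R mat 1)"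
    by metis
  have yx: "y \<longlonglongrightarrow> x"
  proof -
    have "\<rho> \<longlonglongrightarrow> 0" unfolding \<rho>_def by (rule tendsto_mult_right_zero[OF e0])
    then have "(\<lambda>k. dist (y k) x) \<longlonglongrightarrow> 0"
      by (rule tendsto_sandwich[rotated 2, OF tendsto_const])
        (use y(1) in \<open>auto simp: dist_commute less_imp_le\<close>)
    then show ?thesis by (rule tendsto_dist_iff[THEN iffD2])
  qed
  have g: "(\<lambda>k. grad \<phi> (y k)) \<longlonglongrightarrow> grad \<phi> x"
    using isCont_tendsto_compose[OF has_derivative_continuous[OF C2_on_has_derivative(2)[OF C2 xin]] yx] .
  have h: "(\<lambda>k. hessian \<phi> (y k)) \<longlonglongrightarrow> hessian \<phi> x"
  proof (rule isCont_tendsto_compose[OF _ yx])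
    show "isCont (hessian \<phi>) x"
      using C2 xin unfolding C2_on_def continuous_on_eq_continuous_at[OF open_ball] by blast
  qed
  have "(\<lambda>k. det (hessian \<phi> (y k) + (2 * e k) *\<^sub>R mat 1)) \<longlonglongrightarrow> det (hessian \<phi> x + (2 * 0) *\<^sub>R mat 1)"
    by (intro tendsto_det tendsto_intros h e0)
  then have dl: "(\<lambda>k. det (hessian \<phi> (y k) + (2 * e k) *\<^sub>R mat 1)) \<longlonglongrightarrow> det (hessian \<phi> x)" by simp
  have "(\<lambda>k. 1 - (norm (grad \<phi> (y k) + (2 * e k) *\<^sub>R (y k - x)))\<^sup>2) \<longlonglongrightarrow> 1 - (norm (grad \<phi> x + (2 * 0) *\<^sub>R (x - x)))\<^sup>2"
    by (intro tendsto_intros g e0 yx)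
  then have bl: "(\<lambda>k. 1 - (norm (grad \<phi> (y k) + (2 * e k) *\<^sub>R (y k - x)))\<^sup>2) \<longlonglongrightarrow> 1 - (norm (grad \<phi> x))\<^sup>2" by simp
  show "curvature_bound \<phi> x \<le> det (hessian \<phi> x)"
  \<comment> \<open>\<open>powr\<close> passes to the limit at a nonzero base. At base zero the
    bound is 0, and convexity of \<open>u\<close> gives a nonnegative determinant.\<close>
  proof (cases "1 - (norm (grad \<phi> x))\<^sup>2 = 0")
    case False
    have "(\<lambda>k. (1 - (norm (grad \<phi> (y k) + (2 * e k) *\<^sub>R (y k - x)))\<^sup>2) powr q) \<longlonglongrightarrow> (1 - (norm (grad \<phi> x))\<^sup>2) powr q"
      by (rule tendsto_powr[OF bl tendsto_const False])
    then show ?thesis unfolding q_def[symmetric] by (rule LIMSEQ_le[OF _ dl]) (use y(2) in auto)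
  qed (use T(3) in simp)
qed

definition hyperboloid :: "real^'n \<Rightarrow> real" where
  "hyperboloid x = sqrt (4 + (norm x)\<^sup>2)"

text \<open>With \<open>s = hyperboloid x\<close> the determinant is \<open>4 / s^(n+2)\<close> and
  the right-hand side is \<open>(2 / s)^(n+2)\<close>. For radius 1 both would be
  \<open>1 / s^(n+2)\<close>; radius 2 gains the factor \<open>2^n\<close>, hence
  strictness.\<close>

lemma
  fixes x :: "real^'n"
  shows C2_on_hyperboloid: "C2_on UNIV (hyperboloid :: real^'n \<Rightarrow> real)"
    and hyperboloid_strict_supersolution:
      "det (hessian hyperboloid x) < curvature_bound hyperboloid x"
proof -
  let ?H = "hyperboloid :: real^'n \<Rightarrow> real"
  have Hp: "?H x > 0" and H2: "(?H x)\<^sup>2 = 4 + x \<bullet> x" for x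
    by (auto simp: hyperboloid_def power2_norm_eq_inner intro: add_pos_nonneg)
  define M :: "real^'n \<Rightarrow> real^'n^'n" where
    "M x = (\<chi> i j. (if i = j then 1 / ?H x else 0) + (- 1 / (?H x)^3) * x $ i * x $ j)" for x
  have 1: "(?H has_derivative (\<lambda>h. h \<bullet> ((1 / ?H x) *\<^sub>R x))) (at x)" for x
  proof -
    have p: "0 < 4 + x \<bullet> x" by (simp add: add_pos_nonneg)
    have "((\<lambda>x. 4 + x \<bullet> x) has_derivative (\<lambda>h. 2 * (x \<bullet> h))) (at x)"
      by (auto intro!: derivative_eq_intros simp: inner_commute)
    from has_derivative_compose[OF this, of sqrt] DERIV_real_sqrt[OF p]
    have "((\<lambda>x. sqrt (4 + x \<bullet> x)) has_derivative (\<lambda>h. inverse (sqrt (4 + x \<bullet> x)) / 2 * (2 * (x \<bullet> h)))) (at x)"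
      unfolding has_field_derivative_def by blast
    moreover have "(\<lambda>h. inverse (sqrt (4 + x \<bullet> x)) / 2 * (2 * (x \<bullet> h))) = (\<lambda>h. h \<bullet> ((1 / sqrt (4 + x \<bullet> x)) *\<^sub>R x))"
      by (auto simp: fun_eq_iff inner_commute inverse_eq_divide)
    ultimately have "((\<lambda>x. sqrt (4 + x \<bullet> x)) has_derivative (\<lambda>h. h \<bullet> ((1 / sqrt (4 + x \<bullet> x)) *\<^sub>R x))) (at x)" by simp
    then show ?thesis by (simp add: hyperboloid_def[abs_def] power2_norm_eq_inner)
  qed
  have Mv: "M x *v h = (1 / ?H x) *\<^sub>R h - ((x \<bullet> h) / (?H x)^3) *\<^sub>R x" for x h
  proof -
    have "(M x *v h) $ i = (1 / ?H x) * h $ i - ((x \<bullet> h) / (?H x)^3) * x $ i" for i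
    proof -
      have "(M x *v h) $ i = (\<Sum>j\<in>UNIV. (if i = j then 1 / ?H x * h $ j else 0) + (- 1 / (?H x)^3 * x $ i) * (x $ j * h $ j))"
        unfolding matrix_vector_mult_def M_def by (auto simp: algebra_simps intro!: sum.cong)
      also have "\<dots> = 1 / ?H x * h $ i + (- 1 / (?H x)^3 * x $ i) * (x \<bullet> h)"
        by (simp only: sum.distrib sum_distrib_left[symmetric] inner_vec_def inner_real_def) simp
      finally show ?thesis by simp
    qed
    then show ?thesis by (simp add: vec_eq_iff)
  qed
  have 2: "((\<lambda>x. (1 / ?H x) *\<^sub>R x) has_derivative (\<lambda>h. M x *v h)) (at x)" for x
  proof -
    have "((\<lambda>x. 1 / ?H x) has_derivative (\<lambda>h. - (h \<bullet> ((1 / ?H x) *\<^sub>R x)) / (?H x)\<^sup>2)) (at x)"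
      by (rule has_derivative_eq_rhs[OF has_derivative_divide[OF has_derivative_const 1[of x]]])
        (use Hp[of x] in \<open>auto simp: fun_eq_iff field_simps power2_eq_square\<close>)
    from has_derivative_scaleR[OF this has_derivative_ident]
    show ?thesis unfolding Mv by (simp add: inner_commute power2_eq_square power3_eq_cube algebra_simps)
  qed
  have cH: "continuous_on UNIV ?H" unfolding hyperboloid_def by (intro continuous_intros)
  have Hn: "?H x \<noteq> 0" for x using Hp[of x] by simp
  have 3: "continuous_on UNIV M"
    unfolding M_def
  proof (rule continuous_on_vec_lambda, rule continuous_on_vec_lambda)
    fix i j :: 'n
    have "continuous_on UNIV (\<lambda>x. if i = j then 1 / ?H x else 0)"
      by (cases "i = j") (auto intro!: continuous_intros cH simp: Hn)
    moreover have "continuous_on UNIV (\<lambda>x. (- 1 / (?H x)^3) * x $ i * x $ j)"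
      by (intro continuous_intros cH) (simp add: Hn)
    ultimately show "continuous_on UNIV (\<lambda>x. (if i = j then 1 / ?H x else 0) + (- 1 / (?H x)^3) * x $ i * x $ j)"
      by (rule continuous_on_add)
  qed
  show "C2_on UNIV ?H" by (rule C2_onI[OF open_UNIV 1 2 3])
  have g: "grad ?H x = (1 / ?H x) *\<^sub>R x" by (rule grad_of_C2[OF open_UNIV 1 2 3]) auto
  have h: "hessian ?H x = M x" by (rule hessian_of_C2[OF open_UNIV 1 2 3]) auto
  let ?n = "CARD('n)" and ?s = "?H x"
  note s = Hp[of x] and s2 = H2[of x]
  have n: "?n \<ge> 1" by (simp add: Suc_leI)
  have "det (hessian ?H x) = (1 / ?s) ^ (?n - 1) * (1 / ?s + (- 1 / ?s^3) * (x \<bullet> x))"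
    unfolding h by (rule det_rank_one_perturbation) (simp add: M_def)
  also have "1 / ?s + (- 1 / ?s^3) * (x \<bullet> x) = 4 * (1 / ?s) ^ 3"
  proof -
    have "1 / ?s + (- 1 / ?s^3) * (x \<bullet> x) = (?s\<^sup>2 - x \<bullet> x) / ?s^3"
      using s by (simp add: field_simps power2_eq_square power3_eq_cube)
    then show ?thesis using s2 by (simp add: power_one_over)
  qed
  also have "(1 / ?s) ^ (?n - 1) * (4 * (1 / ?s) ^ 3) = 4 * (1 / ?s) ^ (?n + 2)"
  proof -
    have "?n + 2 = (?n - 1) + 3" using n by simp
    then show ?thesis by (simp only: power_add mult.left_commute)
  qed
  also have "\<dots> < 2 ^ (?n + 2) * (1 / ?s) ^ (?n + 2)"
  proof -
    have "(2::real) ^ 2 < 2 ^ (?n + 2)" using n by (intro power_strict_increasing) auto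
    then show ?thesis using s by (intro mult_strict_right_mono) auto
  qed
  also have "\<dots> = (2 / ?s) ^ (?n + 2)" by (simp add: power_mult_distrib[symmetric])
  also have "\<dots> = (2 / ?s) powr (2 * ((real ?n + 2) / 2))"
  proof -
    have "2 * ((real ?n + 2) / 2) = real (?n + 2)" by simp
    moreover have "2 / ?s > 0" using s by simp
    ultimately show ?thesis by (simp only: powr_realpow)
  qed
  also have "\<dots> = ((2 / ?s) powr 2) powr ((real ?n + 2) / 2)" by (simp only: powr_powr)
  also have "(2 / ?s) powr 2 = 1 - (norm (grad ?H x))\<^sup>2"
  proof -
    have "(2 / ?s) powr 2 = (2 / ?s) ^ 2" using s by (intro powr_numeral) simp
    also have "\<dots> = 4 / ?s\<^sup>2" by (simp add: power_divide)
    also have "\<dots> = (?s\<^sup>2 - x \<bullet> x) / ?s\<^sup>2" using s2 by simp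
    also have "\<dots> = 1 - (x \<bullet> x) / ?s\<^sup>2" using s by (simp add: diff_divide_distrib)
    also have "(x \<bullet> x) / ?s\<^sup>2 = (norm (grad ?H x))\<^sup>2"
      unfolding g power2_norm_eq_inner using s by (simp add: power2_eq_square)
    finally show ?thesis .
  qed
  finally show "det (hessian ?H x) < curvature_bound ?H x" .
qed

section \<open>The largest subsolution\<close>

context
  fixes E :: "(real^'n) set"
  assumes E: "E \<subseteq> sphere 0 1" "E \<noteq> {}"
begin

section \<open>Support function and closed convex hull\<close>

lemma support_fun_bdd: "bdd_above ((\<lambda>\<alpha>. \<alpha> \<bullet> x) ` E)"
proof (rule bdd_aboveI2)
  fix \<alpha> assume "\<alpha> \<in> E"
  then have "norm \<alpha> = 1" using E by auto
  then show "\<alpha> \<bullet> x \<le> norm x" using norm_cauchy_schwarz[of \<alpha> x] by simp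
qed

lemma support_fun_ge: "\<alpha> \<in> E \<Longrightarrow> \<alpha> \<bullet> x \<le> support_fun E x"
  unfolding support_fun_def by (rule cSUP_upper[OF _ support_fun_bdd])

lemma support_fun_le: "(\<And>\<alpha>. \<alpha> \<in> E \<Longrightarrow> \<alpha> \<bullet> x \<le> c) \<Longrightarrow> support_fun E x \<le> c"
  unfolding support_fun_def by (rule cSUP_least[OF E(2)])

lemma support_fun_le_norm: "support_fun E x \<le> norm x"
proof (rule support_fun_le)
  fix \<alpha> assume "\<alpha> \<in> E"
  then have "norm \<alpha> = 1" using E by auto
  then show "\<alpha> \<bullet> x \<le> norm x" using norm_cauchy_schwarz[of \<alpha> x] by simp
qed

lemma support_fun_add: "support_fun E (x + y) \<le> support_fun E x + support_fun E y"
  by (rule support_fun_le) (simp add: inner_add_right add_mono support_fun_ge)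

lemma support_fun_scale: "t \<ge> 0 \<Longrightarrow> support_fun E (t *\<^sub>R x) = t * support_fun E x"
proof (cases "t = 0")
  case True
  obtain \<alpha> where "\<alpha> \<in> E" using E by blast
  then have "support_fun E 0 \<ge> 0" using support_fun_ge[of \<alpha> 0] by simp
  moreover have "support_fun E 0 \<le> 0" by (rule support_fun_le) simp
  ultimately show ?thesis using True by simp
next
  case False
  have *: "support_fun E (t *\<^sub>R x) \<le> t * support_fun E x" if "t > 0" for t x
    by (rule support_fun_le) (use that in \<open>simp add: support_fun_ge\<close>)
  assume "t \<ge> 0"
  with False have t: "t > 0" by simp
  have "support_fun E ((1/t) *\<^sub>R t *\<^sub>R x) \<le> 1/t * support_fun E (t *\<^sub>R x)" using t by (intro *) simp
  then have "t * support_fun E x \<le> support_fun E (t *\<^sub>R x)" using t by (simp add: field_simps)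
  with *[OF t, of x] show ?thesis by simp
qed

lemma support_fun_hull_ge:
  assumes "p \<in> closed_convex_hull E" shows "p \<bullet> x \<le> support_fun E x"
proof -
  have "E \<subseteq> {p. x \<bullet> p \<le> support_fun E x}" using support_fun_ge by (auto simp: inner_commute)
  then have "closure (convex hull E) \<subseteq> {p. x \<bullet> p \<le> support_fun E x}"
    by (intro closure_minimal hull_minimal convex_halfspace_le closed_halfspace_le)
  with assms show ?thesis by (auto simp: closed_convex_hull_def inner_commute)
qed

text \<open>If \<open>a\<close> is the normal of a hyperplane strictly separating \<open>p\<close>
  from the hull, the assumption fails in the direction \<open>-a\<close>.\<close>

lemma in_closed_convex_hullI:
  assumes p: "\<And>x. p \<bullet> x \<le> support_fun E x" shows "p \<in> closed_convex_hull E"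
proof (rule ccontr)
  assume "p \<notin> closed_convex_hull E"
  then obtain a b where ab: "a \<bullet> p < b" "\<And>x. x \<in> closed_convex_hull E \<Longrightarrow> a \<bullet> x > b"
    using separating_hyperplane_closed_point[of "closed_convex_hull E" p]
    by (auto simp: closed_convex_hull_def convex_closure)
  have "support_fun E (- a) \<le> - b"
  proof (rule support_fun_le)
    fix \<alpha> assume "\<alpha> \<in> E"
    then have "\<alpha> \<in> closed_convex_hull E"
      unfolding closed_convex_hull_def using hull_inc[of \<alpha> E convex] closure_subset by blast
    from ab(2)[OF this] show "\<alpha> \<bullet> - a \<le> - b" by (simp add: inner_commute)
  qed
  with p[of "- a"] ab(1) show False by (simp add: inner_commute)
qed

lemma support_fun_convex: "convex_on UNIV (support_fun E)"
proof (rule convex_onI)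
  fix t :: real and x y assume "t > 0" "t < 1"
  then show "support_fun E ((1 - t) *\<^sub>R x + t *\<^sub>R y) \<le> (1 - t) * support_fun E x + t * support_fun E y"
    using support_fun_add[of "(1 - t) *\<^sub>R x" "t *\<^sub>R y"] by (simp add: support_fun_scale)
qed simp

text \<open>At a point of differentiability the gradient of the support function is a maximizer in the
  closure of \<open>E\<close>, so it has norm one and the right-hand side of the equation vanishes.\<close>

lemma support_fun_subsolution: "subsolution_at (support_fun E) x"
  unfolding subsolution_at_def
proof (intro allI impI, elim conjE)
  fix \<phi> :: "real^'n \<Rightarrow> real" and r :: real
  assume r: "r > 0" and C2: "C2_on (ball x r) \<phi>"
    and "\<forall>y\<in>ball x r. support_fun E y - \<phi> y \<le> support_fun E x - \<phi> x"
  then have max: "\<And>y. y \<in> ball x r \<Longrightarrow> support_fun E y - \<phi> y \<le> support_fun E x - \<phi> x" by blast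
  have cb: "convex_on (ball x r) (support_fun E)" using support_fun_convex convex_on_subset by blast
  note T = convex_touched_above[OF r cb C2 max]
  \<comment> \<open>The supremum over \<open>E\<close> need not be attained, so the maximizer is
    taken in the closure, which still lies in the sphere.\<close>
  have "compact (closure E)"
    using bounded_subset[OF bounded_sphere E(1)] by (simp add: compact_closure)
  moreover have "closure E \<noteq> {}" using E by simp
  ultimately obtain \<alpha> where \<alpha>: "\<alpha> \<in> closure E" "\<And>\<beta>. \<beta> \<in> closure E \<Longrightarrow> \<beta> \<bullet> x \<le> \<alpha> \<bullet> x"
    using continuous_attains_sup[of "closure E" "\<lambda>\<beta>. \<beta> \<bullet> x"] continuous_on_inner[OF continuous_on_id continuous_on_const]
    by blast
  have "closure E \<subseteq> sphere 0 1" using E(1) by (intro closure_minimal) auto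
  then have n\<alpha>: "norm \<alpha> = 1" using \<alpha> by auto
  have "\<alpha> \<in> closed_convex_hull E"
    using \<alpha>(1) closure_mono[OF hull_subset[of E convex]] by (auto simp: closed_convex_hull_def)
  then have ge: "\<alpha> \<bullet> y \<le> support_fun E y" for y by (rule support_fun_hull_ge)
  have "support_fun E x \<le> \<alpha> \<bullet> x" by (rule support_fun_le) (use \<alpha>(2) closure_subset in blast)
  with ge[of x] have eq: "support_fun E x = \<alpha> \<bullet> x" by simp
  have "\<alpha> = grad (support_fun E) x"
    by (rule touching_grad(1)[where f = "support_fun E", OF r _ _ has_derivative_grad[OF T(1)]])
      (use ge eq in \<open>auto simp: inner_diff_right\<close>)
  then have "norm (grad \<phi> x) = 1" using T(2) n\<alpha> by simp
  then show "curvature_bound \<phi> x \<le> det (hessian \<phi> x)"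
    using T(3) by simp
qed

text \<open>For convex \<open>w\<close> the increment bound says that all subgradients lie in the
  closed convex hull of \<open>E\<close>. The hyperboloid keeps the pointwise supremum
  finite.\<close>

definition perron_class :: "(real^'n \<Rightarrow> real) set" where
  "perron_class = {w. convex_on UNIV w \<and> (\<forall>x. subsolution_at w x) \<and>
     (\<forall>x y. w (x + y) \<le> w x + support_fun E y) \<and> (\<forall>x. w x \<le> hyperboloid x)}"

lemma norm_le_hyperboloid: "norm x \<le> hyperboloid x"
  unfolding hyperboloid_def by (rule real_le_rsqrt) simp

lemma support_fun_perron: "support_fun E \<in> perron_class"
  unfolding perron_class_def
proof (intro CollectI conjI allI support_fun_convex support_fun_subsolution support_fun_add)
  show "support_fun E x \<le> hyperboloid x" for x
    using support_fun_le_norm norm_le_hyperboloid by (rule order_trans)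
qed

lemma perron_class_diff_le: "w \<in> perron_class \<Longrightarrow> w x - w y \<le> norm (x - y)"
proof -
  assume "w \<in> perron_class"
  then have "w (y + (x - y)) \<le> w y + support_fun E (x - y)" unfolding perron_class_def by blast
  then show ?thesis using support_fun_le_norm[of "x - y"] by simp
qed

lemma perron_class_lipschitz: "w \<in> perron_class \<Longrightarrow> 1-lipschitz_on UNIV w"
  by (rule lipschitz_on_UNIV_1I) (rule perron_class_diff_le)

lemma perron_class_continuous: "w \<in> perron_class \<Longrightarrow> continuous_on A w"
  using lipschitz_on_continuous_on[OF perron_class_lipschitz] continuous_on_subset by blast

definition perron :: "real^'n \<Rightarrow> real" where
  "perron x = (SUP w\<in>perron_class. w x)"

lemma perron_bdd: "bdd_above ((\<lambda>w. w x) ` perron_class)"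
  by (rule bdd_aboveI2[of _ _ "hyperboloid x"]) (auto simp: perron_class_def)

lemma perron_upper: "w \<in> perron_class \<Longrightarrow> w x \<le> perron x"
  unfolding perron_def by (rule cSUP_upper[OF _ perron_bdd])

lemma perron_least: "(\<And>w. w \<in> perron_class \<Longrightarrow> w x \<le> c) \<Longrightarrow> perron x \<le> c"
  unfolding perron_def using support_fun_perron by (intro cSUP_least) auto

lemma perron_in_class: "perron \<in> perron_class"
proof -
  have sub: "perron (x + y) \<le> perron x + support_fun E y" for x y
  proof (rule perron_least)
    fix w assume w: "w \<in> perron_class"
    then have "w (x + y) \<le> w x + support_fun E y" unfolding perron_class_def by blast
    then show "w (x + y) \<le> perron x + support_fun E y" using perron_upper[OF w, of x] by simp
  qed
  have le: "perron x \<le> hyperboloid x" for x by (rule perron_least) (auto simp: perron_class_def)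
  have conv: "convex_on UNIV perron"
  proof (rule convex_onI)
    fix t :: real and x y assume t: "t > 0" "t < 1"
    show "perron ((1 - t) *\<^sub>R x + t *\<^sub>R y) \<le> (1 - t) * perron x + t * perron y"
    proof (rule perron_least)
      fix w assume w: "w \<in> perron_class"
      then have "convex_on UNIV w" unfolding perron_class_def by blast
      from convex_onD[OF this, of t x y] t
      have "w ((1 - t) *\<^sub>R x + t *\<^sub>R y) \<le> (1 - t) * w x + t * w y" by simp
      also have "\<dots> \<le> (1 - t) * perron x + t * perron y"
        using t by (intro add_mono mult_left_mono perron_upper[OF w]) auto
      finally show "w ((1 - t) *\<^sub>R x + t *\<^sub>R y) \<le> (1 - t) * perron x + t * perron y" .
    qed
  qed simp
  have "subsolution_at perron x" for x
  proof (rule Sup_subsolution_at[of perron_class])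
    show "perron_class \<noteq> {}" using support_fun_perron by blast
    show "\<exists>w\<in>perron_class. perron x - e < w x" if "e > 0" for x e
    proof (rule ccontr)
      assume "\<not> ?thesis"
      then have "perron x \<le> perron x - e" by (intro perron_least) (auto simp: not_less)
      with that show False by simp
    qed
  qed (auto simp: perron_class_def[THEN eqset_imp_iff, simplified] perron_upper perron_class_continuous conv)
  with sub le conv show ?thesis unfolding perron_class_def by blast
qed

lemma perron_diff_le: "perron x - perron y \<le> norm (x - y)"
  using perron_class_diff_le[OF perron_in_class] .

lemma support_fun_le_perron: "support_fun E x \<le> perron x"
  by (rule perron_upper[OF support_fun_perron])

text \<open>The gluing \<open>w = max u v\<close> on \<open>\<Omega>\<close>, \<open>w = u\<close> elsewhere, belongs to the Perron class: a supporting
  plane of \<open>u\<close> at a boundary point of \<open>\<Omega>\<close> supports \<open>w\<close>, and a positive maximum of \<open>w - hyperboloid\<close>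
  would contradict the strict supersolution property.\<close>

lemma admissible_le_perron:
  assumes \<Omega>: "open \<Omega>" "bounded \<Omega>" and v: "v \<in> admissible (\<lambda>x t. 1) \<Omega>"
    and fr: "\<And>x. x \<in> frontier \<Omega> \<Longrightarrow> v x = perron x" and x0: "x0 \<in> \<Omega>"
  shows "v x0 \<le> perron x0"
proof -
  define w where "w x = (if x \<in> \<Omega> then max (perron x) (v x) else perron x)" for x
  have cv: "continuous_on (closure \<Omega>) v" and lc: "locally_convex \<Omega> v" and vs: "viscosity_subsolution (\<lambda>x t. 1) \<Omega> v"
    using v by (auto simp: admissible_def)
  have pc: "convex_on UNIV perron" and ps: "\<And>x. subsolution_at perron x"
    and pH: "\<And>x. perron x \<le> hyperboloid x" and pV: "\<And>x y. perron (x + y) \<le> perron x + support_fun E y"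
    using perron_in_class unfolding perron_class_def by blast+
  have wge: "perron x \<le> w x" for x by (simp add: w_def)
  have cw: "continuous_on UNIV w"
  proof -
    have "continuous_on (closure \<Omega> \<union> - \<Omega>) (\<lambda>x. if x \<in> closure \<Omega> then max (perron x) (v x) else perron x)"
    proof (rule continuous_on_If)
      show "max (perron x) (v x) = perron x" if "x \<in> - \<Omega>" "x \<in> closure \<Omega>" for x
        using that fr[of x] \<Omega>(1) by (simp add: frontier_def interior_open)
    qed (use \<Omega> cv perron_class_continuous[OF perron_in_class] in \<open>auto intro!: continuous_intros\<close>)
    moreover have "closure \<Omega> \<union> - \<Omega> = UNIV" using closure_subset by blast
    moreover have "(\<lambda>x. if x \<in> closure \<Omega> then max (perron x) (v x) else perron x) = w"
    proof
      fix x show "(if x \<in> closure \<Omega> then max (perron x) (v x) else perron x) = w x"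
        using fr[of x] \<Omega>(1) closure_subset[of \<Omega>] by (auto simp: w_def frontier_def interior_open)
    qed
    ultimately show ?thesis by metis
  qed
  have supp: "\<exists>r>0. \<exists>p. \<forall>y\<in>ball x r. w y \<ge> w x + p \<bullet> (y - x)" for x
  proof (cases "x \<in> \<Omega>")
    case True
    then obtain r where r: "r > 0" "ball x r \<subseteq> \<Omega>" "convex_on (ball x r) v"
      using lc by (auto simp: locally_convex_def)
    have "convex_on (ball x r) perron" using pc convex_on_subset by blast
    from convex_on_max[OF this r(3)] obtain p where
      "\<And>y. y \<in> ball x r \<Longrightarrow> max (perron y) (v y) \<ge> max (perron x) (v x) + p \<bullet> (y - x)"
      using convex_on_ball_subgradient[OF r(1)] by blast
    then have "\<forall>y\<in>ball x r. w y \<ge> w x + p \<bullet> (y - x)" using r(2) True by (auto simp: w_def subset_iff)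
    then show ?thesis using r(1) by blast
  next
    case False
    obtain p where "\<And>y. perron y \<ge> perron x + p \<bullet> (y - x)" using convex_on_UNIV_subgradient[OF pc] by blast
    moreover have "w x = perron x" using False by (simp add: w_def)
    ultimately have "\<forall>y\<in>ball x 1. w y \<ge> w x + p \<bullet> (y - x)" using wge by (metis order_trans)
    then show ?thesis by (intro exI[of _ 1]) auto
  qed
  have wc: "convex_on UNIV w" by (rule convex_on_of_local_support[OF cw supp])
  have "compact (closure \<Omega>)" using \<Omega> by (simp add: compact_closure)
  then have "bounded (v ` closure \<Omega>)" "bounded (perron ` closure \<Omega>)"
    using cv perron_class_continuous[OF perron_in_class] by (auto intro!: compact_imp_bounded compact_continuous_image)
  then obtain B1 B2 where B1: "\<And>x. x \<in> closure \<Omega> \<Longrightarrow> \<bar>v x\<bar> \<le> B1" and B2: "\<And>x. x \<in> closure \<Omega> \<Longrightarrow> \<bar>perron x\<bar> \<le> B2"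
    unfolding bounded_iff by (metis imageI real_norm_def)
  \<comment> \<open>\<open>w\<close> stays within a constant of the Perron function; this is the
    global information behind the increment bound.\<close>
  define C where "C = \<bar>B1\<bar> + \<bar>B2\<bar>"
  have wC: "w x \<le> perron x + C" for x
  proof (cases "x \<in> \<Omega>")
    case True
    then have "x \<in> closure \<Omega>" using closure_subset by blast
    from B1[OF this] B2[OF this] show ?thesis using True by (simp add: w_def C_def abs_le_iff)
  qed (simp add: w_def C_def)
  have wV: "w (x + y) \<le> w x + support_fun E y" for x y
  proof -
    have "w (x + y) - w x \<le> support_fun E y + e" if e: "e > 0" for e
    proof -
      \<comment> \<open>By convexity the increment over \<open>y\<close> is at most
        \<open>1 / t\<close> times the increment over \<open>t y\<close>. The latter exceeds the
        wanted bound by a constant only, and this \<open>t\<close> reduces the constant to at most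
        \<open>e\<close>.\<close>
      define t where "t = max 1 ((C + \<bar>perron x - w x\<bar>) / e)"
      have t: "t \<ge> 1" "(C + \<bar>perron x - w x\<bar>) / e \<le> t" by (auto simp: t_def)
      have "x + y = (1 - 1/t) *\<^sub>R x + (1/t) *\<^sub>R (x + t *\<^sub>R y)" using t by (simp add: algebra_simps)
      then have "w (x + y) \<le> (1 - 1/t) * w x + 1/t * w (x + t *\<^sub>R y)"
        using convex_onD[OF wc, of "1/t" x "x + t *\<^sub>R y"] t by simp
      then have "t * (w (x + y) - w x) \<le> w (x + t *\<^sub>R y) - w x"
        using t by (simp add: field_simps)
      also have "\<dots> \<le> perron x + t * support_fun E y + C - w x"
        using wC[of "x + t *\<^sub>R y"] pV[of x "t *\<^sub>R y"] t by (simp add: support_fun_scale)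
      also have "\<dots> \<le> t * support_fun E y + (C + \<bar>perron x - w x\<bar>)" by simp
      also have "\<dots> \<le> t * support_fun E y + t * e" using t(2) e by (simp add: field_simps)
      finally have "t * (w (x + y) - w x) \<le> t * (support_fun E y + e)" by (simp add: distrib_left)
      then show ?thesis using t by simp
    qed
    then show ?thesis using field_le_epsilon[of "w (x + y) - w x" "support_fun E y"] by simp
  qed
  have ws: "subsolution_at w x" for x
  proof (cases "w x = perron x")
    case True
    then show ?thesis using subsolution_at_le[OF ps[of x], of 1 w] wge by simp
  next
    case False
    then have x: "x \<in> \<Omega>" and eq: "v x = w x" by (auto simp: w_def max_def split: if_splits)
    obtain r where r: "r > 0" "ball x r \<subseteq> \<Omega>" using \<Omega> x open_contains_ball by blast
    have "subsolution_at v x" using vs x viscosity_subsolution_iff[OF \<Omega>(1)] by blast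
    then show ?thesis
    proof (rule subsolution_at_le[where u = v and w = w])
      show "v y \<le> w y" if "y \<in> ball x r" for y using that r(2) by (auto simp: w_def)
    qed (use r(1) eq in auto)
  qed
  have wH: "w x \<le> hyperboloid x" for x
  proof (rule ccontr)
    assume neg: "\<not> ?thesis"
    then have "x \<in> \<Omega>" using pH[of x] by (auto simp: w_def split: if_splits)
    then have xc: "x \<in> closure \<Omega>" using closure_subset by blast
    have "continuous_on (closure \<Omega>) (\<lambda>x. w x - hyperboloid x)"
      unfolding hyperboloid_def by (intro continuous_intros continuous_on_subset[OF cw]) auto
    then have "\<exists>z\<in>closure \<Omega>. \<forall>y\<in>closure \<Omega>. w y - hyperboloid y \<le> w z - hyperboloid z"
      using \<open>compact (closure \<Omega>)\<close> xc by (intro continuous_attains_sup) auto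
    then obtain z where z: "z \<in> closure \<Omega>" "\<And>y. y \<in> closure \<Omega> \<Longrightarrow> w y - hyperboloid y \<le> w z - hyperboloid z"
      by auto
    have zp: "w z - hyperboloid z > 0" using z(2)[OF xc] neg by simp
    \<comment> \<open>Outside the closure \<open>w\<close> equals the Perron function, which lies
      below the barrier. The positive maximum is thus global, and the barrier itself is a test
      function at \<open>z\<close>.\<close>
    have "w y - hyperboloid y \<le> w z - hyperboloid z" for y
    proof (cases "y \<in> closure \<Omega>")
      case False
      then have "w y = perron y" using closure_subset by (auto simp: w_def)
      then show ?thesis using pH[of y] zp by simp
    qed (use z in blast)
    then have "curvature_bound hyperboloid z \<le> det (hessian hyperboloid z)"
      by (intro subsolution_atD[OF ws, of 1] C2_on_subset[OF C2_on_hyperboloid]) auto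
    then show False using hyperboloid_strict_supersolution[of z] by simp
  qed
  have "w \<in> perron_class" unfolding perron_class_def using wc ws wV wH by blast
  from perron_upper[OF this, of x0] show ?thesis using x0 by (simp add: w_def)
qed

section \<open>Admissibility, maximality, blowdown and gradients of the Perron function\<close>

lemma perron_admissible: "perron \<in> admissible (\<lambda>x t. 1) UNIV"
  unfolding admissible_def
proof (intro CollectI conjI)
  note L = perron_class_lipschitz[OF perron_in_class]
  have p: "convex_on UNIV perron" "\<And>x. subsolution_at perron x"
    using perron_in_class unfolding perron_class_def by blast+
  show "continuous_on (closure UNIV) perron" by (rule perron_class_continuous[OF perron_in_class])
  show "viscosity_subsolution (\<lambda>x t. 1) UNIV perron" using p viscosity_subsolution_iff[OF open_UNIV] by blast
  show "locally_convex UNIV perron" unfolding locally_convex_def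
    using p(1) convex_on_subset by (intro ballI exI[of _ 1]) auto
  show "weakly_spacelike UNIV perron" unfolding weakly_spacelike_def
  proof (intro conjI ballI impI)
    show "\<exists>r>0. \<exists>L. L-lipschitz_on (ball x r \<inter> UNIV) perron" for x
      using lipschitz_on_subset[OF L] by (intro exI[of _ 1] exI[of _ 1] conjI) auto
    show "norm (grad perron x) \<le> 1" if "perron differentiable (at x)" for x
      using norm_grad_le_of_lipschitz[OF zero_less_one lipschitz_on_subset[OF L] that] by simp
  qed
qed

lemma perron_maximal: "admissible_maximal_solution (\<lambda>x t. 1) UNIV perron"
  unfolding admissible_maximal_solution_def
proof (intro conjI allI impI perron_admissible, elim conjE)
  fix \<Omega> :: "(real^'n) set" and v
  assume dom: "is_domain \<Omega>" and bd: "bounded \<Omega>" and v: "v \<in> admissible (\<lambda>x t. 1) \<Omega>"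
    and fr: "\<forall>x\<in>frontier \<Omega>. perron x = v x"
  have \<Omega>: "open \<Omega>" using dom by (simp add: is_domain_def)
  have "convex_on UNIV perron" using perron_in_class unfolding perron_class_def by blast
  then show "spacelike_area \<Omega> v \<le> spacelike_area \<Omega> perron"
  proof (rule area_comparison[OF \<Omega> bd _ perron_diff_le])
    show "spacelike_convex \<Omega> v" using v by (auto simp: admissible_def spacelike_convex_def)
    show "v x \<le> perron x" if "x \<in> \<Omega>" for x
      by (rule admissible_le_perron[OF \<Omega> bd v _ that]) (use fr in auto)
  qed (use fr in auto)
qed

text \<open>For \<open>u = perron\<close> the claim follows from
  \<open>V_E(x) \<le> u(r x) / r \<le> V_E(x) + u(0) / r\<close>: the lower bound since the support
  function is homogeneous and belongs to the class, the upper one by the increment bound from the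
  origin.\<close>

lemma perron_blowdown: "has_blowdown perron (support_fun E)"
  unfolding has_blowdown_def
proof
  fix x
  have lo: "support_fun E x \<le> perron (r *\<^sub>R x) / r" if "r > 0" for r
    using support_fun_le_perron[of "r *\<^sub>R x"] that by (simp add: support_fun_scale field_simps)
  have hi: "perron (r *\<^sub>R x) / r \<le> support_fun E x + perron 0 / r" if "r > 0" for r
  proof -
    have "perron (0 + r *\<^sub>R x) \<le> perron 0 + support_fun E (r *\<^sub>R x)"
      using perron_in_class unfolding perron_class_def by blast
    then show ?thesis using that by (simp add: support_fun_scale field_simps)
  qed
  have "((\<lambda>r. support_fun E x + perron 0 / r) \<longlongrightarrow> support_fun E x + 0) at_top"
    by (intro tendsto_add tendsto_const tendsto_divide_0[OF tendsto_const] filterlim_at_top_imp_at_infinity filterlim_ident)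
  then have hl: "((\<lambda>r. support_fun E x + perron 0 / r) \<longlongrightarrow> support_fun E x) at_top" by simp
  show "((\<lambda>r. perron (r *\<^sub>R x) / r) \<longlongrightarrow> support_fun E x) at_top"
  proof (rule tendsto_sandwich[OF _ _ tendsto_const hl])
    show "\<forall>\<^sub>F r in at_top. support_fun E x \<le> perron (r *\<^sub>R x) / r"
      using eventually_gt_at_top[of 0] by eventually_elim (rule lo)
    show "\<forall>\<^sub>F r in at_top. perron (r *\<^sub>R x) / r \<le> support_fun E x + perron 0 / r"
      using eventually_gt_at_top[of 0] by eventually_elim (rule hi)
  qed
qed

lemma perron_grad_in_hull:
  assumes "perron differentiable (at x)" shows "grad perron x \<in> closed_convex_hull E"
proof (rule in_closed_convex_hullI)
  fix y :: "real^'n"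
  have "convex_on (ball x (norm y + 1)) perron"
    using perron_in_class convex_on_subset unfolding perron_class_def by blast
  moreover have "norm y + 1 > 0" using norm_ge_zero[of y] by linarith
  ultimately have "perron (x + y) \<ge> perron x + grad perron x \<bullet> (x + y - x)"
    by (intro convex_grad_support[OF _ _ assms]) (auto simp: dist_norm)
  moreover have "perron (x + y) \<le> perron x + support_fun E y"
    using perron_in_class unfolding perron_class_def by blast
  ultimately show "grad perron x \<bullet> y \<le> support_fun E y" by simp
qed

end

section \<open>Density of the gradient image\<close>

text \<open>The Hessian is \<open>2 A I + 2 B e e^T\<close>: with small \<open>A\<close> and large
  \<open>B\<close>, slight curvature in all directions and a large one along the unit vector
  \<open>e\<close>.\<close>

definition quad :: "real \<Rightarrow> real^'n \<Rightarrow> real \<Rightarrow> real \<Rightarrow> real^'n \<Rightarrow> real^'n \<Rightarrow> real^'n \<Rightarrow> real" where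
  "quad \<alpha> P A B e x y = \<alpha> + P \<bullet> (y - x) + A * (norm (y - x))\<^sup>2 + B * (e \<bullet> (y - x))\<^sup>2"

definition quad_grad :: "real^'n \<Rightarrow> real \<Rightarrow> real \<Rightarrow> real^'n \<Rightarrow> real^'n \<Rightarrow> real^'n \<Rightarrow> real^'n" where
  "quad_grad P A B e x z = P + (2 * A) *\<^sub>R (z - x) + (2 * B * (e \<bullet> (z - x))) *\<^sub>R e"

lemma quad_expand:
  "quad \<alpha> P A B e x y = quad \<alpha> P A B e x z + quad_grad P A B e x z \<bullet> (y - z)
     + (A * (norm (y - z))\<^sup>2 + B * (e \<bullet> (y - z))\<^sup>2)"
proof -
  define h k where "h = y - z" and "k = z - x"
  have "y - x = k + h" "z - x = k" "y - z = h" by (auto simp: h_def k_def)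
  then show ?thesis unfolding quad_def quad_grad_def power2_norm_eq_inner
    by (simp add: inner_add_left inner_add_right inner_commute power2_eq_square algebra_simps)
qed

lemma quad_has_derivative:
  "(quad \<alpha> P A B e x has_derivative (\<lambda>h. h \<bullet> quad_grad P A B e x z)) (at z)"
proof -
  have 1: "((\<lambda>y. P \<bullet> (y - x)) has_derivative (\<lambda>h. P \<bullet> h)) (at z)"
    and 2: "((\<lambda>y. e \<bullet> (y - x)) has_derivative (\<lambda>h. e \<bullet> h)) (at z)"
    and 3: "((\<lambda>y. (y - x) \<bullet> (y - x)) has_derivative (\<lambda>h. (z - x) \<bullet> h + h \<bullet> (z - x))) (at z)"
    by (auto intro!: derivative_eq_intros)
  have "((\<lambda>y. \<alpha> + P \<bullet> (y - x) + A * ((y - x) \<bullet> (y - x)) + B * ((e \<bullet> (y - x)) * (e \<bullet> (y - x)))) has_derivative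
      (\<lambda>h. 0 + P \<bullet> h + A * ((z - x) \<bullet> h + h \<bullet> (z - x)) + B * (e \<bullet> (z - x) * (e \<bullet> h) + e \<bullet> h * (e \<bullet> (z - x))))) (at z)"
    by (intro has_derivative_add has_derivative_const has_derivative_mult_right has_derivative_mult 1 2 3)
  moreover have "0 + P \<bullet> h + A * ((z - x) \<bullet> h + h \<bullet> (z - x)) + B * (e \<bullet> (z - x) * (e \<bullet> h) + e \<bullet> h * (e \<bullet> (z - x)))
      = h \<bullet> quad_grad P A B e x z" for h
    by (simp add: quad_grad_def inner_add_right inner_commute[of h])
  ultimately show ?thesis
    by (simp add: quad_def[abs_def] power2_norm_eq_inner power2_eq_square[of "e \<bullet> _"])
qed

lemma continuous_on_quad: "continuous_on S (quad \<alpha> P A B e x)"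
  unfolding quad_def by (intro continuous_intros)

lemma convex_on_quad:
  assumes "A \<ge> 0" "B \<ge> 0" shows "convex_on UNIV (quad \<alpha> P A B e x)"
proof (rule convex_on_of_local_support[OF continuous_on_quad])
  fix z
  have "\<forall>y\<in>ball z 1. quad \<alpha> P A B e x y \<ge> quad \<alpha> P A B e x z + quad_grad P A B e x z \<bullet> (y - z)"
    using assms by (subst quad_expand[of _ _ _ _ _ _ _ z]) auto
  then show "\<exists>r>0. \<exists>p. \<forall>y\<in>ball z r. quad \<alpha> P A B e x y \<ge> quad \<alpha> P A B e x z + p \<bullet> (y - z)"
    by (intro exI[of _ 1] conjI exI[of _ "quad_grad P A B e x z"]) auto
qed

text \<open>The quadratic part bounds the Hessian of every touching test function from below, so
  \<open>big\<close> makes its determinant at least 1, while the right-hand side is at most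
  1.\<close>

lemma quad_subsolution:
  fixes e :: "real^'n"
  assumes AB: "A \<ge> 0" "B \<ge> 0" and e: "norm e = 1" and big: "(2 * A) ^ (CARD('n) - 1) * (2 * A + 2 * B) \<ge> 1"
    and g: "norm (quad_grad P A B e x z) \<le> 1"
  shows "subsolution_at (quad \<alpha> P A B e x) z"
  unfolding subsolution_at_def
proof (intro allI impI, elim conjE)
  fix \<phi> :: "real^'n \<Rightarrow> real" and r :: real
  let ?Q = "quad \<alpha> P A B e x"
  assume r: "r > 0" and C2: "C2_on (ball z r) \<phi>" and max: "\<forall>y\<in>ball z r. ?Q y - \<phi> y \<le> ?Q z - \<phi> z"
  define q where "q h = A * (norm h)\<^sup>2 + B * (e \<bullet> h)\<^sup>2" for h
  have le: "\<phi> y \<ge> \<phi> z + quad_grad P A B e x z \<bullet> (y - z) + q (y - z)" if "y \<in> ball z r" for y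
    using max that quad_expand[of \<alpha> P A B e x y z] by (fastforce simp: q_def)
  have q: "q (t *\<^sub>R v) = t\<^sup>2 * q v" for t v by (simp add: q_def power_mult_distrib algebra_simps)
  note T = quadratic_touching_below[where p = "quad_grad P A B e x z" and q = q, OF r C2 le q]
  have sym: "transpose (hessian \<phi> z) = hessian \<phi> z" by (rule hessian_symmetric[OF open_ball C2]) (use r in simp)
  have "v \<bullet> (hessian \<phi> z *v v) \<ge> 2 * A * (v \<bullet> v)" for v
  proof -
    have "2 * q v \<ge> 2 * A * (v \<bullet> v)" using AB by (simp add: q_def power2_norm_eq_inner)
    with T(2)[of v] show ?thesis by linarith
  qed
  moreover have "e \<bullet> (hessian \<phi> z *v e) \<ge> 2 * A + 2 * B"
    using T(2)[of e] e by (simp add: q_def norm_eq_1)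
  ultimately have "det (hessian \<phi> z) \<ge> (2 * A) ^ (CARD('n) - 1) * (2 * A + 2 * B)"
    using AB by (intro det_ge_of_quadratic_bounds[OF sym _ _ e]) auto
  moreover have "curvature_bound \<phi> z \<le> 1 powr ((real CARD('n) + 2) / 2)"
  proof (intro powr_mono2)
    have "grad \<phi> z = quad_grad P A B e x z" by (rule T(1))
    then show "0 \<le> 1 - (norm (grad \<phi> z))\<^sup>2" using g by (simp add: abs_square_le_1)
  qed auto
  ultimately show "curvature_bound \<phi> z \<le> det (hessian \<phi> z)"
    using big by simp
qed

context
  fixes E :: "(real^'n) set"
  assumes E: "E \<subseteq> sphere 0 1" "E \<noteq> {}"
begin

text \<open>The maximum of the two functions is an admissible competitor on the ball with the
  boundary values of the Perron function, so it lies below it. The gradient bound makes this maximum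
  1-Lipschitz.\<close>

lemma quad_le_perron:
  assumes AB: "A \<ge> 0" "B \<ge> 0" and e: "norm e = 1" and big: "(2 * A) ^ (CARD('n) - 1) * (2 * A + 2 * B) \<ge> 1"
    and \<rho>: "\<rho> > 0" and g: "\<And>z. z \<in> ball x \<rho> \<Longrightarrow> norm (quad_grad P A B e x z) \<le> 1"
    and bd: "\<And>y. y \<in> sphere x \<rho> \<Longrightarrow> quad \<alpha> P A B e x y \<le> perron E y"
  shows "quad \<alpha> P A B e x x \<le> perron E x"
proof -
  let ?Q = "quad \<alpha> P A B e x" and ?u = "perron E"
  define v where "v y = max (?u y) (?Q y)" for y
  note u = perron_in_class[OF E]
  have uc: "convex_on UNIV ?u" and us: "\<And>y. subsolution_at ?u y"
    using u unfolding perron_class_def[OF E] by blast+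
  have vs: "subsolution_at v z" if z: "z \<in> ball x \<rho>" for z
  proof (cases "?u z \<ge> ?Q z")
    case True
    then show ?thesis by (intro subsolution_at_le[OF us, of 1]) (auto simp: v_def)
  next
    case False
    then show ?thesis by (intro subsolution_at_le[OF quad_subsolution[OF AB e big g[OF z]], of 1]) (auto simp: v_def)
  qed
  have vc: "convex_on UNIV v" unfolding v_def by (intro convex_on_max uc convex_on_quad AB)
  have Qlip: "\<bar>?Q y - ?Q z\<bar> \<le> norm (y - z)" if "y \<in> ball x \<rho>" "z \<in> ball x \<rho>" for y z
  proof -
    have "norm (?Q y - ?Q z) \<le> 1 * norm (y - z)"
    proof (rule differentiable_bound[OF convex_ball _ _ that])
      fix w assume w: "w \<in> ball x \<rho>"
      show "(?Q has_derivative (\<lambda>h. h \<bullet> quad_grad P A B e x w)) (at w within ball x \<rho>)"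
        by (rule has_derivative_at_withinI[OF quad_has_derivative])
      show "onorm (\<lambda>h. h \<bullet> quad_grad P A B e x w) \<le> 1"
      proof (rule onorm_le)
        fix h
        have "\<bar>h \<bullet> quad_grad P A B e x w\<bar> \<le> norm h * norm (quad_grad P A B e x w)" by (rule Cauchy_Schwarz_ineq2)
        also have "\<dots> \<le> norm h * 1" using g[OF w] by (intro mult_left_mono) auto
        finally show "norm (h \<bullet> quad_grad P A B e x w) \<le> 1 * norm h" by simp
      qed
    qed
    then show ?thesis by simp
  qed
  have vlip: "1-lipschitz_on (ball x \<rho>) v"
  proof (rule lipschitz_onI)
    fix y z assume yz: "y \<in> ball x \<rho>" "z \<in> ball x \<rho>"
    show "dist (v y) (v z) \<le> 1 * dist y z"
      using Qlip[OF yz] perron_diff_le[OF E, of y z] perron_diff_le[OF E, of z y]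
      by (auto simp: v_def dist_norm norm_minus_commute max_def abs_le_iff)
  qed simp
  have "v \<in> admissible (\<lambda>x t. 1) (ball x \<rho>)"
    unfolding admissible_def
  proof (intro CollectI conjI)
    show "continuous_on (closure (ball x \<rho>)) v"
      unfolding v_def by (intro continuous_on_max perron_class_continuous[OF E u] continuous_on_quad)
    show "viscosity_subsolution (\<lambda>x t. 1) (ball x \<rho>) v"
      using vs viscosity_subsolution_iff[OF open_ball] by blast
    show "locally_convex (ball x \<rho>) v"
      unfolding locally_convex_def using vc convex_on_subset open_contains_ball[of "ball x \<rho>"]
      by (metis convex_ball open_ball subset_UNIV)
    show "weakly_spacelike (ball x \<rho>) v"
      unfolding weakly_spacelike_def
    proof (intro conjI ballI impI)
      fix z assume z: "z \<in> ball x \<rho>"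
      obtain s where s: "s > 0" "ball z s \<subseteq> ball x \<rho>" using openE[OF open_ball z] by blast
      show "\<exists>r>0. \<exists>L. L-lipschitz_on (ball z r \<inter> ball x \<rho>) v"
        using lipschitz_on_subset[OF vlip] by (intro exI[of _ 1] exI[of _ 1] conjI) auto
      show "norm (grad v z) \<le> 1" if "v differentiable (at z)"
        using norm_grad_le_of_lipschitz[OF s(1) lipschitz_on_subset[OF vlip s(2)] that] .
    qed
  qed
  then have "v x \<le> ?u x"
    by (rule admissible_le_perron[OF E open_ball bounded_ball])
      (use \<rho> bd in \<open>auto simp: v_def frontier_ball max_def intro: antisym\<close>)
  then show ?thesis by (simp add: v_def)
qed

lemma closed_convex_hull_norm_le: "p \<in> closed_convex_hull E \<Longrightarrow> norm p \<le> 1"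
proof -
  assume p: "p \<in> closed_convex_hull E"
  have "p \<bullet> p \<le> norm p"
    using support_fun_hull_ge[OF E p, of p] support_fun_le_norm[OF E, of p] by simp
  then have "norm p * norm p \<le> 1 * norm p" by (simp add: power2_norm_eq_inner[symmetric] power2_eq_square)
  then show ?thesis by (cases "p = 0") auto
qed

text \<open>The hull contains \<open>\<xi> + c y / |y|\<close>, whose product with \<open>y\<close>
  is the right-hand side. The growth beyond slope \<xi> later confines contact points to a fixed
  ball.\<close>

lemma support_fun_interior:
  assumes "ball \<xi> d \<subseteq> closed_convex_hull E" "0 \<le> c" "c < d"
  shows "support_fun E y \<ge> \<xi> \<bullet> y + c * norm y"
proof (cases "y = 0")
  case False
  have "\<xi> + (c / norm y) *\<^sub>R y \<in> closed_convex_hull E"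
    using False assms by (intro subsetD[OF assms(1)]) (simp add: dist_norm)
  from support_fun_hull_ge[OF E this, of y] show ?thesis
    using False by (simp add: inner_add_left power2_norm_eq_inner[symmetric] power2_eq_square)
next
  case True
  have "support_fun E 0 = 0" using support_fun_scale[OF E, of 0 0] by simp
  then show ?thesis using True by simp
qed

text \<open>If no gradient lies in \<open>ball p r\<close>, then the points where \<open>u - k/2 |y|\<^sup>2\<close> is touched from below
  by planes of slope \<open>\<xi>\<close> near \<open>p\<close> form a null set, so the map from these points back to \<open>\<xi>\<close> is not
  Lipschitz. Two contact points that are close compared to their slopes give a quadratic polynomial of
  large Hessian determinant that touches \<open>u\<close> from below; raised slightly, it contradicts the
  maximality of \<open>u\<close>.\<close>

lemma perron_gradient_in_ball:
  assumes r: "0 < r" "r \<le> 1" and pr: "ball p r \<subseteq> closed_convex_hull E"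
  shows "\<exists>x. perron E differentiable (at x) \<and> grad (perron E) x \<in> ball p r"
proof (rule ccontr)
  assume neg: "\<not> ?thesis"
  let ?u = "perron E"
  \<comment> \<open>\<open>R0\<close> comes from the estimate \<open>r / 2 * |x| \<le> 3\<close> for
    contact points below. The extra 1 keeps unit balls around them inside the ball of radius
    \<open>R\<close>, and \<open>k R^2 = r / 8\<close> makes the paraboloid change slopes by at most
    \<open>r / 8\<close>.\<close>
  define R0 where "R0 = 6 / r"
  define R where "R = R0 + 1"
  define k where "k = r / (8 * R\<^sup>2)"
  have R0: "R0 > 0" using r by (simp add: R0_def)
  then have R: "R \<ge> 1" "R > 0" by (auto simp: R_def)
  have k0: "k > 0" using r R by (simp add: k_def)
  have kR2: "k * R\<^sup>2 = r / 8" using R by (simp add: k_def)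
  have "R \<le> R\<^sup>2" using R by (simp add: power2_eq_square)
  then have "k * R \<le> k * R\<^sup>2" using k0 by (intro mult_left_mono) auto
  then have kR: "k * R \<le> r / 8" using kR2 by simp
  have "k * 1 \<le> k * R" using k0 R by (intro mult_left_mono) auto
  then have k1: "k \<le> 1 / 8" using kR r by simp
  note uclass = perron_in_class[OF E]
  have uc: "continuous_on S ?u" for S by (rule perron_class_continuous[OF E uclass])
  have u0: "?u 0 \<le> 2"
  proof -
    have "?u 0 \<le> hyperboloid (0 :: real^'n)" using uclass unfolding perron_class_def[OF E] by blast
    then show ?thesis by (simp add: hyperboloid_def)
  qed
  let ?B = "ball p (r / 8)"
  let ?f = "\<lambda>y. ?u y - k / 2 * (norm y)\<^sup>2"
  \<comment> \<open>The contact point minimizes \<open>?f\<close> minus the linear function of slope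
    \<xi>. Comparing the minimum with the value at \<open>0\<close>, where \<open>u\<close> is at
    most 2, with the growth of \<open>u\<close> beyond slope \<xi> gives the bound
    \<open>R0\<close>.\<close>
  have "\<exists>x. norm x \<le> R0 \<and> (\<forall>y\<in>cball 0 R. ?f y \<ge> ?f x + \<xi> \<bullet> (y - x))" if \<xi>: "\<xi> \<in> ?B" for \<xi>
  proof -
    have "continuous_on (cball 0 R) (\<lambda>y. ?f y - \<xi> \<bullet> y)" by (intro continuous_intros uc)
    then obtain x where x: "x \<in> cball 0 R" "\<And>y. y \<in> cball 0 R \<Longrightarrow> ?f x - \<xi> \<bullet> x \<le> ?f y - \<xi> \<bullet> y"
      using continuous_attains_inf[of "cball 0 R" "\<lambda>y. ?f y - \<xi> \<bullet> y"] R by auto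
    have "ball \<xi> (3 * r / 4) \<subseteq> ball p r"
    proof
      fix z assume "z \<in> ball \<xi> (3 * r / 4)"
      then show "z \<in> ball p r" using \<xi> r dist_triangle[of p z \<xi>] by simp
    qed
    then have sub: "ball \<xi> (3 * r / 4) \<subseteq> closed_convex_hull E" using pr by blast
    have "support_fun E x \<ge> \<xi> \<bullet> x + r / 2 * norm x"
      by (rule support_fun_interior[OF sub]) (use r in auto)
    then have "?u x \<ge> \<xi> \<bullet> x + r / 2 * norm x"
      using support_fun_le_perron[OF E, of x] by linarith
    moreover have "?f x - \<xi> \<bullet> x \<le> ?u 0" using x(2)[of 0] R by simp
    moreover have "k / 2 * (norm x)\<^sup>2 \<le> k / 2 * R\<^sup>2"
      using x(1) k0 by (intro mult_left_mono power_mono) auto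
    moreover have "k / 2 * R\<^sup>2 = r / 16" using kR2 by simp
    ultimately have "r / 2 * norm x \<le> 3" using u0 r by linarith
    then have "norm x \<le> R0" using r by (simp add: R0_def field_simps)
    moreover have "\<forall>y\<in>cball 0 R. ?f y \<ge> ?f x + \<xi> \<bullet> (y - x)"
      using x(2) by (fastforce simp: inner_diff_right)
    ultimately show ?thesis by blast
  qed
  then obtain X where X: "\<And>\<xi>. \<xi> \<in> ?B \<Longrightarrow> norm (X \<xi>) \<le> R0"
    "\<And>\<xi> y. \<xi> \<in> ?B \<Longrightarrow> y \<in> cball 0 R \<Longrightarrow> ?f y \<ge> ?f (X \<xi>) + \<xi> \<bullet> (y - X \<xi>)" by metis
  have near: "cball x 1 \<subseteq> cball 0 R" if "norm x \<le> R0" for x :: "real^'n"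
  proof
    fix y assume "y \<in> cball x 1"
    then show "y \<in> cball 0 R" using that norm_triangle_ineq2[of y x] by (simp add: R_def dist_norm norm_minus_commute)
  qed
  have kx: "k * norm x \<le> r / 8" if "norm x \<le> R" for x :: "real^'n"
    using mult_left_mono[OF that less_imp_le[OF k0]] kR by linarith
  \<comment> \<open>Differentiability would give the gradient \<open>\<xi> + k X \<xi>\<close>,
    which is within \<open>r / 4\<close> of \<open>p\<close>.\<close>
  have nd: "\<not> ?u differentiable (at (X \<xi>))" if \<xi>: "\<xi> \<in> ?B" for \<xi>
  proof
    let ?x = "X \<xi>"
    assume d: "?u differentiable (at ?x)"
    have "((\<lambda>y. ?u y - k / 2 * (y \<bullet> y)) has_derivative (\<lambda>h. h \<bullet> (grad ?u ?x - k *\<^sub>R ?x))) (at ?x)"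
      by (auto intro!: derivative_eq_intros has_derivative_grad d simp: inner_diff_right inner_commute)
    then have D: "(?f has_derivative (\<lambda>h. h \<bullet> (grad ?u ?x - k *\<^sub>R ?x))) (at ?x)"
      by (simp add: power2_norm_eq_inner)
    have "\<xi> = grad ?u ?x - k *\<^sub>R ?x"
    proof (rule touching_grad(1)[OF zero_less_one _ _ D])
      show "?f y \<ge> ?f ?x + \<xi> \<bullet> (y - ?x)" if "y \<in> ball ?x 1" for y
      proof (rule X(2)[OF \<xi>])
        show "y \<in> cball 0 R" using subsetD[OF near[OF X(1)[OF \<xi>]], of y] that by simp
      qed
    qed simp
    then have "grad ?u ?x = \<xi> + k *\<^sub>R ?x" by (metis eq_diff_eq)
    moreover have "norm (k *\<^sub>R ?x) \<le> r / 8" using kx[of ?x] X(1)[OF \<xi>] k0 by (simp add: R_def)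
    ultimately have "dist p (grad ?u ?x) < r"
      using \<xi> dist_triangle[of p "grad ?u ?x" \<xi>] r by (simp add: dist_norm)
    then show False using neg d by auto
  qed
  have neg_X: "negligible (X ` ?B)"
  proof (rule negligible_subset)
    have "locally_convex UNIV ?u" using perron_admissible[OF E] by (simp add: admissible_def)
    from locally_convex_negligible_nondifferentiable[OF this]
    show "negligible {x. \<not> ?u differentiable (at x)}" by simp
  qed (use nd in auto)
  have notlip: "\<exists>\<xi>1\<in>?B. \<exists>\<xi>2\<in>?B. norm (\<xi>2 - \<xi>1) > M * norm (X \<xi>2 - X \<xi>1)" for M
  proof (rule ccontr)
    assume "\<not> ?thesis"
    then have lip: "norm (\<xi>2 - \<xi>1) \<le> M * norm (X \<xi>2 - X \<xi>1)" if "\<xi>1 \<in> ?B" "\<xi>2 \<in> ?B" for \<xi>1 \<xi>2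
      using that by (force simp: not_less)
    \<comment> \<open>The assumed estimate makes \<open>X\<close> injective, so \<open>Y\<close> is
      its inverse; but a Lipschitz image of a null set cannot be a ball.\<close>
    define Y where "Y x = (SOME \<xi>. \<xi> \<in> ?B \<and> X \<xi> = x)" for x
    have Y: "Y x \<in> ?B \<and> X (Y x) = x" if "x \<in> X ` ?B" for x
      unfolding Y_def by (rule someI_ex) (use that in auto)
    have YX: "Y (X \<xi>) = \<xi>" if "\<xi> \<in> ?B" for \<xi>
      using lip[OF that, of "Y (X \<xi>)"] Y[of "X \<xi>"] that by auto
    have "negligible (Y ` X ` ?B)"
    proof (rule negligible_locally_Lipschitz_image[OF _ neg_X])
      fix x assume x: "x \<in> X ` ?B"
      show "\<exists>T L. open T \<and> x \<in> T \<and> (\<forall>y\<in>X ` ?B \<inter> T. norm (Y y - Y x) \<le> L * norm (y - x))"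
      proof (intro exI[of _ UNIV] exI[of _ M] conjI ballI)
        fix y assume "y \<in> X ` ?B \<inter> UNIV"
        then show "norm (Y y - Y x) \<le> M * norm (y - x)" using lip[of "Y x" "Y y"] Y[OF x] Y[of y] by auto
      qed auto
    qed simp
    moreover have "Y ` X ` ?B = ?B" using YX by force
    ultimately have "negligible ?B" by simp
    then show False using open_not_negligible[of ?B] r by auto
  qed
  \<comment> \<open>The polynomial will have curvature \<open>k / 2\<close> in all directions and an
    additional \<open>c / 4\<close> along \<open>e\<close>; this \<open>c\<close> makes the
    determinant at least 1.\<close>
  define c where "c = max 1 (4 / (k / 2) ^ (CARD('n) - 1))"
  have c1: "c \<ge> 1" by (simp add: c_def)
  have ck: "(k / 2) ^ (CARD('n) - 1) * (c / 4) \<ge> 1"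
  proof -
    have p: "(k / 2) ^ (CARD('n) - 1) > 0" using k0 by simp
    have "4 / (k / 2) ^ (CARD('n) - 1) \<le> c" by (simp add: c_def)
    then show ?thesis using p by (simp add: field_simps)
  qed
  \<comment> \<open>The factor \<open>c^2 / k\<close> makes the distance \<delta> of the contact
    points smaller than \<open>s k / c^2\<close>; this is what the lift has to outweigh at the
    end.\<close>
  obtain \<xi>1 \<xi>2 where \<xi>: "\<xi>1 \<in> ?B" "\<xi>2 \<in> ?B" and gap: "norm (\<xi>2 - \<xi>1) > c\<^sup>2 / k * norm (X \<xi>2 - X \<xi>1)"
    using notlip by blast
  define s \<delta> x where "s = norm (\<xi>2 - \<xi>1)" and "\<delta> = norm (X \<xi>2 - X \<xi>1)" and "x = X \<xi>1"
  have \<delta>0: "\<delta> \<ge> 0" by (simp add: \<delta>_def)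
  have \<delta>: "\<delta> < s * k / c\<^sup>2" using gap k0 c1 by (simp add: s_def \<delta>_def field_simps)
  have "0 \<le> c\<^sup>2 / k * \<delta>" using \<delta>0 k0 by simp
  then have s0: "s > 0" using gap unfolding s_def \<delta>_def by linarith
  have s4: "s < r / 4"
    using \<xi> dist_triangle[of \<xi>1 \<xi>2 p] by (simp add: s_def dist_norm norm_minus_commute)
  \<comment> \<open>On the sphere of radius \<rho> one has
    \<open>|\<tau>| \<le> 2 \<rho> = 4 s / c\<close>, which is exactly the range where the parabola
    \<open>s/2 \<tau> + c/8 \<tau>^2\<close> lies below \<open>max 0 (s \<tau>)\<close>.\<close>
  define \<rho> where "\<rho> = 2 * s / c"
  have \<rho>0: "\<rho> > 0" using s0 c1 by (simp add: \<rho>_def)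
  have c\<rho>: "c * \<rho> = 2 * s" using c1 by (simp add: \<rho>_def)
  have "\<rho> \<le> 2 * s" using s0 c1 by (simp add: \<rho>_def divide_le_eq)
  then have \<rho>1: "\<rho> \<le> 1" using s4 r by linarith
  have \<delta>\<rho>: "\<delta> \<le> \<rho>"
  proof -
    have "k \<le> 2 * c" using k1 c1 by simp
    then have "s * k / c\<^sup>2 \<le> s * (2 * c) / c\<^sup>2" using s0 by (intro divide_right_mono mult_left_mono) auto
    also have "\<dots> = \<rho>" using c1 by (simp add: \<rho>_def power2_eq_square)
    finally show ?thesis using \<delta> by simp
  qed
  define e where "e = (1 / s) *\<^sub>R (\<xi>2 - \<xi>1)"
  have e1: "norm e = 1" using s0 by (simp add: e_def s_def)
  have \<xi>2: "\<xi>2 = \<xi>1 + s *\<^sub>R e" using s0 by (simp add: e_def)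
  \<comment> \<open>\<beta> is the shift along \<open>e\<close> at which the supporting functions of
    the two contact points cross: the second minus the first is \<open>s \<tau>\<close>. The two
    contact conditions give \<open>0 \<le> \<beta> \<le> \<delta>\<close>.\<close>
  define \<beta> where "\<beta> = (?f x - ?f (X \<xi>2) - \<xi>2 \<bullet> (x - X \<xi>2)) / s"
  have xR: "norm x \<le> R0" "x \<in> cball 0 R" using X(1)[OF \<xi>(1)] by (auto simp: x_def R_def)
  have x2R: "X \<xi>2 \<in> cball 0 R" using X(1)[OF \<xi>(2)] by (simp add: R_def)
  have \<beta>0: "\<beta> \<ge> 0" using X(2)[OF \<xi>(2) xR(2)] s0 by (simp add: \<beta>_def)
  have \<beta>\<delta>: "\<beta> \<le> \<delta>"
  proof -
    have "s * \<beta> = ?f x - ?f (X \<xi>2) - \<xi>2 \<bullet> (x - X \<xi>2)" using s0 by (simp add: \<beta>_def)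
    also have "\<dots> \<le> - (\<xi>1 \<bullet> (X \<xi>2 - x)) - \<xi>2 \<bullet> (x - X \<xi>2)" using X(2)[OF \<xi>(1) x2R] by (simp add: x_def)
    also have "\<dots> = s * (e \<bullet> (X \<xi>2 - x))" by (simp add: \<xi>2 inner_add_left inner_diff_right algebra_simps)
    also have "\<dots> \<le> s * (norm e * \<delta>)"
      using s0 norm_cauchy_schwarz[of e "X \<xi>2 - x"] by (intro mult_left_mono) (auto simp: \<delta>_def x_def)
    finally show ?thesis using s0 e1 by simp
  qed
  define \<tau> where "\<tau> y = e \<bullet> (y - x) - \<beta>" for y
  define W where "W y = ?u x + (\<xi>1 + k *\<^sub>R x) \<bullet> (y - x)" for y
  have sq: "(norm y)\<^sup>2 = (norm x)\<^sup>2 + 2 * (x \<bullet> (y - x)) + (norm (y - x))\<^sup>2" for y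
    by (simp add: power2_norm_eq_inner inner_diff_left inner_diff_right inner_commute algebra_simps)
  have lower: "?u y \<ge> W y + k / 2 * (norm (y - x))\<^sup>2 + max 0 (s * \<tau> y)" if y: "y \<in> cball 0 R" for y
  proof -
    have eq: "W y + k / 2 * (norm (y - x))\<^sup>2 = ?f x + \<xi>1 \<bullet> (y - x) + k / 2 * (norm y)\<^sup>2"
      unfolding sq[of y] W_def by (simp add: inner_add_left algebra_simps)
    have "?f (X \<xi>2) + \<xi>2 \<bullet> (y - X \<xi>2) = ?f x + \<xi>1 \<bullet> (y - x) + s * \<tau> y"
    proof -
      have "s * \<tau> y = s * (e \<bullet> (y - x)) - s * \<beta>" by (simp add: \<tau>_def right_diff_distrib)
      moreover have "s * \<beta> = ?f x - ?f (X \<xi>2) - \<xi>2 \<bullet> (x - X \<xi>2)" using s0 by (simp add: \<beta>_def)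
      moreover have "\<xi>2 \<bullet> (y - x) = \<xi>1 \<bullet> (y - x) + s * (e \<bullet> (y - x))" by (simp add: \<xi>2 inner_add_left)
      ultimately show ?thesis by (simp add: inner_diff_right)
    qed
    with X(2)[OF \<xi>(2) y] X(2)[OF \<xi>(1) y] eq show ?thesis by (simp add: x_def[symmetric] max_def)
  qed
  \<comment> \<open>On the sphere half of the curvature \<open>k\<close> is to spare, worth
    \<open>k / 4 * \<rho>^2 = k s^2 / c^2\<close>. At \<open>x\<close> the polynomial without the
    lift is below \<open>u\<close> by at most half of this. The factor 3/4 lies between 1/2 and
    1.\<close>
  define \<eta> where "\<eta> = 3 / 4 * (k * s\<^sup>2 / c\<^sup>2)"
  \<comment> \<open>The wedge \<open>max 0 (s \<tau>)\<close> is replaced by the parabola in \<tau>,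
    the curvature \<open>k\<close> is halved, and the lift is added; \<alpha> and \<open>P\<close>
    are the value and the gradient at \<open>x\<close> of the result.\<close>
  define \<alpha> where "\<alpha> = ?u x - s * \<beta> / 2 + c / 8 * \<beta>\<^sup>2 + \<eta>"
  define P where "P = \<xi>1 + k *\<^sub>R x + (s / 2 - c * \<beta> / 4) *\<^sub>R e"
  have Qeq: "quad \<alpha> P (k / 4) (c / 8) e x y = W y + s / 2 * \<tau> y + c / 8 * (\<tau> y)\<^sup>2 + k / 4 * (norm (y - x))\<^sup>2 + \<eta>" for y
    by (simp add: quad_def \<alpha>_def P_def W_def \<tau>_def inner_add_left power2_eq_square algebra_simps)
  have "quad \<alpha> P (k / 4) (c / 8) e x x \<le> ?u x"
  proof (rule quad_le_perron[OF _ _ e1 _ \<rho>0])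
    show "0 \<le> k / 4" "0 \<le> c / 8" using k0 c1 by auto
    have "(k / 2) ^ (CARD('n) - 1) * (c / 4) \<le> (k / 2) ^ (CARD('n) - 1) * (k / 2 + c / 4)"
      using k0 by (intro mult_left_mono) auto
    with ck show "1 \<le> (2 * (k / 4)) ^ (CARD('n) - 1) * (2 * (k / 4) + 2 * (c / 8))" by simp
    show "quad \<alpha> P (k / 4) (c / 8) e x y \<le> ?u y" if y: "y \<in> sphere x \<rho>" for y
    proof -
      have n: "norm (y - x) = \<rho>" using y by (simp add: dist_norm norm_minus_commute)
      have yR: "y \<in> cball 0 R" using near[OF xR(1)] y \<rho>1 by auto
      have "\<bar>e \<bullet> (y - x)\<bar> \<le> \<rho>" using Cauchy_Schwarz_ineq2[of e "y - x"] e1 n by simp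
      then have "\<bar>\<tau> y\<bar> \<le> 2 * \<rho>" using \<beta>0 \<beta>\<delta> \<delta>\<rho> by (simp add: \<tau>_def abs_le_iff)
      then have "c / 8 * (\<bar>\<tau> y\<bar> * \<bar>\<tau> y\<bar>) \<le> c / 8 * (2 * \<rho> * \<bar>\<tau> y\<bar>)"
        using c1 by (intro mult_left_mono mult_right_mono) auto
      also have "\<dots> = s / 2 * \<bar>\<tau> y\<bar>" using c\<rho> by (simp add: algebra_simps)
      finally have "c / 8 * (\<tau> y)\<^sup>2 \<le> s / 2 * \<bar>\<tau> y\<bar>" by (simp add: power2_eq_square)
      moreover have "s / 2 * \<tau> y + s / 2 * \<bar>\<tau> y\<bar> = max 0 (s * \<tau> y)"
        using s0 by (cases "\<tau> y \<ge> 0") (auto simp: max_def mult_nonneg_nonneg mult_pos_neg algebra_simps abs_of_neg not_le)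
      moreover have "\<eta> \<le> k / 4 * (norm (y - x))\<^sup>2"
        unfolding n using k0 s0 c1 by (simp add: \<eta>_def \<rho>_def power_divide power_mult_distrib field_simps)
      ultimately show ?thesis using lower[OF yR] unfolding Qeq by linarith
    qed
    \<comment> \<open>The gradient is \<open>\<xi>1\<close> plus terms of norm at most
      \<open>r/8\<close>, \<open>s\<close>, \<open>r/16\<close> and \<open>s/2\<close>, where
      \<open>s < r/4\<close>. So it stays in \<open>ball p r\<close>, hence in the hull and in the
      closed unit ball.\<close>
    show "norm (quad_grad P (k / 4) (c / 8) e x z) \<le> 1" if z: "z \<in> ball x \<rho>" for z
    proof -
      have n: "norm (z - x) \<le> \<rho>" using z by (simp add: dist_norm norm_minus_commute)
      have t: "\<bar>e \<bullet> (z - x)\<bar> \<le> \<rho>" using Cauchy_Schwarz_ineq2[of e "z - x"] e1 n by simp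
      define a1 a2 a3 a4 where "a1 = k *\<^sub>R x" and "a2 = (s / 2 - c * \<beta> / 4) *\<^sub>R e"
        and "a3 = (k / 2) *\<^sub>R (z - x)" and "a4 = (c / 4 * (e \<bullet> (z - x))) *\<^sub>R e"
      have G: "quad_grad P (k / 4) (c / 8) e x z = \<xi>1 + a1 + a2 + a3 + a4"
        by (simp add: quad_grad_def P_def a1_def a2_def a3_def a4_def)
      have b1: "norm a1 \<le> r / 8" using kx[of x] xR k0 by (simp add: a1_def)
      have "c * \<beta> \<le> 2 * s" using mult_left_mono[of \<beta> \<rho> c] \<beta>\<delta> \<delta>\<rho> c1 c\<rho> by simp
      moreover have "0 \<le> c * \<beta>" using \<beta>0 c1 by simp
      ultimately have "\<bar>s / 2 - c * \<beta> / 4\<bar> \<le> s" using s0 by linarith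
      then have b2: "norm a2 \<le> s" using e1 by (simp add: a2_def)
      have "k / 2 * norm (z - x) \<le> k / 2 * 1" using n \<rho>1 k0 by (intro mult_left_mono) auto
      moreover have "k \<le> r / 8" using kR \<open>k * 1 \<le> k * R\<close> by simp
      moreover have "norm a3 = k / 2 * norm (z - x)" using k0 by (simp add: a3_def)
      ultimately have b3: "norm a3 \<le> r / 16" by linarith
      have "c / 4 * \<bar>e \<bullet> (z - x)\<bar> \<le> c / 4 * \<rho>" using t c1 by (intro mult_left_mono) auto
      then have b4: "norm a4 \<le> s / 2" using e1 c1 c\<rho> by (simp add: a4_def abs_mult)
      have "norm (a1 + a2 + a3 + a4) \<le> norm a1 + norm a2 + norm a3 + norm a4"
        using norm_triangle_ineq[of "a1 + a2 + a3" a4] norm_triangle_ineq[of "a1 + a2" a3] norm_triangle_ineq[of a1 a2] by linarith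
      then have "norm (a1 + a2 + a3 + a4) < 5 * r / 8" using b1 b2 b3 b4 s4 r by linarith
      moreover have "dist p (\<xi>1 + w) \<le> dist p \<xi>1 + norm w" for w
        using dist_triangle[of p "\<xi>1 + w" \<xi>1] by (simp add: dist_norm)
      note this[of "a1 + a2 + a3 + a4"]
      ultimately have "\<xi>1 + (a1 + a2 + a3 + a4) \<in> ball p r" using \<xi>(1) r by simp
      then have "\<xi>1 + (a1 + a2 + a3 + a4) \<in> closed_convex_hull E" using pr by blast
      then show ?thesis using closed_convex_hull_norm_le unfolding G by (simp add: add.assoc)
    qed
  qed
  then have "s / 2 * \<tau> x + c / 8 * (\<tau> x)\<^sup>2 + \<eta> \<le> 0" unfolding Qeq by (simp add: W_def)
  moreover have "\<tau> x = - \<beta>" by (simp add: \<tau>_def)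
  moreover have "0 \<le> c / 8 * \<beta>\<^sup>2" using c1 by simp
  ultimately have "\<eta> \<le> s / 2 * \<beta>" by simp
  also have "\<dots> \<le> s / 2 * (s * k / c\<^sup>2)" using \<beta>\<delta> \<delta> s0 by (intro mult_left_mono) auto
  also have "\<dots> = 1 / 2 * (k * s\<^sup>2 / c\<^sup>2)" by (simp add: power2_eq_square)
  also have "\<dots> < \<eta>"
  proof -
    have "0 < k * s\<^sup>2 / c\<^sup>2" using k0 s0 c1 by simp
    then show ?thesis unfolding \<eta>_def by linarith
  qed
  finally show False by simp
qed

end

theorem theorem3p5:
  fixes E :: "(real^'n) set"
  assumes "CARD('n) \<ge> 2"
    and "E \<subseteq> sphere 0 1"
    and "\<not> (\<exists>a b. a \<noteq> 0 \<and> E \<subseteq> {x. a \<bullet> x = b})"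
  shows "\<exists>u :: real^'n \<Rightarrow> real.
           convex_on UNIV u \<and>
           (\<exists>L. L-lipschitz_on UNIV u) \<and>
           admissible_maximal_solution (\<lambda>x t. 1) UNIV u \<and>
           closure (gradient_image u UNIV) = closed_convex_hull E \<and>
           has_blowdown u (support_fun E)"
proof (intro exI conjI)
  \<comment> \<open>The empty set lies in every hyperplane, so a single nonzero normal shows that
    \<open>E\<close> is nonempty.\<close>
  have "axis undefined 1 \<noteq> (0 :: real^'n)" by (simp add: axis_eq_0_iff)
  then have ne: "E \<noteq> {}" using assms(3) by blast
  note E = assms(2) ne
  let ?\<Gamma> = "closed_convex_hull E"
  show "convex_on UNIV (perron E)" using perron_in_class[OF E] unfolding perron_class_def[OF E] by blast
  show "1-lipschitz_on UNIV (perron E)" by (rule perron_class_lipschitz[OF E perron_in_class[OF E]])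
  show "admissible_maximal_solution (\<lambda>x t. 1) UNIV (perron E)" by (rule perron_maximal[OF E])
  show "has_blowdown (perron E) (support_fun E)" by (rule perron_blowdown[OF E])
  have cl: "closed ?\<Gamma>" "convex ?\<Gamma>" by (simp_all add: closed_convex_hull_def convex_closure)
  \<comment> \<open>This is where the hyperplane hypothesis enters: a convex set with empty interior
    lies in a hyperplane.\<close>
  have int: "interior ?\<Gamma> \<noteq> {}"
  proof
    assume "interior ?\<Gamma> = {}"
    then obtain a b where ab: "a \<noteq> 0" "?\<Gamma> \<subseteq> {x. a \<bullet> x = b}"
      using empty_interior_subset_hyperplane[OF cl(2)] by metis
    have "E \<subseteq> ?\<Gamma>"
      unfolding closed_convex_hull_def using hull_subset[of E convex] closure_subset by blast
    then have "E \<subseteq> {x. a \<bullet> x = b}" using ab(2) by (rule subset_trans)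
    with ab(1) assms(3) show False by blast
  qed
  show "closure (gradient_image (perron E) UNIV) = ?\<Gamma>"
  proof
    show "closure (gradient_image (perron E) UNIV) \<subseteq> ?\<Gamma>"
      by (rule closure_minimal[OF _ cl(1)]) (auto simp: gradient_image_def intro: perron_grad_in_hull[OF E])
    have "interior ?\<Gamma> \<subseteq> closure (gradient_image (perron E) UNIV)"
    proof
      fix p assume p: "p \<in> interior ?\<Gamma>"
      show "p \<in> closure (gradient_image (perron E) UNIV)"
        unfolding closure_approachable
      proof (intro allI impI)
        fix d :: real assume d: "d > 0"
        obtain r where r: "r > 0" "ball p r \<subseteq> ?\<Gamma>" using p by (meson mem_interior)
        define t where "t = min 1 (min d r)"
        have t: "0 < t" "t \<le> 1" "t \<le> d" "ball p t \<subseteq> ?\<Gamma>" using d r by (auto simp: t_def)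
        obtain x where "perron E differentiable (at x)" "grad (perron E) x \<in> ball p t"
          using perron_gradient_in_ball[OF E t(1,2,4)] by blast
        then show "\<exists>y\<in>gradient_image (perron E) UNIV. dist y p < d"
          using t(3) by (intro bexI[of _ "grad (perron E) x"]) (auto simp: gradient_image_def dist_commute)
      qed
    qed
    \<comment> \<open>A closed convex set with interior points is the closure of its interior, so
      approximating interior points suffices.\<close>
    then have "closure (interior ?\<Gamma>) \<subseteq> closure (gradient_image (perron E) UNIV)"
      by (rule closure_minimal) simp
    then show "?\<Gamma> \<subseteq> closure (gradient_image (perron E) UNIV)"
      using convex_closure_interior[OF cl(2) int] closure_closed[OF cl(1)] by simp
  qed
qed

end
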